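(* Let $F$ be a strictly $r_0$-balanced $r_0$-graph with $2\le \Delta(F)<|F|$. For an integer $r\ge r_0$ let $(\ast)_r$ denote the following assertion: there exist constants $c,C>0$ such that for every function $p=p(n)\in(0,1]$, (1) if $p\gg n^{-r+r_0-\frac{1}{d_{r_0}(F)}}$, then a.a.s. $$\max\left\{c\,p\,n^{r-1},\ n^{r_0-\frac{1}{d_{r_0}(F)}}(\log n)^{-C}\right\}\le \mathrm{ex}(G^r_{n,p},F^{(r)})\le \max\left\{C\,p\,n^{r-1},\ n^{r_0-\frac{1}{d_{r_0}(F)}}(\log n)^{C}\right\};$$ (2) if $n^{-r}\ll p\ll n^{-r+r_0-\frac{1}{d_{r_0}(F)}}$, then a.a.s. $\mathrm{ex}(G^r_{n,p},F^{(r)})=(1+o(1))\,p\binom{n}{r}$. Then: if $F$ is Sidorenko, $(\ast)_r$ holds for every $r>|F|^2\,v(F)\,r_0$. Moreover, if there is no integer $k\ge r_0$ such that $F^{(k)}$ is Sidorenko, then $(\ast)_r$ fails for every $r\ge r_0$.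
   Context: An $r$-graph is a finite $r$-uniform hypergraph; $v(F)$ is its number of vertices, $|F|$ its number of edges, $\Delta(F)$ its maximum vertex degree. For an $r$-graph $F$ with $|F|\ge 2$, $d_r(F)=\max_{F'\subseteq F,\ |F'|\ge 2}\frac{|F'|-1}{v(F')-r}$. An $r_0$-graph $F$ with $|F|\ge 3$ is strictly $r_0$-balanced if $d_{r_0}(F)=\frac{|F|-1}{v(F)-r_0}$ and $\frac{|F'|-1}{v(F')-r_0}<d_{r_0}(F)$ for every proper subgraph $F'\subsetneq F$ with at least two edges. For an $r_0$-graph $F$ and $r\ge r_0$, the expansion $F^{(r)}$ is the $r$-graph obtained by inserting $r-r_0$ new vertices into each edge of $F$, all new vertices (over all edges) being distinct. A homomorphism from an $r$-graph $F$ to an $r$-graph $H$ is a map $\phi:V(F)\to V(H)$ with $\phi(e)\in E(H)$ for every $e\in E(F)$; $\hom(F,H)$ is the number of them and $t_F(H)=\hom(F,H)/v(H)^{v(F)}$. $F$ is Sidorenko if $t_F(H)\ge t_{K_r^r}(H)^{|F|}$ for every $r$-graph $H$, where $K_r^r$ is the $r$-graph consisting of a single edge. $G^r_{n,p}$ is the random $r$-graph on $n$ vertices in which each $r$-set is an edge independently with probability $p$. $\mathrm{ex}(G^r_{n,p},F)$ is the maximum number of edges in an $F$-free subgraph of $G^r_{n,p}$. Events $A_n$ hold a.a.s. if $\Pr[A_n]\to1$ as $n\to\infty$. $f(n)\ll g(n)$ (equivalently $g\gg f$) means $f(n)/g(n)\to0$. *)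

theory Defs
  imports "HOL-Probability.Probability"
begin

record 'a hypergraph =
  verts :: "'a set"
  edges :: "'a set set"

definition r_graph :: "nat \<Rightarrow> 'a hypergraph \<Rightarrow> bool" where
  "r_graph r F \<longleftrightarrow>
     finite (verts F) \<and> (\<forall>e\<in>edges F. e \<subseteq> verts F \<and> card e = r)"

abbreviation num_verts :: "'a hypergraph \<Rightarrow> nat" where
  "num_verts F \<equiv> card (verts F)"

abbreviation num_edges :: "'a hypergraph \<Rightarrow> nat" where
  "num_edges F \<equiv> card (edges F)"

definition max_degree :: "'a hypergraph \<Rightarrow> nat" where
  "max_degree F = Max ((\<lambda>x. card {e \<in> edges F. x \<in> e}) ` verts F)"

definition subgraph :: "'a hypergraph \<Rightarrow> 'a hypergraph \<Rightarrow> bool" where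
  "subgraph F' F \<longleftrightarrow>
     verts F' \<subseteq> verts F \<and> edges F' \<subseteq> edges F \<and> (\<forall>e\<in>edges F'. e \<subseteq> verts F')"

text \<open>If \<open>F\<close> is an \<open>r\<close>-graph with at least two edges, then it has more than \<open>r\<close> vertices,
  so the denominator below is positive wherever \<open>density_ratio\<close> is used.\<close>

definition density_ratio :: "nat \<Rightarrow> 'a hypergraph \<Rightarrow> real" where
  "density_ratio r F = (real (num_edges F) - 1) / (real (num_verts F) - real r)"

definition max_density :: "nat \<Rightarrow> 'a hypergraph \<Rightarrow> real" where
  "max_density r F = Max (density_ratio r ` {F'. subgraph F' F \<and> num_edges F' \<ge> 2})"

definition strictly_balanced :: "nat \<Rightarrow> 'a hypergraph \<Rightarrow> bool" where
  "strictly_balanced r F \<longleftrightarrow>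
     num_edges F \<ge> 3 \<and>
     max_density r F = density_ratio r F \<and>
     (\<forall>F'. subgraph F' F \<and> F' \<noteq> F \<and> num_edges F' \<ge> 2
            \<longrightarrow> density_ratio r F' < max_density r F)"

text \<open>The new vertices of the expansion of an \<open>r0\<close>-graph to an \<open>r\<close>-graph are the
  \<open>Inr (e, i)\<close> with \<open>e\<close> an edge and \<open>i < r - r0\<close>.\<close>

definition expansion ::
  "nat \<Rightarrow> nat \<Rightarrow> 'a hypergraph \<Rightarrow> ('a + 'a set \<times> nat) hypergraph" where
  "expansion r0 r F =
     \<lparr>verts = Inl ` verts F \<union> Inr ` (edges F \<times> {..<r - r0}),
      edges = (\<lambda>e. Inl ` e \<union> Inr ` ({e} \<times> {..<r - r0})) ` edges F\<rparr>"

definition homs :: "'a hypergraph \<Rightarrow> 'b hypergraph \<Rightarrow> ('a \<Rightarrow> 'b) set" where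
  "homs F H = {\<phi> \<in> verts F \<rightarrow>\<^sub>E verts H. \<forall>e\<in>edges F. \<phi> ` e \<in> edges H}"

definition hom_density :: "'a hypergraph \<Rightarrow> 'b hypergraph \<Rightarrow> real" where
  "hom_density F H = real (card (homs F H)) / real (num_verts H) ^ num_verts F"

definition single_edge :: "nat \<Rightarrow> nat hypergraph" where
  "single_edge r = \<lparr>verts = {..<r}, edges = {{..<r}}\<rparr>"

text \<open>Finite hypergraphs with vertices in \<open>nat\<close> represent all finite hypergraphs up to
  isomorphism. For \<open>H\<close> without vertices and \<open>F\<close> with an edge, the inequality reads
  \<open>0 \<ge> 0\<close>, because \<open>x / 0 = 0\<close>.\<close>

definition sidorenko :: "nat \<Rightarrow> 'a hypergraph \<Rightarrow> bool" where
  "sidorenko r F \<longleftrightarrow>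
     (\<forall>H :: nat hypergraph. r_graph r H \<longrightarrow>
        hom_density F H \<ge> hom_density (single_edge r) H ^ num_edges F)"

text \<open>Copies are not required to be induced.\<close>

definition contains_copy :: "'a hypergraph \<Rightarrow> 'b hypergraph \<Rightarrow> bool" where
  "contains_copy G F \<longleftrightarrow> (\<exists>\<phi> \<in> homs F G. inj_on \<phi> (verts F))"

definition ex_number :: "'a hypergraph \<Rightarrow> 'b hypergraph \<Rightarrow> nat" where
  "ex_number G F = Max (num_edges ` {G'. subgraph G' G \<and> \<not> contains_copy G' F})"

definition random_r_graph :: "nat \<Rightarrow> nat \<Rightarrow> real \<Rightarrow> nat hypergraph pmf" where
  "random_r_graph r n p =
     (let K = {e. e \<subseteq> {..<n} \<and> card e = r}
      in map_pmf (\<lambda>f. \<lparr>verts = {..<n}, edges = {e \<in> K. f e}\<rparr>)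
           (Pi_pmf K False (\<lambda>_. bernoulli_pmf p)))"

definition aas :: "(nat \<Rightarrow> 'a pmf) \<Rightarrow> (nat \<Rightarrow> 'a \<Rightarrow> bool) \<Rightarrow> bool" where
  "aas M A \<longleftrightarrow> (\<lambda>n. measure_pmf.prob (M n) {x. A n x}) \<longlonglongrightarrow> 1"

definition much_less :: "(nat \<Rightarrow> real) \<Rightarrow> (nat \<Rightarrow> real) \<Rightarrow> bool" (infix "\<lless>" 50) where
  "f \<lless> g \<longleftrightarrow> (\<lambda>n. f n / g n) \<longlonglongrightarrow> 0"

definition upper_range :: "nat \<Rightarrow> 'a hypergraph \<Rightarrow> nat \<Rightarrow> real \<Rightarrow> real \<Rightarrow> (nat \<Rightarrow> real) \<Rightarrow> bool" where
  "upper_range r0 F r c C p \<longleftrightarrow>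
     (let d = max_density r0 F in
      (\<lambda>n. real n powr (- real r + real r0 - 1 / d)) \<lless> p \<longrightarrow>
      aas (\<lambda>n. random_r_graph r n (p n))
        (\<lambda>n G.
           max (c * p n * real n ^ (r - 1))
               (real n powr (real r0 - 1 / d) * ln (real n) powr (- C))
             \<le> real (ex_number G (expansion r0 r F)) \<and>
           real (ex_number G (expansion r0 r F))
             \<le> max (C * p n * real n ^ (r - 1))
                   (real n powr (real r0 - 1 / d) * ln (real n) powr C)))"

definition lower_range :: "nat \<Rightarrow> 'a hypergraph \<Rightarrow> nat \<Rightarrow> (nat \<Rightarrow> real) \<Rightarrow> bool" where
  "lower_range r0 F r p \<longleftrightarrow>
     (let d = max_density r0 F in
      (\<lambda>n. real n powr (- real r)) \<lless> p \<and>
      p \<lless> (\<lambda>n. real n powr (- real r + real r0 - 1 / d)) \<longrightarrow>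
      (\<forall>\<epsilon>>0. aas (\<lambda>n. random_r_graph r n (p n))
        (\<lambda>n G. \<bar>real (ex_number G (expansion r0 r F)) - p n * real (n choose r)\<bar>
                 \<le> \<epsilon> * (p n * real (n choose r)))))"

definition turan_assertion :: "nat \<Rightarrow> 'a hypergraph \<Rightarrow> nat \<Rightarrow> bool" where
  "turan_assertion r0 F r \<longleftrightarrow>
     (\<exists>c>0. \<exists>C>0. \<forall>p. (\<forall>n. 0 < p n \<and> p n \<le> 1) \<longrightarrow>
        upper_range r0 F r c C p \<and> lower_range r0 F r p)"

end

theory Submission
  imports Defs "HOL-Real_Asymp.Real_Asymp"
begin

text \<open>
  Upper bound in the Sidorenko case. Call a probability weight on the copies of the expansion in an
  \<open>r\<close>-graph \<open>H\<close> spread if every set of \<open>j\<close> edges carries weight at most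
  \<open>K m\<^sup>j\<^sup>-\<^sup>1 / \<bar>H\<bar>\<^sup>j\<close>, where \<open>m = n powr (r0 - 1/d)\<close> and \<open>K\<close> is polylogarithmic. A spread weight
  gives \<open>exp (m polylog n)\<close> containers for the copy-free subgraphs of \<open>H\<close>, each missing a
  \<open>1/polylog n\<close> proportion of \<open>H\<close>; iterating from the complete \<open>r\<close>-graph until \<open>O(n\<^sup>r\<^sup>-\<^sup>1)\<close> edges are left
  and taking a union bound over the containers gives the upper bound. To find a spread weight in \<open>H\<close>
  with at least \<open>K\<^sub>0 n\<^sup>r\<^sup>-\<^sup>1\<close> edges, cut each edge into disjoint blocks of size \<open>r0\<close>. Since \<open>r\<close> is large, some
  choice of a block per edge projects \<open>H\<close> onto an \<open>r0\<close>-graph of density at least \<open>n powr (- \<delta>)\<close> with a tiny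
  \<open>\<delta>\<close>; there the Sidorenko property yields enough copies of \<open>F\<close>, and the strictness in strict
  balancedness absorbs the loss of powers of \<open>n powr \<delta>\<close>.

  The lower bounds come from a star and from deleting an edge of each copy. If the expansion is not
  Sidorenko, witnessed by \<open>H\<close>, then the common preimage of \<open>H\<close> under about \<open>a ln n\<close> random maps has
  polynomially fewer copies than a random hypergraph of the same density, so that deletion beats
  \<open>n powr (r0 - 1/d)\<close> by a power of \<open>n\<close>.
\<close>

section \<open>Containers from spread weights\<close>

text \<open>Write \<open>s\<close> and \<open>v\<close> for the numbers of edges and vertices of
  \<open>F\<close>. The bound r > s^2 v r0 makes room for q = s^2 v disjoint blocks in an edge, and
  \<delta> = 2 / q. Two conditions on \<delta> are at stake. With \<delta> s < 1, the homomorphisms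
  supplied by the Sidorenko property, about n powr (v - \<delta> s) up to logarithms, outnumber the
  at most v^2 n^(v-1) non-injective maps. With \<delta> (s - 2) (s - 1) \<le> 1, the integrality gap
  in strict balancedness covers the loss in the codegrees. The degree D of the projection is known
  only within a factor of about n powr \<delta>. It cancels from the number of copies: a larger D
  means a sparser projection, but equally many more choices for the new vertices. D survives only in
  the codegrees of proper subgraphs, where there is slack; for the full edge set there is neither
  slack nor loss. The uniform weight on all copies may load single edges too heavily, which is why a
  balanced subfamily of copies is selected. The condition 2 \<le> \<Delta> yields r0 - 1/d > 1, and
  \<Delta> < s keeps stars free of the expansion.\<close>

definition wdeg :: "'x set \<Rightarrow> ('x set \<Rightarrow> real) \<Rightarrow> 'x set \<Rightarrow> real" where
  "wdeg X w J = (\<Sum>e | e \<subseteq> X \<and> J \<subseteq> e. w e)"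

text \<open>With \<open>\<tau>\<close> = m / card X the bound on \<open>J\<close> is K m^(j-1) /
  (card X)^j, where j = card J. The total is bounded below by \<open>c\<close> instead of being
  normalised, because the weights arising in the container recursion are sums of links, whose total
  is only known to be large.\<close>

definition spread_weight :: "'x set \<Rightarrow> real \<Rightarrow> nat \<Rightarrow> real \<Rightarrow> real \<Rightarrow> ('x set \<Rightarrow> real) \<Rightarrow> bool" where
  "spread_weight X \<tau> k K c w \<longleftrightarrow>
     (\<forall>e. 0 \<le> w e) \<and> (\<forall>e. w e \<noteq> 0 \<longrightarrow> e \<subseteq> X \<and> card e = k) \<and>
     c \<le> wdeg X w {} \<and>
     (\<forall>J. J \<noteq> {} \<longrightarrow> wdeg X w J \<le> K / real (card X) * \<tau> ^ (card J - 1))"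

text \<open>When a vertex \<open>v\<close> enters the fingerprint, its link is added to the weight \<open>u\<close> on \<open>k\<close>-sets collected
  so far, except on sets containing a saturated set; this keeps \<open>u\<close> spread.\<close>

definition saturated :: "'x set \<Rightarrow> real \<Rightarrow> real \<Rightarrow> ('x set \<Rightarrow> real) \<Rightarrow> 'x set \<Rightarrow> bool" where
  "saturated X \<tau> K u J \<longleftrightarrow> J \<noteq> {} \<and> K / real (card X) * \<tau> ^ (card J - 1) \<le> wdeg X u J"

text \<open>The division by \<open>\<tau>\<close> offsets the drop in uniformity: a bound with
  exponent \<open>card (insert v J) - 1\<close> for \<open>w\<close> becomes one with exponent
  \<open>card J - 1\<close> for the link. Saturation is measured by \<open>u\<close>, the weight
  collected before \<open>v\<close>.\<close>

definition link ::
  "'x set \<Rightarrow> real \<Rightarrow> real \<Rightarrow> ('x set \<Rightarrow> real) \<Rightarrow> ('x set \<Rightarrow> real) \<Rightarrow> 'x \<Rightarrow> 'x set \<Rightarrow> real" where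
  "link X \<tau> K w u v e =
     (if e \<subseteq> X \<and> v \<notin> e \<and> (\<forall>J\<subseteq>e. \<not> saturated X \<tau> K u J) then w (insert v e) / \<tau> else 0)"

text \<open>The head of the list is the vertex chosen last: its link is trimmed by the sets that the
  tail has saturated.\<close>

primrec link_sum ::
  "'x set \<Rightarrow> real \<Rightarrow> real \<Rightarrow> ('x set \<Rightarrow> real) \<Rightarrow> 'x list \<Rightarrow> 'x set \<Rightarrow> real" where
  "link_sum X \<tau> K w [] = (\<lambda>_. 0)"
| "link_sum X \<tau> K w (v # T) = (\<lambda>e. link_sum X \<tau> K w T e + link X \<tau> K w (link_sum X \<tau> K w T) v e)"

lemma wdeg_nonneg: "(\<And>e. 0 \<le> w e) \<Longrightarrow> 0 \<le> wdeg X w J"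
  by (simp add: wdeg_def sum_nonneg)

lemma wdeg_add: "wdeg X (\<lambda>e. u e + w e) J = wdeg X u J + wdeg X w J"
  by (simp add: wdeg_def sum.distrib)

lemma sum_insert_eq_wdeg:
  assumes "finite X" "v \<in> X" "v \<notin> J"
  shows "(\<Sum>e | e \<subseteq> X \<and> J \<subseteq> e \<and> v \<notin> e. w (insert v e)) = wdeg X w (insert v J)"
proof -
  have "(\<Sum>e | e \<subseteq> X \<and> J \<subseteq> e \<and> v \<notin> e. w (insert v e)) = (\<Sum>e | e \<subseteq> X \<and> insert v J \<subseteq> e. w e)"
    by (rule sum.reindex_bij_witness[where j = "insert v" and i = "\<lambda>e. e - {v}"])
      (use assms in \<open>auto simp: insert_absorb\<close>)
  then show ?thesis by (simp add: wdeg_def)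
qed

lemma sum_wdeg_singleton:
  assumes "finite X"
  shows "(\<Sum>x\<in>X. wdeg X w {x}) = (\<Sum>e | e \<subseteq> X. real (card e) * w e)"
proof -
  have "(\<Sum>x\<in>X. wdeg X w {x}) = (\<Sum>x\<in>X. \<Sum>e | e \<subseteq> X. if x \<in> e then w e else 0)"
    unfolding wdeg_def using assms by (intro sum.cong[OF refl], intro sum.mono_neutral_cong_left) auto
  also have "\<dots> = (\<Sum>e | e \<subseteq> X. \<Sum>x\<in>X. if x \<in> e then w e else 0)"
    by (rule sum.swap)
  also have "\<dots> = (\<Sum>e | e \<subseteq> X. real (card e) * w e)"
  proof (intro sum.cong refl)
    fix e assume "e \<in> {e. e \<subseteq> X}"
    then have "(\<Sum>x\<in>X. if x \<in> e then w e else 0) = (\<Sum>x\<in>e. w e)"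
      using assms by (intro sum.mono_neutral_cong_right) auto
    then show "(\<Sum>x\<in>X. if x \<in> e then w e else 0) = real (card e) * w e" by simp
  qed
  finally show ?thesis .
qed

text \<open>Every set in the support has 2 ^ k subsets. This bounds the cost of charging every
  saturated set to its degree.\<close>

lemma sum_wdeg_all:
  assumes "finite X" "\<And>e. w e \<noteq> 0 \<Longrightarrow> card e = k"
  shows "(\<Sum>J | J \<subseteq> X. wdeg X w J) = 2 ^ k * wdeg X w {}"
proof -
  have "(\<Sum>J | J \<subseteq> X. wdeg X w J) = (\<Sum>J | J \<subseteq> X. \<Sum>e | e \<subseteq> X. if J \<subseteq> e then w e else 0)"
    unfolding wdeg_def using assms by (intro sum.cong[OF refl], intro sum.mono_neutral_cong_left) auto
  also have "\<dots> = (\<Sum>e | e \<subseteq> X. \<Sum>J | J \<subseteq> X. if J \<subseteq> e then w e else 0)"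
    by (rule sum.swap)
  also have "\<dots> = (\<Sum>e | e \<subseteq> X. 2 ^ k * w e)"
  proof (intro sum.cong refl)
    fix e assume e: "e \<in> {e. e \<subseteq> X}"
    then have "(\<Sum>J | J \<subseteq> X. if J \<subseteq> e then w e else 0) = (\<Sum>J\<in>Pow e. w e)"
      using assms by (intro sum.mono_neutral_cong_right) auto
    also have "\<dots> = 2 ^ k * w e"
      using assms(1) assms(2)[of e] e by (cases "w e = 0") (auto simp: card_Pow finite_subset)
    finally show "(\<Sum>J | J \<subseteq> X. if J \<subseteq> e then w e else 0) = 2 ^ k * w e" .
  qed
  finally show ?thesis by (simp add: wdeg_def sum_distrib_left)
qed

lemma link_nonneg: "0 < \<tau> \<Longrightarrow> (\<And>e. 0 \<le> w e) \<Longrightarrow> 0 \<le> link X \<tau> K w u v e"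
  by (simp add: link_def)

lemma link_sum_nonneg: "0 < \<tau> \<Longrightarrow> (\<And>e. 0 \<le> w e) \<Longrightarrow> 0 \<le> link_sum X \<tau> K w T e"
  by (induction T) (auto simp: link_nonneg)

lemma link_sum_support: "link_sum X \<tau> K w T e \<noteq> 0 \<Longrightarrow> e \<subseteq> X \<and> (\<exists>v\<in>set T. v \<notin> e \<and> w (insert v e) \<noteq> 0)"
  by (induction T) (auto simp: link_def split: if_splits)

lemma wdeg_link_le:
  assumes X: "finite X" "v \<in> X" and "0 < \<tau>" "0 < K" and w: "spread_weight X \<tau> (Suc k) K c w" and J: "J \<noteq> {}"
  shows "wdeg X (link X \<tau> K w u v) J \<le> K / real (card X) * \<tau> ^ (card J - 1)"
proof (cases "v \<in> J \<or> \<not> J \<subseteq> X")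
  case True
  have "wdeg X (link X \<tau> K w u v) J = 0"
    unfolding wdeg_def by (rule sum.neutral) (use True in \<open>auto simp: link_def\<close>)
  then show ?thesis using assms by simp
next
  case False
  have nn: "\<And>e. 0 \<le> w e" using w by (auto simp: spread_weight_def)
  have fJ: "finite J" using False X finite_subset by blast
  have "wdeg X (link X \<tau> K w u v) J \<le> (\<Sum>e | e \<subseteq> X \<and> J \<subseteq> e. if v \<notin> e then w (insert v e) / \<tau> else 0)"
    unfolding wdeg_def by (rule sum_mono) (use nn \<open>0 < \<tau>\<close> in \<open>auto simp: link_def\<close>)
  also have "\<dots> = (\<Sum>e | e \<subseteq> X \<and> J \<subseteq> e \<and> v \<notin> e. w (insert v e)) / \<tau>"
    unfolding sum_divide_distrib using X by (intro sum.mono_neutral_cong_right) auto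
  also have "\<dots> = wdeg X w (insert v J) / \<tau>"
    using False X by (subst sum_insert_eq_wdeg) auto
  also have "\<dots> \<le> K / real (card X) * \<tau> ^ (card (insert v J) - 1) / \<tau>"
    using w \<open>0 < \<tau>\<close> by (intro divide_right_mono) (auto simp: spread_weight_def)
  also have "card (insert v J) - 1 = Suc (card J - 1)"
    using False fJ J by (simp add: Suc_leI card_gt_0_iff)
  finally show ?thesis using \<open>0 < \<tau>\<close> by simp
qed

lemma wdeg_link_saturated:
  assumes "saturated X \<tau> K u J"
  shows "wdeg X (link X \<tau> K w u v) J = 0"
  unfolding wdeg_def by (rule sum.neutral) (use assms in \<open>auto simp: link_def\<close>)

text \<open>A nonempty set below the saturation threshold gains at most one more threshold from a
  single link, and a saturated set gains nothing. So twice the threshold is never exceeded, whatever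
  the length of \<open>T\<close>.\<close>

lemma wdeg_link_sum_le:
  assumes X: "finite X" and "0 < \<tau>" "0 < K" and w: "spread_weight X \<tau> (Suc k) K c w" and J: "J \<noteq> {}"
    and T: "set T \<subseteq> X"
  shows "wdeg X (link_sum X \<tau> K w T) J \<le> 2 * K / real (card X) * \<tau> ^ (card J - 1)"
  using T
proof (induction T)
  case Nil
  then show ?case using assms by (simp add: wdeg_def)
next
  case (Cons v T)
  show ?case
  proof (cases "saturated X \<tau> K (link_sum X \<tau> K w T) J")
    case True
    then show ?thesis using Cons by (simp add: wdeg_add wdeg_link_saturated)
  next
    case False
    then have "wdeg X (link_sum X \<tau> K w T) J < K / real (card X) * \<tau> ^ (card J - 1)"
      using J by (simp add: saturated_def)
    then show ?thesis
      using wdeg_link_le[OF X _ assms(2,3) w J, of v "link_sum X \<tau> K w T"] Cons(2)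
      by (simp add: wdeg_add mult.assoc)
  qed
qed

text \<open>A set of positive weight has at least one point, so the total is at most the sum of all
  degrees.\<close>

lemma wdeg_total_le:
  assumes X: "finite X" and k: "1 \<le> k" and nn: "\<And>e. 0 \<le> u e"
    and supp: "\<And>e. u e \<noteq> 0 \<Longrightarrow> card e = k" and K: "0 \<le> K"
    and bd: "\<And>x. x \<in> X \<Longrightarrow> wdeg X u {x} \<le> K / real (card X)"
  shows "wdeg X u {} \<le> K"
proof -
  have "wdeg X u {} \<le> (\<Sum>e | e \<subseteq> X. real (card e) * u e)"
    unfolding wdeg_def
  proof (simp, rule sum_mono)
    fix e
    show "u e \<le> real (card e) * u e"
      using supp[of e] nn[of e] k by (cases "u e = 0") (auto simp: mult_le_cancel_right1)
  qed
  also have "\<dots> = (\<Sum>x\<in>X. wdeg X u {x})"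
    using X by (simp add: sum_wdeg_singleton)
  also have "\<dots> \<le> (\<Sum>x\<in>X. K / real (card X))"
    by (rule sum_mono) (use bd in auto)
  also have "\<dots> \<le> K" using K by (cases "card X = 0") auto
  finally show ?thesis .
qed

text \<open>Either the vertices of small gain leave a positive proportion of \<open>X\<close> uncovered, or most of
  the weight of \<open>w\<close> lies on saturated sets, which is only possible if \<open>u\<close> has large total weight.\<close>

lemma total_weight_dichotomy:
  assumes X: "finite X" and \<tau>: "0 < \<tau>" and K: "0 < K" and w: "spread_weight X \<tau> (Suc k) K c w"
    and u: "\<And>e. 0 \<le> u e" "\<And>e. u e \<noteq> 0 \<Longrightarrow> card e = k"
    and C: "C = {v \<in> X. wdeg X (link X \<tau> K w u v) {} < c / (4 * real (card X) * \<tau>)}"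
    and big: "real (card C) \<ge> (1 - \<beta>) * real (card X)" and \<beta>: "\<beta> * K \<le> c / 4" and c: "0 < c"
    and ne: "X \<noteq> {}"
  shows "c \<le> 2 * (real k + 1) * 2 ^ k * wdeg X u {}"
proof -
  define N where "N = real (card X)"
  have N: "N > 0" using X ne by (simp add: N_def card_gt_0_iff)
  have nn: "\<And>e. 0 \<le> w e" and supp: "\<And>e. w e \<noteq> 0 \<Longrightarrow> card e = Suc k" and cw: "c \<le> wdeg X w {}"
    using w by (auto simp: spread_weight_def)
  have wJ: "\<And>J. J \<noteq> {} \<Longrightarrow> wdeg X w J \<le> K / N * \<tau> ^ (card J - 1)"
    using w by (auto simp: spread_weight_def N_def)
  let ?S = "saturated X \<tau> K u"
  have CX: "C \<subseteq> X" using C by auto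
  have fin: "finite {e. e \<subseteq> X}" using X by simp
  have "(real k + 1) * wdeg X w {} = (\<Sum>v\<in>X. wdeg X w {v})"
    unfolding sum_wdeg_singleton[OF X]
    unfolding wdeg_def sum_distrib_left
  proof (rule sum.cong)
    show "(real k + 1) * w e = real (card e) * w e" for e
      using supp[of e] by (cases "w e = 0") auto
  qed simp
  also have "\<dots> = (\<Sum>v\<in>X. \<Sum>e | e \<subseteq> X \<and> v \<notin> e. w (insert v e))"
    using sum_insert_eq_wdeg[OF X, of _ "{}" w] by (intro sum.cong) auto
  \<comment> \<open>For each \<open>v\<close>, a set \<open>e\<close> with \<open>insert v e\<close>
    in the support either enters the link of \<open>v\<close> or contains a saturated
    \<open>J\<close>. The minimum keeps two bounds at hand: the small gain for \<open>v\<close> in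
    \<open>C\<close>, and the degree condition on \<open>w\<close> for the other vertices.\<close>
  also have "\<dots> \<le> (\<Sum>v\<in>X. min (wdeg X w {v}) (\<tau> * wdeg X (link X \<tau> K w u v) {}) +
       (\<Sum>J | J \<subseteq> X \<and> ?S J. \<Sum>e | e \<subseteq> X \<and> J \<subseteq> e \<and> v \<notin> e. w (insert v e)))"
  proof (rule sum_mono)
    fix v assume v: "v \<in> X"
    have "(\<Sum>e | e \<subseteq> X \<and> v \<notin> e. w (insert v e)) =
       (\<Sum>e | e \<subseteq> X. \<tau> * link X \<tau> K w u v e) +
       (\<Sum>e | e \<subseteq> X \<and> v \<notin> e \<and> (\<exists>J\<subseteq>e. ?S J). w (insert v e))" (is "?L = ?A + ?B")
    proof -
      have A: "?A = (\<Sum>e | e \<subseteq> X \<and> v \<notin> e \<and> \<not> (\<exists>J\<subseteq>e. ?S J). w (insert v e))"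
        using fin \<tau> by (intro sum.mono_neutral_cong_right) (auto simp: link_def)
      have "?L = (\<Sum>e \<in> {e. e \<subseteq> X \<and> v \<notin> e \<and> \<not> (\<exists>J\<subseteq>e. ?S J)} \<union>
          {e. e \<subseteq> X \<and> v \<notin> e \<and> (\<exists>J\<subseteq>e. ?S J)}. w (insert v e))"
        by (rule sum.cong) auto
      also have "\<dots> = (\<Sum>e | e \<subseteq> X \<and> v \<notin> e \<and> \<not> (\<exists>J\<subseteq>e. ?S J). w (insert v e)) + ?B"
        using fin by (subst sum.union_disjoint) auto
      finally show ?thesis using A by simp
    qed
    moreover have "?B \<le> (\<Sum>J | J \<subseteq> X \<and> ?S J. \<Sum>e | e \<subseteq> X \<and> J \<subseteq> e \<and> v \<notin> e. w (insert v e))"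
    proof -
      have "?B \<le> (\<Sum>e | e \<subseteq> X \<and> v \<notin> e. \<Sum>J | J \<subseteq> X \<and> ?S J. if J \<subseteq> e then w (insert v e) else 0)"
      proof -
        have "?B \<le> (\<Sum>e | e \<subseteq> X \<and> v \<notin> e \<and> (\<exists>J\<subseteq>e. ?S J).
            \<Sum>J | J \<subseteq> X \<and> ?S J. if J \<subseteq> e then w (insert v e) else 0)"
        proof (rule sum_mono)
          fix e assume "e \<in> {e. e \<subseteq> X \<and> v \<notin> e \<and> (\<exists>J\<subseteq>e. ?S J)}"
          then obtain J where J: "J \<subseteq> e" "?S J" "e \<subseteq> X" by auto
          have "w (insert v e) = (\<Sum>J\<in>{J}. if J \<subseteq> e then w (insert v e) else 0)" using J by simp
          also have "\<dots> \<le> (\<Sum>J | J \<subseteq> X \<and> ?S J. if J \<subseteq> e then w (insert v e) else 0)"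
            using J nn fin by (intro sum_mono2) auto
          finally show "w (insert v e) \<le> \<dots>" .
        qed
        also have "\<dots> \<le> (\<Sum>e | e \<subseteq> X \<and> v \<notin> e.
            \<Sum>J | J \<subseteq> X \<and> ?S J. if J \<subseteq> e then w (insert v e) else 0)"
          using nn fin by (intro sum_mono2) (auto intro!: sum_nonneg)
        finally show ?thesis .
      qed
      also have "\<dots> = (\<Sum>J | J \<subseteq> X \<and> ?S J. \<Sum>e | e \<subseteq> X \<and> v \<notin> e. if J \<subseteq> e then w (insert v e) else 0)"
        by (rule sum.swap)
      also have "\<dots> = (\<Sum>J | J \<subseteq> X \<and> ?S J. \<Sum>e | e \<subseteq> X \<and> J \<subseteq> e \<and> v \<notin> e. w (insert v e))"
        using fin by (intro sum.cong refl sum.mono_neutral_cong_right) auto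
      finally show ?thesis .
    qed
    moreover have "?A = \<tau> * wdeg X (link X \<tau> K w u v) {}"
      by (simp add: wdeg_def sum_distrib_left)
    moreover have "?A \<le> wdeg X w {v}"
    proof -
      have "?A \<le> (\<Sum>e | e \<subseteq> X. if v \<notin> e then w (insert v e) else 0)"
        using nn \<tau> by (intro sum_mono) (auto simp: link_def)
      also have "\<dots> = (\<Sum>e | e \<subseteq> X \<and> {} \<subseteq> e \<and> v \<notin> e. w (insert v e))"
        using fin by (intro sum.mono_neutral_cong_right) auto
      also have "\<dots> = wdeg X w {v}" using sum_insert_eq_wdeg[OF X v, of "{}" w] by simp
      finally show ?thesis .
    qed
    ultimately show "(\<Sum>e | e \<subseteq> X \<and> v \<notin> e. w (insert v e)) \<le>
        min (wdeg X w {v}) (\<tau> * wdeg X (link X \<tau> K w u v) {}) +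
       (\<Sum>J | J \<subseteq> X \<and> ?S J. \<Sum>e | e \<subseteq> X \<and> J \<subseteq> e \<and> v \<notin> e. w (insert v e))"
      by simp
  qed
  also have "\<dots> = (\<Sum>v\<in>X. min (wdeg X w {v}) (\<tau> * wdeg X (link X \<tau> K w u v) {})) +
       (\<Sum>v\<in>X. \<Sum>J | J \<subseteq> X \<and> ?S J. \<Sum>e | e \<subseteq> X \<and> J \<subseteq> e \<and> v \<notin> e. w (insert v e))"
    by (simp add: sum.distrib)
  \<comment> \<open>\<open>C\<close> contributes at most c / 4 because of its small gains; the at
    most \<beta> card X other vertices contribute K / card X each, again at most c / 4
    together.\<close>
  also have "\<dots> \<le> c / 2 + (real k + 1) * (2 ^ k * wdeg X u {})"
  proof (rule add_mono)
    have "(\<Sum>v\<in>X. min (wdeg X w {v}) (\<tau> * wdeg X (link X \<tau> K w u v) {})) =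
       (\<Sum>v\<in>C. min (wdeg X w {v}) (\<tau> * wdeg X (link X \<tau> K w u v) {})) +
       (\<Sum>v\<in>X - C. min (wdeg X w {v}) (\<tau> * wdeg X (link X \<tau> K w u v) {}))"
      using sum.subset_diff[OF CX X] by (simp add: add.commute)
    also have "\<dots> \<le> (\<Sum>v\<in>C. c / (4 * N)) + (\<Sum>v\<in>X - C. K / N)"
    proof (intro add_mono sum_mono)
      fix v assume "v \<in> C"
      then have "\<tau> * wdeg X (link X \<tau> K w u v) {} < \<tau> * (c / (4 * N * \<tau>))"
        using \<tau> by (intro mult_strict_left_mono) (simp_all add: C N_def)
      then show "min (wdeg X w {v}) (\<tau> * wdeg X (link X \<tau> K w u v) {}) \<le> c / (4 * N)"
        using \<tau> N by simp
    next
      fix v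
      show "min (wdeg X w {v}) (\<tau> * wdeg X (link X \<tau> K w u v) {}) \<le> K / N"
        using wJ[of "{v}"] by simp
    qed
    also have "\<dots> = real (card C) * c / (4 * N) + (N - real (card C)) * (K / N)"
      using CX X by (simp add: card_Diff_subset finite_subset N_def of_nat_diff card_mono)
    also have "\<dots> \<le> N * c / (4 * N) + (\<beta> * N) * (K / N)"
    proof (intro add_mono mult_right_mono divide_right_mono)
      show "real (card C) \<le> N" using CX X by (simp add: N_def card_mono)
      show "N - real (card C) \<le> \<beta> * N" using big by (simp add: N_def algebra_simps)
    qed (use N c K in auto)
    also have "\<dots> \<le> c / 2" using N \<beta> by simp
    finally show "(\<Sum>v\<in>X. min (wdeg X w {v}) (\<tau> * wdeg X (link X \<tau> K w u v) {})) \<le> c / 2" .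
  next
    have "(\<Sum>v\<in>X. \<Sum>J | J \<subseteq> X \<and> ?S J. \<Sum>e | e \<subseteq> X \<and> J \<subseteq> e \<and> v \<notin> e. w (insert v e)) =
       (\<Sum>J | J \<subseteq> X \<and> ?S J. \<Sum>v\<in>X. \<Sum>e | e \<subseteq> X \<and> J \<subseteq> e \<and> v \<notin> e. w (insert v e))"
      by (rule sum.swap)
    also have "\<dots> \<le> (\<Sum>J | J \<subseteq> X \<and> ?S J. (real k + 1) * wdeg X u J)"
    proof (rule sum_mono)
      fix J assume J: "J \<in> {J. J \<subseteq> X \<and> ?S J}"
      have "(\<Sum>v\<in>X. \<Sum>e | e \<subseteq> X \<and> J \<subseteq> e \<and> v \<notin> e. w (insert v e)) \<le>
          (\<Sum>v\<in>X. \<Sum>e | e \<subseteq> X \<and> J \<subseteq> e. if v \<in> e then w e else 0)"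
      proof (rule sum_mono)
        fix v assume v: "v \<in> X"
        have "(\<Sum>e | e \<subseteq> X \<and> J \<subseteq> e \<and> v \<notin> e. w (insert v e)) \<le> (\<Sum>e | e \<subseteq> X \<and> insert v J \<subseteq> e. w e)"
        proof (cases "v \<in> J")
          case True
          then have "{e. e \<subseteq> X \<and> J \<subseteq> e \<and> v \<notin> e} = {}" by auto
          then show ?thesis using nn by (simp only: sum.empty) (rule sum_nonneg, auto)
        next
          case False
          then show ?thesis using sum_insert_eq_wdeg[OF X v False, of w] by (simp add: wdeg_def)
        qed
        also have "\<dots> = (\<Sum>e | e \<subseteq> X \<and> J \<subseteq> e. if v \<in> e then w e else 0)"
          using fin by (intro sum.mono_neutral_cong_left) auto
        finally show "(\<Sum>e | e \<subseteq> X \<and> J \<subseteq> e \<and> v \<notin> e. w (insert v e)) \<le>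
          (\<Sum>e | e \<subseteq> X \<and> J \<subseteq> e. if v \<in> e then w e else 0)" .
      qed
      also have "\<dots> = (\<Sum>e | e \<subseteq> X \<and> J \<subseteq> e. \<Sum>v\<in>X. if v \<in> e then w e else 0)"
        by (rule sum.swap)
      also have "\<dots> = (\<Sum>e | e \<subseteq> X \<and> J \<subseteq> e. (real k + 1) * w e)"
      proof (rule sum.cong[OF refl])
        fix e assume e: "e \<in> {e. e \<subseteq> X \<and> J \<subseteq> e}"
        then have "(\<Sum>v\<in>X. if v \<in> e then w e else 0) = (\<Sum>v\<in>e. w e)"
          using X by (intro sum.mono_neutral_cong_right) auto
        then show "(\<Sum>v\<in>X. if v \<in> e then w e else 0) = (real k + 1) * w e"
          using supp[of e] by (cases "w e = 0") auto
      qed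
      also have "\<dots> = (real k + 1) * wdeg X w J" by (simp add: wdeg_def sum_distrib_left)
      \<comment> \<open>The degree of a saturated \<open>J\<close> in \<open>u\<close> is at least
        the threshold that bounds its degree in \<open>w\<close>, so \<open>u\<close> pays for what
        the link of \<open>v\<close> had to drop.\<close>
      also have "\<dots> \<le> (real k + 1) * wdeg X u J"
        using J wJ[of J] by (intro mult_left_mono) (auto simp: saturated_def N_def)
      finally show "(\<Sum>v\<in>X. \<Sum>e | e \<subseteq> X \<and> J \<subseteq> e \<and> v \<notin> e. w (insert v e)) \<le> (real k + 1) * wdeg X u J" .
    qed
    also have "\<dots> \<le> (\<Sum>J | J \<subseteq> X. (real k + 1) * wdeg X u J)"
      using fin u(1) by (intro sum_mono2) (auto simp: wdeg_nonneg)
    also have "\<dots> = (real k + 1) * (2 ^ k * wdeg X u {})"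
      using sum_wdeg_all[OF X u(2)] by (simp add: sum_distrib_left[symmetric])
    finally show "(\<Sum>v\<in>X. \<Sum>J | J \<subseteq> X \<and> ?S J. \<Sum>e | e \<subseteq> X \<and> J \<subseteq> e \<and> v \<notin> e. w (insert v e))
        \<le> (real k + 1) * (2 ^ k * wdeg X u {})" .
  qed
  finally have "(real k + 1) * wdeg X w {} \<le> c / 2 + (real k + 1) * (2 ^ k * wdeg X u {})" .
  moreover have "c \<le> (real k + 1) * wdeg X w {}"
    using cw c by (smt (verit) mult_le_cancel_right1 of_nat_0_le_iff)
  ultimately show ?thesis by (simp add: algebra_simps)
qed


section \<open>Fingerprints and the container recursion\<close>

lemma card_lists_length_le_power:
  assumes "finite X"
  shows "card {T. set T \<subseteq> X \<and> length T \<le> b} \<le> (card X + 1) ^ b"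
proof -
  have "card {T. set T \<subseteq> X \<and> length T \<le> b} = (\<Sum>i\<le>b. card X ^ i)"
    using card_lists_length_le[OF assms] by simp
  also have "\<dots> \<le> (\<Sum>i\<le>b. (b choose i) * card X ^ i * 1 ^ (b - i))"
    by (rule sum_mono) (simp add: Suc_leI)
  also have "\<dots> = (card X + 1) ^ b" using binomial[of "card X" 1 b] by simp
  finally show ?thesis .
qed

text \<open>One level of the recursion doubles \<open>K\<close> and divides \<open>c\<close> by 2 (k
  + 1) 2^k, so c / K loses the factor (k + 1) 2^(k + 2). Dividing by exactly this factor lets the
  two numerical hypotheses of \<open>hypergraph_container\<close> pass to the next level.\<close>

primrec container_const :: "nat \<Rightarrow> real" where
  "container_const 0 = 1"
| "container_const (Suc k) = container_const k / (real (k + 1) * 2 ^ (k + 2))"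

lemma container_const_pos: "0 < container_const k"
  by (induction k) auto

lemma container_const_Suc_le': "container_const (Suc k) \<le> container_const k / 4"
proof -
  have "1 * 1 \<le> real (k + 1) * 2 ^ k" by (intro mult_mono) auto
  then have "4 \<le> real (k + 1) * 2 ^ (k + 2)" by (simp add: power_add)
  then show ?thesis
    unfolding container_const.simps using container_const_pos[of k] by (intro divide_left_mono) auto
qed

lemma container_const_le_1: "container_const k \<le> 1"
proof (induction k)
  case (Suc k)
  then show ?case using container_const_Suc_le'[of k] by linarith
qed simp

lemma container_const_Suc_le: "container_const (Suc k) \<le> 1 / 4"
  using container_const_Suc_le'[of k] container_const_le_1[of k] by linarith

definition avoids :: "('x set \<Rightarrow> real) \<Rightarrow> 'x set \<Rightarrow> bool" where
  "avoids w I \<longleftrightarrow> (\<forall>e. w e \<noteq> 0 \<longrightarrow> \<not> e \<subseteq> I)"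

text \<open>Take a longest list from \<open>I\<close> whose entries gained c / (4 card X \<tau>)
  each on average. The collected total is at most 2 K, so the length is at most 8 card X \<tau> K /
  c; by maximality no vertex of \<open>I\<close> can still gain that much.\<close>

lemma exists_fingerprint:
  assumes X: "finite X" "I \<subseteq> X" and \<tau>: "0 < \<tau>" and K: "0 < K" and k: "1 \<le> k"
    and w: "spread_weight X \<tau> (Suc k) K c w" and c: "0 < c" and ne: "X \<noteq> {}"
    and b: "8 * real (card X) * \<tau> * K \<le> real b * c"
  obtains T where "set T \<subseteq> I" "length T \<le> b"
    "\<And>v. v \<in> I \<Longrightarrow> wdeg X (link X \<tau> K w (link_sum X \<tau> K w T) v) {} < c / (4 * real (card X) * \<tau>)"
proof -
  define N where "N = real (card X)"
  have N: "N > 0" using X ne by (simp add: N_def card_gt_0_iff)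
  define \<theta> where "\<theta> = c / (4 * N * \<tau>)"
  have \<theta>: "\<theta> > 0" using c N \<tau> by (simp add: \<theta>_def)
  have nn: "\<And>e. 0 \<le> w e" and supp: "\<And>e. w e \<noteq> 0 \<Longrightarrow> e \<subseteq> X \<and> card e = Suc k"
    using w by (auto simp: spread_weight_def)
  let ?u = "link_sum X \<tau> K w"
  define P where "P T \<longleftrightarrow> set T \<subseteq> I \<and> real (length T) * \<theta> \<le> wdeg X (?u T) {}" for T
  have bnd: "length T \<le> b" if "P T" for T
  proof -
    have "wdeg X (?u T) {} \<le> 2 * K"
    proof (rule wdeg_total_le[OF X(1) k])
      fix e assume "?u T e \<noteq> 0"
      from link_sum_support[OF this] obtain v where "v \<notin> e" "w (insert v e) \<noteq> 0" "e \<subseteq> X" by auto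
      then show "card e = k" using supp[of "insert v e"] X(1) finite_subset by fastforce
    next
      show "wdeg X (?u T) {x} \<le> 2 * K / real (card X)" for x
        using wdeg_link_sum_le[OF X(1) \<tau> K w, of "{x}" T] that X by (auto simp: P_def)
    qed (use link_sum_nonneg[OF \<tau> nn] K in auto)
    then have "real (length T) * \<theta> \<le> 2 * K" using that by (simp add: P_def)
    then have "real (length T) * c \<le> 8 * N * \<tau> * K" using N \<tau> by (simp add: \<theta>_def field_simps)
    also have "\<dots> \<le> real b * c" using b by (simp add: N_def)
    finally show ?thesis using c by simp
  qed
  have "P []" by (simp add: P_def wdeg_def)
  define T where "T = (ARG_MAX length T. P T)"
  have "P T" and max: "\<And>T'. P T' \<Longrightarrow> length T' \<le> length T"
    using arg_max_nat_lemma[of P "[]" length "Suc b"] \<open>P []\<close> bnd unfolding T_def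
    by (auto simp: less_Suc_eq_le)
  have "wdeg X (link X \<tau> K w (?u T) v) {} < c / (4 * real (card X) * \<tau>)" if v: "v \<in> I" for v
  proof (rule ccontr)
    assume "\<not> ?thesis"
    then have "\<theta> \<le> wdeg X (link X \<tau> K w (?u T) v) {}" by (simp add: \<theta>_def N_def)
    then have "P (v # T)"
      using v \<open>P T\<close> by (simp add: P_def wdeg_add algebra_simps)
    then show False using max[of "v # T"] by simp
  qed
  then show ?thesis using that[of T] \<open>P T\<close> bnd by (auto simp: P_def)
qed

text \<open>Induction on the uniformity. A fingerprint \<open>T\<close> of \<open>I\<close>
  determines the set of vertices of small gain, and this set contains \<open>I\<close>. Either it is
  small enough to serve as a container, or the links of \<open>T\<close> add up to a spread weight
  of uniformity one less, which \<open>I\<close> avoids as well. Each level costs at most (card X +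
  1) ^ b choices of \<open>T\<close>, whence the exponent \<open>b * k\<close>.\<close>

theorem hypergraph_container:
  assumes X: "finite X" "X \<noteq> {}" and \<tau>: "0 < \<tau>" and "1 \<le> k" "0 < c" "0 < K"
    and "spread_weight X \<tau> k K c w" "\<beta> * K \<le> container_const k * c"
    and "8 * real (card X) * \<tau> * K \<le> real b * (container_const k * c)"
  shows "\<exists>\<C>. finite \<C> \<and> card \<C> \<le> (card X + 1) ^ (b * k) \<and>
           (\<forall>C\<in>\<C>. C \<subseteq> X \<and> real (card C) \<le> (1 - \<beta>) * real (card X)) \<and>
           (\<forall>I\<subseteq>X. avoids w I \<longrightarrow> (\<exists>C\<in>\<C>. I \<subseteq> C))"
  using assms(4-)
proof (induction k arbitrary: w c K)
  case 0
  then show ?case by simp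
next
  case (Suc k)
  note c = \<open>0 < c\<close> and K = \<open>0 < K\<close> and w = \<open>spread_weight X \<tau> (Suc k) K c w\<close>
  define N where "N = real (card X)"
  have N: "N > 0" using X by (simp add: N_def card_gt_0_iff)
  have nn: "\<And>e. 0 \<le> w e" and supp: "\<And>e. w e \<noteq> 0 \<Longrightarrow> e \<subseteq> X \<and> card e = Suc k"
    and wJ: "\<And>J. J \<noteq> {} \<Longrightarrow> wdeg X w J \<le> K / N * \<tau> ^ (card J - 1)" and cw: "c \<le> wdeg X w {}"
    using w by (auto simp: spread_weight_def N_def)
  have \<beta>: "\<beta> * K \<le> c / 4"
    using Suc.prems(5) mult_right_mono[OF container_const_Suc_le[of k], of c] c by linarith
  have b: "8 * real (card X) * \<tau> * K \<le> real b * c"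
  proof -
    have "8 * real (card X) * \<tau> * K \<le> real b * (container_const (Suc k) * c)" by fact
    also have "\<dots> \<le> real b * (1 * c)"
      using c container_const_le_1[of "Suc k"] by (intro mult_left_mono mult_right_mono) (auto simp del: container_const.simps)
    finally show ?thesis by simp
  qed
  show ?case
  proof (cases "k = 0")
    case True
    \<comment> \<open>For weights on singletons the container consists of the points without weight.
      A point carries at most K / card X, so at least c card X / K points are left out.\<close>
    define C where "C = {v \<in> X. w {v} = 0}"
    have "c \<le> (\<Sum>e | e \<subseteq> X. w e)" using cw by (simp add: wdeg_def)
    also have "\<dots> = (\<Sum>e\<in>(\<lambda>v. {v}) ` (X - C). w e)"
    proof (rule sum.mono_neutral_right)
      show "\<forall>e\<in>{e. e \<subseteq> X} - (\<lambda>v. {v}) ` (X - C). w e = 0"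
      proof
        fix e assume e: "e \<in> {e. e \<subseteq> X} - (\<lambda>v. {v}) ` (X - C)"
        show "w e = 0"
        proof (rule ccontr)
          assume "w e \<noteq> 0"
          with supp[of e] True obtain v where "e = {v}" by (auto simp: card_1_singleton_iff)
          with e \<open>w e \<noteq> 0\<close> show False by (auto simp: C_def)
        qed
      qed
    qed (use X in \<open>auto simp: C_def\<close>)
    also have "\<dots> = (\<Sum>v\<in>X - C. w {v})" by (subst sum.reindex) (auto simp: inj_on_def)
    also have "\<dots> \<le> (\<Sum>v\<in>X - C. K / N)"
    proof (rule sum_mono)
      fix v assume v: "v \<in> X - C"
      have "w {v} = (\<Sum>e\<in>{{v}}. w e)" by simp
      also have "\<dots> \<le> wdeg X w {v}" unfolding wdeg_def
        using X nn v by (intro sum_mono2) auto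
      finally show "w {v} \<le> K / N" using wJ[of "{v}"] by simp
    qed
    also have "\<dots> = (N - real (card C)) * (K / N)"
      using X by (simp add: C_def card_Diff_subset N_def of_nat_diff card_mono)
    finally have "c * N \<le> (N - real (card C)) * K" using N by (simp add: field_simps)
    moreover have "\<beta> * K * N \<le> c * N"
      using \<beta> N c by (intro mult_right_mono) auto
    ultimately have "\<beta> * N * K \<le> (N - real (card C)) * K" by (simp add: mult_ac)
    then have "\<beta> * N \<le> N - real (card C)" using K by (rule mult_right_le_imp_le)
    then have "real (card C) \<le> (1 - \<beta>) * N" by (simp add: algebra_simps)
    moreover have "I \<subseteq> C" if "I \<subseteq> X" "avoids w I" for I
      using that by (force simp: C_def avoids_def)
    moreover have "C \<subseteq> X" by (auto simp: C_def)
    ultimately show ?thesis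
      by (intro exI[of _ "{C}"]) (auto simp: N_def)
  next
    case False
    then have k: "1 \<le> k" by simp
    let ?u = "link_sum X \<tau> K w"
    define CT where "CT T = {v \<in> X. wdeg X (link X \<tau> K w (?u T) v) {} < c / (4 * real (card X) * \<tau>)}" for T
    define LL where "LL = {T. set T \<subseteq> X \<and> length T \<le> b}"
    \<comment> \<open>For a given \<open>T\<close> it suffices to cover the sets \<open>I\<close>
      with \<open>set T\<close> \<subseteq> \<open>I\<close> \<subseteq> \<open>CT T\<close>; every
      avoiding set satisfies this for some \<open>T\<close>.\<close>
    have "\<exists>\<D>. finite \<D> \<and> card \<D> \<le> (card X + 1) ^ (b * k) \<and>
           (\<forall>C\<in>\<D>. C \<subseteq> X \<and> real (card C) \<le> (1 - \<beta>) * real (card X)) \<and>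
           (\<forall>I\<subseteq>X. avoids w I \<longrightarrow> set T \<subseteq> I \<longrightarrow> I \<subseteq> CT T \<longrightarrow> (\<exists>C\<in>\<D>. I \<subseteq> C))" if T: "T \<in> LL" for T
    proof (cases "real (card (CT T)) \<le> (1 - \<beta>) * real (card X)")
      case True
      then show ?thesis by (intro exI[of _ "{CT T}"]) (auto simp: CT_def)
    next
      case False
      have usupp: "e \<subseteq> X \<and> card e = k" if "?u T e \<noteq> 0" for e
      proof -
        from link_sum_support[OF that] obtain v where "v \<notin> e" "w (insert v e) \<noteq> 0" "e \<subseteq> X" by auto
        then show ?thesis using supp[of "insert v e"] X(1) finite_subset by fastforce
      qed
      define c' where "c' = c / (2 * (real k + 1) * 2 ^ k)"
      have c': "c' > 0" using c by (simp add: c'_def add_pos_nonneg)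
      have "c \<le> 2 * (real k + 1) * 2 ^ k * wdeg X (?u T) {}"
        by (rule total_weight_dichotomy[OF X(1) \<tau> K w _ _ CT_def[of T] _ \<beta> c X(2)])
          (use link_sum_nonneg[OF \<tau> nn] usupp False in auto)
      then have "c' \<le> wdeg X (?u T) {}"
        by (simp add: c'_def divide_le_eq mult_ac add_pos_nonneg)
      then have sp: "spread_weight X \<tau> k (2 * K) c' (?u T)"
        unfolding spread_weight_def using link_sum_nonneg[OF \<tau> nn] usupp wdeg_link_sum_le[OF X(1) \<tau> K w] T
        by (auto simp: LL_def)
      have eq: "2 * (container_const (Suc k) * c) = container_const k * c'"
      proof -
        have "real (k + 1) * 2 ^ (k + 2) = 2 * (2 * (real k + 1) * 2 ^ k)" by (simp add: power_add)
        moreover have "2 * (a / (2 * q) * c) = a * (c / q)" for a q :: real by simp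
        ultimately show ?thesis unfolding container_const.simps c'_def by metis
      qed
      have "\<exists>\<C>. finite \<C> \<and> card \<C> \<le> (card X + 1) ^ (b * k) \<and>
           (\<forall>C\<in>\<C>. C \<subseteq> X \<and> real (card C) \<le> (1 - \<beta>) * real (card X)) \<and>
           (\<forall>I\<subseteq>X. avoids (?u T) I \<longrightarrow> (\<exists>C\<in>\<C>. I \<subseteq> C))"
      proof (rule Suc.IH[OF k c' _ sp])
        show "\<beta> * (2 * K) \<le> container_const k * c'" using Suc.prems(5) unfolding eq[symmetric] by linarith
        show "8 * real (card X) * \<tau> * (2 * K) \<le> real b * (container_const k * c')"
          using Suc.prems(6) unfolding eq[symmetric] by (simp add: mult_ac del: container_const.simps)
      qed (use K in simp)
      then obtain \<D> where \<D>: "finite \<D>" "card \<D> \<le> (card X + 1) ^ (b * k)"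
           "\<forall>C\<in>\<D>. C \<subseteq> X \<and> real (card C) \<le> (1 - \<beta>) * real (card X)"
           "\<forall>I\<subseteq>X. avoids (?u T) I \<longrightarrow> (\<exists>C\<in>\<D>. I \<subseteq> C)" by blast
      \<comment> \<open>A set in the support of the link sum is completed by a vertex of
        \<open>T\<close> to one in the support of \<open>w\<close>. Since \<open>T\<close> lies in
        \<open>I\<close>, avoiding \<open>w\<close> implies avoiding the link sum.\<close>
      have "avoids (?u T) I" if "avoids w I" "set T \<subseteq> I" for I
        unfolding avoids_def using that link_sum_support[of X \<tau> K w T] by (fastforce simp: avoids_def)
      then show ?thesis using \<D> by (intro exI[of _ \<D>]) blast
    qed
    then obtain \<D> where \<D>: "\<And>T. T \<in> LL \<Longrightarrow> finite (\<D> T) \<and> card (\<D> T) \<le> (card X + 1) ^ (b * k) \<and>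
           (\<forall>C\<in>\<D> T. C \<subseteq> X \<and> real (card C) \<le> (1 - \<beta>) * real (card X)) \<and>
           (\<forall>I\<subseteq>X. avoids w I \<longrightarrow> set T \<subseteq> I \<longrightarrow> I \<subseteq> CT T \<longrightarrow> (\<exists>C\<in>\<D> T. I \<subseteq> C))"
      by metis
    have finL: "finite LL" using finite_lists_length_le[OF X(1)] by (simp add: LL_def)
    have "card (\<Union>T\<in>LL. \<D> T) \<le> (\<Sum>T\<in>LL. card (\<D> T))" by (rule card_UN_le[OF finL])
    also have "\<dots> \<le> (\<Sum>T\<in>LL. (card X + 1) ^ (b * k))" by (rule sum_mono) (use \<D> in auto)
    also have "\<dots> = card LL * (card X + 1) ^ (b * k)" by simp
    also have "\<dots> \<le> (card X + 1) ^ b * (card X + 1) ^ (b * k)"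
      using card_lists_length_le_power[OF X(1), of b] by (intro mult_right_mono) (auto simp: LL_def)
    also have "\<dots> = (card X + 1) ^ (b * Suc k)" by (simp add: power_add)
    finally have cd: "card (\<Union>T\<in>LL. \<D> T) \<le> (card X + 1) ^ (b * Suc k)" .
    have "\<exists>C\<in>(\<Union>T\<in>LL. \<D> T). I \<subseteq> C" if I: "I \<subseteq> X" "avoids w I" for I
    proof -
      obtain T where T: "set T \<subseteq> I" "length T \<le> b"
        "\<And>v. v \<in> I \<Longrightarrow> wdeg X (link X \<tau> K w (?u T) v) {} < c / (4 * real (card X) * \<tau>)"
        using exists_fingerprint[OF X(1) I(1) \<tau> K k w c X(2) b] by blast
      then have "T \<in> LL" "I \<subseteq> CT T" using I by (auto simp: LL_def CT_def)
      then show ?thesis using \<D>[of T] I T by blast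
    qed
    then show ?thesis using \<D> finL cd by (intro exI[of _ "\<Union>T\<in>LL. \<D> T"]) auto
  qed
qed

section \<open>Regular projections\<close>

lemma pigeonhole_fibre:
  assumes "finite A" "finite B" "B \<noteq> {}" "g ` A \<subseteq> B"
  obtains b where "b \<in> B" "card A \<le> card B * card {a \<in> A. g a = b}"
proof -
  have eq: "card A = (\<Sum>b\<in>B. card {a \<in> A. g a = b})"
    using card_UN_disjoint[of B "\<lambda>b. {a \<in> A. g a = b}"] assms
    by (subst card_UN_disjoint[symmetric]) (auto intro!: arg_cong[where f = card])
  have "\<exists>b\<in>B. card A \<le> card B * card {a \<in> A. g a = b}"
  proof (rule ccontr)
    assume "\<not> ?thesis"
    then have "(\<Sum>b\<in>B. card B * card {a \<in> A. g a = b}) < (\<Sum>b\<in>B. card A)"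
      using assms by (intro sum_strict_mono) auto
    then show False by (simp add: eq sum_distrib_left[symmetric])
  qed
  then show ?thesis using that by blast
qed

lemma card_sum_fibres_le:
  assumes "finite A" "finite B"
  shows "(\<Sum>b\<in>B. card {a \<in> A. g a = b}) \<le> card A"
proof -
  have "(\<Sum>b\<in>B. card {a \<in> A. g a = b}) = card (\<Union>b\<in>B. {a \<in> A. g a = b})"
    using assms by (subst card_UN_disjoint) auto
  also have "\<dots> \<le> card A" using assms by (intro card_mono) auto
  finally show ?thesis .
qed

abbreviation complete_edges :: "nat \<Rightarrow> nat \<Rightarrow> nat set set" where
  "complete_edges n r \<equiv> {e. e \<subseteq> {..<n} \<and> card e = r}"

lemma card_ksubsets: "card (complete_edges n r) = n choose r"
  using n_subsets[of "{..<n}" r] by simp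

lemma card_ksubsets_le: "card (complete_edges n r) \<le> n ^ r"
  unfolding card_ksubsets by (cases "r \<le> n") (auto simp: binomial_le_pow binomial_eq_0)

lemma exists_blocks:
  assumes "finite f" "q * r0 \<le> card f"
  shows "\<exists>bl. (\<forall>k<q. bl k \<subseteq> f \<and> card (bl k) = r0) \<and> card (f - (\<Union>k<q. bl k)) = card f - q * r0"
proof -
  obtain h where h: "bij_betw h {0..<card f} f" using ex_bij_betw_nat_finite[OF assms(1)] by blast
  define bl where "bl k = h ` {k * r0..<(k + 1) * r0}" for k
  have sub: "{k * r0..<(k + 1) * r0} \<subseteq> {0..<card f}" if "k < q" for k
    using that assms(2) mult_le_mono1[of "k + 1" q r0] by (auto simp: algebra_simps)
  have inj: "inj_on h {0..<card f}" and im: "h ` {0..<card f} = f" using h by (auto simp: bij_betw_def)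
  have "card (bl k) = r0" "bl k \<subseteq> f" if "k < q" for k
    using card_image[OF inj_on_subset[OF inj sub[OF that]]] sub[OF that] im by (auto simp: bl_def)
  moreover have "card (f - (\<Union>k<q. bl k)) = card f - q * r0"
  proof -
    have "(\<Union>k<q. bl k) = h ` (\<Union>k<q. {k * r0..<(k + 1) * r0})" by (simp add: bl_def image_UN)
    also have "(\<Union>k<q. {k * r0..<(k + 1) * r0}) = {0..<q * r0}"
    proof (induction q)
      case (Suc q)
      then show ?case by (auto simp: lessThan_Suc)
    qed simp
    finally have eq: "(\<Union>k<q. bl k) = h ` {0..<q * r0}" .
    have "card (h ` {0..<q * r0}) = q * r0"
      using card_image[OF inj_on_subset[OF inj, of "{0..<q * r0}"]] assms(2) by auto
    moreover have "h ` {0..<q * r0} \<subseteq> f" using im assms(2) by auto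
    ultimately show ?thesis using assms(1) by (simp add: eq card_Diff_subset finite_subset)
  qed
  ultimately show ?thesis by blast
qed

text \<open>An edge is recovered from its \<open>q\<close> blocks and the set of its remaining r - q
  r0 vertices, so it is enough to count the choices for these.\<close>

lemma card_all_blocks_in_le:
  fixes H :: "nat set set" and B :: "nat \<Rightarrow> nat set set"
  assumes H: "H \<subseteq> complete_edges n r"
    and bl: "\<And>f k. f \<in> H \<Longrightarrow> k < q \<Longrightarrow> bl f k \<subseteq> f"
      "\<And>f. f \<in> H \<Longrightarrow> card (f - (\<Union>k<q. bl f k)) = r - q * r0"
    and fin: "\<And>k. k < q \<Longrightarrow> finite (B k)"
  shows "card {f \<in> H. \<forall>k<q. bl f k \<in> B k} \<le> (\<Prod>k<q. card (B k)) * n ^ (r - q * r0)"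
proof -
  let ?A = "{f \<in> H. \<forall>k<q. bl f k \<in> B k}"
  let ?R = "{e. e \<subseteq> {..<n} \<and> card e = r - q * r0}"
  let ?g = "\<lambda>f. (restrict (bl f) {..<q}, f - (\<Union>k<q. bl f k))"
  have "inj_on ?g ?A"
  proof (rule inj_onI)
    fix f f' assume f: "f \<in> ?A" "f' \<in> ?A" and eq: "?g f = ?g f'"
    have "bl f k = bl f' k" if "k < q" for k
      using eq that by (metis (mono_tags, lifting) lessThan_iff prod.inject restrict_apply')
    then have "(\<Union>k<q. bl f k) = (\<Union>k<q. bl f' k)" by auto
    moreover have "f = (f - (\<Union>k<q. bl f k)) \<union> (\<Union>k<q. bl f k)"
      "f' = (f' - (\<Union>k<q. bl f' k)) \<union> (\<Union>k<q. bl f' k)"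
      using bl(1) f by blast+
    ultimately show "f = f'" using eq by (metis (no_types, lifting) prod.inject)
  qed
  moreover have "?g ` ?A \<subseteq> (PiE {..<q} B) \<times> ?R"
    using H bl(2) by (auto simp: restrict_def)
  moreover have "finite ((PiE {..<q} B) \<times> ?R)"
    using fin by (auto intro!: finite_PiE)
  ultimately have "card ?A \<le> card ((PiE {..<q} B) \<times> ?R)"
    by (meson card_inj_on_le)
  also have "\<dots> \<le> (\<Prod>k<q. card (B k)) * n ^ (r - q * r0)"
    using card_ksubsets_le[of n "r - q * r0"] by (simp add: card_cartesian_product card_PiE)
  finally show ?thesis .
qed

lemma dyadic_level:
  assumes "0 < (m::nat)"
  shows "2 ^ nat \<lfloor>log 2 m\<rfloor> \<le> real m \<and> real m \<le> 2 * 2 ^ nat \<lfloor>log 2 m\<rfloor>"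
proof -
  have "2 ^ nat \<lfloor>log 2 m\<rfloor> \<le> m" "m \<le> 2 * 2 ^ nat \<lfloor>log 2 m\<rfloor>"
    using floor_log_nat_eq_powr_iff[of 2 m "nat \<lfloor>log 2 m\<rfloor>"] assms by simp_all
  from this[THEN of_nat_mono, where 'a = real] show ?thesis by simp
qed

text \<open>Edges all of whose \<open>q\<close> blocks have degree above \<open>N n powr (\<delta> - r0)\<close> number at most
  \<open>n powr (q (r0 - \<delta>) + r - q r0) = n\<^sup>r\<^sup>-\<^sup>2\<close>, so for most edges some block has smaller degree. A dyadic
  pigeonhole then makes the degrees comparable; discarding the blocks of very small degree first
  avoids a logarithmic loss in the lower bound for \<open>D\<close>.\<close>

proposition regular_projection:
  fixes H :: "nat set set" and n r r0 q :: nat and \<delta> K :: real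
  defines "N \<equiv> real (card H)"
  assumes H: "H \<subseteq> complete_edges n r" and q: "1 \<le> q" "q * r0 \<le> r" and r: "2 \<le> r"
    and \<delta>: "\<delta> * q = 2" and N: "K * real n ^ (r - 1) \<le> N" and nK: "2 \<le> K * n" and n: "1 \<le> n"
  obtains \<pi> H' and D :: real where
    "\<And>f. f \<in> H \<Longrightarrow> \<pi> f \<subseteq> f \<and> card (\<pi> f) = r0" "H' \<subseteq> H"
    "N \<le> 4 * q * (r * log 2 n + 1) * real (card H')" "(1::real) \<le> D"
    "\<And>\<sigma>. \<sigma> \<in> \<pi> ` H' \<Longrightarrow> D \<le> card {f \<in> H'. \<pi> f = \<sigma>} \<and> card {f \<in> H'. \<pi> f = \<sigma>} \<le> 2 * D"
    "N / (8 * q) * real n powr (- real r0) \<le> D" "D \<le> N * real n powr (\<delta> - real r0)"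
proof -
  let ?n = "real n"
  have n0: "?n > 0" using n by simp
  have finH: "finite H" using H by (rule finite_subset) simp
  have Kpos: "K > 0" using nK n0 mult_nonpos_nonneg[of K ?n] by linarith
  have N0: "N > 0" using N Kpos n0 by (smt (verit) mult_pos_pos zero_less_power)
  have subN: "f \<subseteq> {..<n}" "card f = r" "finite f" if "f \<in> H" for f
    using that H finite_subset by auto
  have "\<forall>f\<in>H. \<exists>bl. (\<forall>k<q. bl k \<subseteq> f \<and> card (bl k) = r0) \<and> card (f - (\<Union>k<q. bl k)) = r - q * r0"
  proof
    fix f assume f: "f \<in> H"
    show "\<exists>bl. (\<forall>k<q. bl k \<subseteq> f \<and> card (bl k) = r0) \<and> card (f - (\<Union>k<q. bl k)) = r - q * r0"
      using exists_blocks[of f q r0] subN[OF f] q by simp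
  qed
  then obtain bl where bl: "\<And>f k. f \<in> H \<Longrightarrow> k < q \<Longrightarrow> bl f k \<subseteq> f \<and> card (bl f k) = r0"
    "\<And>f. f \<in> H \<Longrightarrow> card (f - (\<Union>k<q. bl f k)) = r - q * r0" by metis
  define dg where "dg k \<sigma> = card {f \<in> H. bl f k = \<sigma>}" for k \<sigma>
  define T where "T = N * ?n powr (\<delta> - real r0)"
  have T0: "T > 0" using N0 n0 by (simp add: T_def)
  define B where "B k = {\<sigma> \<in> (\<lambda>f. bl f k) ` H. T < real (dg k \<sigma>)}" for k
  have finB: "finite (B k)" for k using finH by (simp add: B_def)
  \<comment> \<open>Each heavy set has more than \<open>T\<close> edges above it, and the classes of
    different sets are disjoint, so there are at most N / T heavy sets.\<close>
  have cB: "real (card (B k)) \<le> ?n powr (real r0 - \<delta>)" for k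
  proof -
    have "real (card (B k)) * T \<le> (\<Sum>\<sigma>\<in>B k. real (dg k \<sigma>))"
      using sum_bounded_below[of "B k" T "\<lambda>\<sigma>. real (dg k \<sigma>)"] by (force simp: B_def)
    also have "\<dots> \<le> N"
      using card_sum_fibres_le[OF finH finB, of "\<lambda>f. bl f k" k] unfolding dg_def N_def
      unfolding of_nat_sum[symmetric] by (rule of_nat_mono)
    finally have "real (card (B k)) \<le> N / T" using T0 by (simp add: field_simps)
    also have "\<dots> = ?n powr (real r0 - \<delta>)" using N0 by (simp add: T_def powr_diff)
    finally show ?thesis .
  qed
  have "real (card {f \<in> H. \<forall>k<q. bl f k \<in> B k}) \<le> (\<Prod>k<q. real (card (B k))) * ?n ^ (r - q * r0)"
    using card_all_blocks_in_le[OF H, of q bl r0 B] bl finB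
    by (simp flip: of_nat_mult of_nat_power of_nat_prod)
  also have "\<dots> \<le> (\<Prod>k<q. ?n powr (real r0 - \<delta>)) * ?n ^ (r - q * r0)"
    using cB by (intro mult_right_mono prod_mono) auto
  also have "\<dots> = ?n powr (q * (real r0 - \<delta>) + real (r - q * r0))"
    using n0 by (simp add: powr_add powr_powr powr_realpow[symmetric] mult.commute)
  \<comment> \<open>Here q \<delta> = 2 puts the exponent one below the r - 1 of the hypothesis on
    \<open>N\<close>.\<close>
  also have "q * (real r0 - \<delta>) + real (r - q * r0) = real (r - 2)"
    using q r \<delta> by (simp add: of_nat_diff algebra_simps)
  also have "?n powr real (r - 2) = ?n ^ (r - 2)" using n0 by (simp add: powr_realpow)
  also have "\<dots> \<le> N / 2"
  proof -
    have "2 * ?n ^ (r - 2) \<le> K * ?n * ?n ^ (r - 2)" using nK n0 by (intro mult_right_mono) auto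
    also have "\<dots> = K * ?n ^ Suc (r - 2)" by simp
    also have "Suc (r - 2) = r - 1" using r by simp
    finally show ?thesis using N by simp
  qed
  finally have bad: "real (card {f \<in> H. \<forall>k<q. bl f k \<in> B k}) \<le> N / 2" .
  define G where "G = {f \<in> H. \<exists>k<q. bl f k \<notin> B k}"
  have "card H = card {f \<in> H. \<forall>k<q. bl f k \<in> B k} + card G"
    unfolding G_def using finH by (subst card_Un_disjoint[symmetric]) (auto intro!: arg_cong[where f = card])
  then have G: "N / 2 \<le> real (card G)" using bad by (simp add: N_def)
  define kf where "kf f = (SOME k. k < q \<and> bl f k \<notin> B k)" for f
  have kf: "kf f < q \<and> bl f (kf f) \<notin> B (kf f)" if "f \<in> G" for f
    unfolding kf_def by (rule someI_ex) (use that in \<open>auto simp: G_def\<close>)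
  have finG: "finite G" using finH by (simp add: G_def)
  have "kf ` G \<subseteq> {..<q}" using kf by blast
  moreover have "{..<q} \<noteq> {}" using q(1) by (simp add: lessThan_empty_iff)
  ultimately obtain k where k: "k \<in> {..<q}" "card G \<le> card {..<q} * card {f \<in> G. kf f = k}"
    using pigeonhole_fibre[OF finG finite_lessThan] by metis
  define H1 where "H1 = {f \<in> H. bl f k \<notin> B k}"
  have finH1: "finite H1" using finH by (simp add: H1_def)
  have "card {f \<in> G. kf f = k} \<le> card H1" using finH kf by (intro card_mono) (auto simp: H1_def G_def)
  then have "card G \<le> q * card H1" using k(2) using le_trans mult_le_mono2 by fastforce
  then have "real (card G) \<le> q * real (card H1)" by (metis of_nat_mono of_nat_mult)
  then have H1: "N / (2 * q) \<le> real (card H1)" using G q by (simp add: field_simps)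
  define \<pi> where "\<pi> f = bl f k" for f
  have \<pi>: "\<pi> f \<subseteq> f \<and> card (\<pi> f) = r0" if "f \<in> H" for f using bl k that by (auto simp: \<pi>_def)
  define d where "d \<sigma> = card {f \<in> H. \<pi> f = \<sigma>}" for \<sigma>
  have dT: "real (d (\<pi> f)) \<le> T" if "f \<in> H1" for f
    using that by (auto simp: H1_def B_def d_def \<pi>_def dg_def)
  \<comment> \<open>There are at most n^r0 classes, so those smaller than \<open>d0\<close> cover at
    most N / (4 q) edges, half of what \<open>H1\<close> is known to have.\<close>
  define d0 where "d0 = N / (4 * q) * ?n powr (- real r0)"
  have d00: "d0 > 0" using N0 n0 q by (simp add: d0_def)
  have low: "real (card {f \<in> H1. real (d (\<pi> f)) < d0}) \<le> N / (4 * q)"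
  proof -
    let ?S = "complete_edges n r0"
    let ?L = "{f \<in> H1. real (d (\<pi> f)) < d0}"
    have eq: "?L = (\<Union>\<sigma>\<in>?S. {f \<in> ?L. \<pi> f = \<sigma>})"
      using \<pi> subN by (fastforce simp: H1_def)
    have "card (\<Union>\<sigma>\<in>?S. {f \<in> ?L. \<pi> f = \<sigma>}) \<le> (\<Sum>\<sigma>\<in>?S. card {f \<in> ?L. \<pi> f = \<sigma>})"
      by (rule card_UN_le) simp
    then have "card ?L \<le> (\<Sum>\<sigma>\<in>?S. card {f \<in> ?L. \<pi> f = \<sigma>})"
      by (subst eq)
    then have "real (card ?L) \<le> (\<Sum>\<sigma>\<in>?S. real (card {f \<in> ?L. \<pi> f = \<sigma>}))"
      unfolding of_nat_sum[symmetric] by (rule of_nat_mono)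
    also have "\<dots> \<le> (\<Sum>\<sigma>\<in>?S. d0)"
    proof (rule sum_mono)
      fix \<sigma>
      show "real (card {f \<in> ?L. \<pi> f = \<sigma>}) \<le> d0"
      proof (cases "{f \<in> ?L. \<pi> f = \<sigma>} = {}")
        case False
        have "card {f \<in> ?L. \<pi> f = \<sigma>} \<le> d \<sigma>"
          unfolding d_def using finH by (intro card_mono) (auto simp: H1_def)
        then show ?thesis using False by auto
      next
        case True
        then have "card {f \<in> ?L. \<pi> f = \<sigma>} = 0" by (simp only: card.empty)
        then show ?thesis using d00 by simp
      qed
    qed
    also have "\<dots> = real (card ?S) * d0" by simp
    also have "\<dots> \<le> ?n ^ r0 * d0"
      using d00 card_ksubsets_le[of n r0] by (intro mult_right_mono) (simp_all flip: of_nat_power)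
    also have "\<dots> = N / (4 * q)" using n0 by (simp add: d0_def powr_minus powr_realpow)
    finally show ?thesis .
  qed
  define H2 where "H2 = {f \<in> H1. d0 \<le> real (d (\<pi> f))}"
  have finH2: "finite H2" using finH1 by (simp add: H2_def)
  have "card H1 = card {f \<in> H1. real (d (\<pi> f)) < d0} + card H2"
    unfolding H2_def using finH1 by (subst card_Un_disjoint[symmetric]) (auto intro!: arg_cong[where f = card])
  then have H2: "N / (4 * q) \<le> real (card H2)" using low H1 q by (simp add: field_simps)
  define lev where "lev f = nat \<lfloor>log 2 (d (\<pi> f))\<rfloor>" for f
  define L where "L = nat \<lfloor>r * log 2 n\<rfloor>"
  have dpos: "0 < d (\<pi> f)" if "f \<in> H2" for f
    using that d00 by (auto simp: H2_def intro!: Nat.gr0I)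
  have levL: "lev f \<in> {..L}" if "f \<in> H2" for f
  proof -
    have "d (\<pi> f) \<le> card (complete_edges n r)"
      unfolding d_def using H by (intro card_mono) auto
    also have "\<dots> \<le> n ^ r" by (rule card_ksubsets_le)
    finally have "real (d (\<pi> f)) \<le> ?n ^ r" by (metis of_nat_mono of_nat_power)
    then have "log 2 (d (\<pi> f)) \<le> log 2 (?n ^ r)" using dpos[OF that] n0 by simp
    also have "\<dots> = r * log 2 n" using n0 by (simp add: log_nat_power)
    finally show ?thesis by (simp add: lev_def L_def nat_mono floor_mono)
  qed
  obtain i where i: "i \<in> {..L}" "card H2 \<le> card {..L} * card {f \<in> H2. lev f = i}"
    by (rule pigeonhole_fibre[of H2 "{..L}" lev]) (use finH2 levL in auto)
  define H3 where "H3 = {f \<in> H2. lev f = i}"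
  \<comment> \<open>Membership in \<open>H1\<close> and \<open>H2\<close> and the level depend on an
    edge only through its projection. So \<open>H3\<close> is a union of entire fibres, and the
    degrees in \<open>H3\<close> agree with those in \<open>H\<close>.\<close>
  have cls: "{f \<in> H3. \<pi> f = \<sigma>} = {f \<in> H. \<pi> f = \<sigma>}" if "\<sigma> \<in> \<pi> ` H3" for \<sigma>
    using that unfolding H3_def H2_def H1_def lev_def \<pi>_def by auto
  have L: "real L + 1 \<le> r * log 2 n + 1" using n by (simp add: L_def)
  have "N / (4 * q) \<le> (real L + 1) * real (card H3)"
  proof -
    have "real (card H2) \<le> real (card {..L} * card {f \<in> H2. lev f = i})" using i(2) by (rule of_nat_mono)
    then show ?thesis using H2 by (simp add: H3_def algebra_simps)
  qed
  also have "\<dots> \<le> (r * log 2 n + 1) * real (card H3)" using L by (intro mult_right_mono) auto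
  finally have N3: "N \<le> 4 * q * (r * log 2 n + 1) * real (card H3)" using q by (simp add: field_simps)
  then have ne: "H3 \<noteq> {}" using N0 by auto
  then obtain f where f: "f \<in> H3" by blast
  have fi: "2 ^ i \<le> real (d (\<pi> f))" "real (d (\<pi> f)) \<le> 2 * 2 ^ i"
    using dyadic_level[OF dpos[of f]] f by (auto simp: H3_def lev_def)
  have cl: "2 ^ i \<le> real (card {f \<in> H3. \<pi> f = \<sigma>}) \<and> real (card {f \<in> H3. \<pi> f = \<sigma>}) \<le> 2 * 2 ^ i"
    if \<sigma>: "\<sigma> \<in> \<pi> ` H3" for \<sigma>
  proof -
    obtain f where f: "f \<in> H3" "\<sigma> = \<pi> f" using \<sigma> by blast
    have "2 ^ i \<le> real (d (\<pi> f))" "real (d (\<pi> f)) \<le> 2 * 2 ^ i"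
      using dyadic_level[OF dpos[of f]] f by (auto simp: H3_def lev_def)
    then show ?thesis unfolding cls[OF \<sigma>] by (simp add: d_def f(2))
  qed
  have "N / (8 * q) * ?n powr (- real r0) \<le> 2 ^ i"
    using fi f by (simp add: H3_def H2_def d0_def)
  moreover have "2 ^ i \<le> N * ?n powr (\<delta> - real r0)"
  proof -
    have "f \<in> H1" using f by (simp add: H3_def H2_def)
    from order_trans[OF fi(1) dT[OF this]] show ?thesis by (simp add: T_def)
  qed
  moreover have "H3 \<subseteq> H" by (auto simp: H3_def H2_def H1_def)
  moreover have "(1::real) \<le> 2 ^ i" by simp
  ultimately show ?thesis using that[of \<pi> H3 "2 ^ i"] \<pi> N3 cl by blast
qed

section \<open>Supersaturation for expansions\<close>

lemma card_supersets_le: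
  assumes "finite Y"
  shows "card {a. a \<subseteq> {..<n::nat} \<and> card a = r \<and> Y \<subseteq> a} \<le> n ^ (r - card Y)"
proof -
  let ?A = "{a. a \<subseteq> {..<n} \<and> card a = r \<and> Y \<subseteq> a}"
  let ?B = "{a. a \<subseteq> {..<n} \<and> card a = r - card Y}"
  have "inj_on (\<lambda>a. a - Y) ?A" by (auto simp: inj_on_def)
  moreover have "(\<lambda>a. a - Y) ` ?A \<subseteq> ?B" using assms by (auto simp: card_Diff_subset)
  moreover have "finite ?B" by simp
  ultimately have "card ?A \<le> card ?B" by (meson card_inj_on_le)
  moreover have "card ?B \<le> n ^ (r - card Y)" by (rule card_ksubsets_le)
  ultimately show ?thesis by linarith
qed

text \<open>Greedy counting: every admissible partial choice extends in at least \<open>m\<close>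
  ways, and distinct extensions are distinct functions. \<open>P\<close> takes the current domain as
  an argument so that it can be carried through the induction.\<close>

lemma card_choices_ge:
  fixes m :: real
  assumes "finite E" and finA: "\<And>e. e \<in> E \<Longrightarrow> finite (A e)" and m: "0 \<le> m" and base: "P {} (\<lambda>_. undefined)"
    and step: "\<And>E0 e g. E0 \<subseteq> E \<Longrightarrow> e \<in> E - E0 \<Longrightarrow> g \<in> PiE E0 A \<Longrightarrow> P E0 g \<Longrightarrow>
      m \<le> real (card {a \<in> A e. P (insert e E0) (g(e := a))})"
  shows "m ^ card E \<le> real (card {g \<in> PiE E A. P E g})"
proof -
  have "E' \<subseteq> E \<Longrightarrow> m ^ card E' \<le> real (card {g \<in> PiE E' A. P E' g})" if "finite E'" for E'
    using that
  proof (induction E' rule: finite_induct)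
    case empty
    have "{g \<in> PiE {} A. P {} g} = {\<lambda>_. undefined}" using base by auto
    then show ?case by simp
  next
    case (insert e E0)
    let ?G = "{g \<in> PiE E0 A. P E0 g}"
    let ?S = "SIGMA g:?G. {a \<in> A e. P (insert e E0) (g(e := a))}"
    let ?T = "{g \<in> PiE (insert e E0) A. P (insert e E0) g}"
    have "finite (PiE E0 A)" "finite (PiE (insert e E0) A)"
      using insert.hyps insert.prems finA by (intro finite_PiE; blast)+
    then have fin: "finite ?G" "finite ?T" by simp_all
    have "m ^ card (insert e E0) = m ^ card E0 * m" using insert by simp
    also have "\<dots> \<le> real (card ?G) * m" using insert m by (intro mult_right_mono) auto
    also have "\<dots> \<le> (\<Sum>g\<in>?G. real (card {a \<in> A e. P (insert e E0) (g(e := a))}))"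
    proof -
      have "(\<Sum>g\<in>?G. m) \<le> (\<Sum>g\<in>?G. real (card {a \<in> A e. P (insert e E0) (g(e := a))}))"
        by (rule sum_mono) (use step[of E0 e] insert in auto)
      then show ?thesis by simp
    qed
    also have "\<dots> = real (card ?S)"
      using fin finA insert by (subst card_SigmaI) auto
    also have "card ?S \<le> card ?T"
    proof (rule card_inj_on_le[where f = "\<lambda>(g, a). g(e := a)"])
      show "inj_on (\<lambda>(g, a). g(e := a)) ?S"
      proof (rule inj_onI, clarify)
        fix g a g' a'
        assume *: "g \<in> PiE E0 A" "g' \<in> PiE E0 A" "g(e := a) = g'(e := a')"
        then have "g x = g' x" if "x \<noteq> e" for x using that by (metis fun_upd_other)
        moreover have "g e = g' e" using * insert by (auto simp: PiE_def extensional_def)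
        ultimately have "g x = g' x" for x by (cases "x = e") auto
        then have "g = g'" by auto
        moreover have "a = a'" using *(3) by (metis fun_upd_same)
        ultimately show "g = g' \<and> a = a'" by blast
      qed
      show "(\<lambda>(g, a). g(e := a)) ` ?S \<subseteq> ?T"
        by (auto intro!: PiE_fun_upd)
    qed (rule fin)
    finally show ?case by simp
  qed
  then show ?thesis using assms(1) by blast
qed

text \<open>A non-injective map identifies some pair of points; once the pair is fixed, one value is
  determined by the others.\<close>

lemma card_not_inj_le:
  assumes "finite V"
  shows "card {\<phi> \<in> V \<rightarrow>\<^sub>E {..<n::nat}. \<not> inj_on \<phi> V} \<le> card V ^ 2 * n ^ (card V - 1)"
proof -
  let ?P = "{(x, y) \<in> V \<times> V. x \<noteq> y}"
  let ?X = "\<lambda>(x, y). {\<phi> \<in> V \<rightarrow>\<^sub>E {..<n}. \<phi> x = \<phi> y}"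
  have finP: "finite ?P" by (rule finite_subset[of _ "V \<times> V"]) (use assms in auto)
  have sub: "{\<phi> \<in> V \<rightarrow>\<^sub>E {..<n}. \<not> inj_on \<phi> V} \<subseteq> (\<Union>p\<in>?P. ?X p)"
    by (fastforce simp: inj_on_def)
  have finX: "finite (?X p)" for p using assms by (cases p) (auto intro!: finite_PiE)
  have X: "card (?X p) \<le> n ^ (card V - 1)" if "p \<in> ?P" for p
  proof -
    obtain x y where "p = (x, y)" by (cases p)
    then have p: "p = (x, y)" "x \<in> V" "y \<in> V" "x \<noteq> y" using that by auto
    have "card (?X p) \<le> card ((V - {y}) \<rightarrow>\<^sub>E {..<n})"
    proof (rule card_inj_on_le[where f = "\<lambda>\<phi>. restrict \<phi> (V - {y})"])
      show "inj_on (\<lambda>\<phi>. restrict \<phi> (V - {y})) (?X p)"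
      proof (rule inj_onI)
        fix \<phi> \<psi> assume a: "\<phi> \<in> ?X p" "\<psi> \<in> ?X p"
          and eq: "restrict \<phi> (V - {y}) = restrict \<psi> (V - {y})"
        have "\<phi> z = \<psi> z" if "z \<in> V - {y}" for z using eq that by (metis restrict_apply')
        moreover have "\<phi> y = \<phi> x" "\<psi> y = \<psi> x" using a p by auto
        ultimately have "\<phi> z = \<psi> z" if "z \<in> V" for z
          using that p by (cases "z = y") auto
        then show "\<phi> = \<psi>" using a p by (intro PiE_ext[of \<phi> V _ \<psi>]) auto
      qed
      show "(\<lambda>\<phi>. restrict \<phi> (V - {y})) ` ?X p \<subseteq> (V - {y}) \<rightarrow>\<^sub>E {..<n}"
        unfolding image_subset_iff restrict_PiE_iff using p by auto
    qed (use assms in \<open>auto intro!: finite_PiE\<close>)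
    also have "\<dots> = n ^ (card V - 1)" using assms p by (simp add: card_funcsetE)
    finally show ?thesis .
  qed
  have "card {\<phi> \<in> V \<rightarrow>\<^sub>E {..<n}. \<not> inj_on \<phi> V} \<le> card (\<Union>p\<in>?P. ?X p)"
    using sub finP finX by (intro card_mono) auto
  also have "\<dots> \<le> (\<Sum>p\<in>?P. card (?X p))" by (rule card_UN_le[OF finP])
  also have "\<dots> \<le> (\<Sum>p\<in>?P. n ^ (card V - 1))" by (rule sum_mono) (rule X)
  also have "\<dots> = card ?P * n ^ (card V - 1)" by simp
  also have "card ?P \<le> card (V \<times> V)" using assms by (intro card_mono) auto
  finally show ?thesis using assms by (simp add: card_cartesian_product power2_eq_square mult_right_mono)
qed

text \<open>One enumeration for each edge is enough; the factor r0! that is given away affects only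
  constants.\<close>

lemma card_homs_single_edge_ge:
  fixes n r0 :: nat
  assumes S: "S \<subseteq> complete_edges n r0"
  shows "card S \<le> card (homs (single_edge r0) \<lparr>verts = {..<n}, edges = S\<rparr>)"
proof -
  have "\<exists>h. bij_betw h {0..<r0} \<sigma>" if "\<sigma> \<in> S" for \<sigma>
  proof -
    have "\<sigma> \<subseteq> {..<n}" "card \<sigma> = r0" using that S by auto
    moreover from this have "finite \<sigma>" by (rule_tac finite_subset) auto
    ultimately have "finite \<sigma>" "card \<sigma> = r0" by auto
    then show ?thesis using ex_bij_betw_nat_finite[of \<sigma>] by simp
  qed
  then obtain h where h: "\<And>\<sigma>. \<sigma> \<in> S \<Longrightarrow> bij_betw (h \<sigma>) {0..<r0} \<sigma>" by metis
  have im: "restrict (h \<sigma>) {..<r0} ` {..<r0} = \<sigma>" if "\<sigma> \<in> S" for \<sigma>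
    using h[OF that] by (simp add: bij_betw_def atLeast0LessThan)
  show ?thesis
  proof (rule card_inj_on_le[where f = "\<lambda>\<sigma>. restrict (h \<sigma>) {..<r0}"])
    show "inj_on (\<lambda>\<sigma>. restrict (h \<sigma>) {..<r0}) S" by (rule inj_onI) (metis im)
    show "(\<lambda>\<sigma>. restrict (h \<sigma>) {..<r0}) ` S \<subseteq> homs (single_edge r0) \<lparr>verts = {..<n}, edges = S\<rparr>"
    proof clarify
      fix \<sigma> assume \<sigma>: "\<sigma> \<in> S"
      then have "restrict (h \<sigma>) {..<r0} ` {..<r0} = \<sigma>" "\<sigma> \<subseteq> {..<n}" using im S by auto
      then show "restrict (h \<sigma>) {..<r0} \<in> homs (single_edge r0) \<lparr>verts = {..<n}, edges = S\<rparr>"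
        using \<sigma> unfolding homs_def single_edge_def by (auto simp: PiE_def Pi_def subset_iff)
    qed
    show "finite (homs (single_edge r0) \<lparr>verts = {..<n}, edges = S\<rparr>)"
      by (rule finite_subset[of _ "{..<r0} \<rightarrow>\<^sub>E {..<n}"]) (auto simp: homs_def single_edge_def intro!: finite_PiE)
  qed
qed

lemma sidorenko_homs_ge:
  fixes n r0 :: nat
  assumes sid: "sidorenko r0 F" and S: "S \<subseteq> complete_edges n r0" and n: "0 < n"
  shows "real n ^ num_verts F * (real (card S) / real n ^ r0) ^ num_edges F
    \<le> real (card (homs F \<lparr>verts = {..<n}, edges = S\<rparr>))"
proof -
  let ?H = "\<lparr>verts = {..<n}, edges = S\<rparr>"
  have "r_graph r0 ?H" using S by (auto simp: r_graph_def)
  then have "hom_density (single_edge r0) ?H ^ num_edges F \<le> hom_density F ?H"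
    using sid by (auto simp: sidorenko_def)
  moreover have "(real (card S) / real n ^ r0) ^ num_edges F \<le> hom_density (single_edge r0) ?H ^ num_edges F"
    unfolding hom_density_def using card_homs_single_edge_ge[OF S]
    by (intro power_mono) (auto simp: single_edge_def intro!: divide_right_mono)
  ultimately have "(real (card S) / real n ^ r0) ^ num_edges F \<le> hom_density F ?H" by linarith
  then show ?thesis using n by (simp add: hom_density_def le_divide_eq mult.commute)
qed

text \<open>By \<open>large\<close>, the non-injective maps, at most v^2 n^(v-1) for v =
  \<open>num_verts F\<close>, amount to no more than half of the homomorphisms guaranteed by the
  Sidorenko property.\<close>

lemma card_injective_homs_ge:
  fixes n r0 :: nat and c :: real
  assumes F: "r_graph r0 F" and sid: "sidorenko r0 F"
    and S: "S \<subseteq> complete_edges n r0" and n: "0 < n" and V: "0 < num_verts F"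
    and c: "0 \<le> c" "c \<le> real (card S) / real n ^ r0"
    and large: "2 * real (num_verts F) ^ 2 \<le> n * c ^ num_edges F"
  shows "real n ^ num_verts F * c ^ num_edges F / 2
    \<le> real (card {\<phi> \<in> homs F \<lparr>verts = {..<n}, edges = S\<rparr>. inj_on \<phi> (verts F)})"
proof -
  let ?h = "homs F \<lparr>verts = {..<n}, edges = S\<rparr>"
  let ?v = "num_verts F" and ?s = "num_edges F"
  have fV: "finite (verts F)" using F by (simp add: r_graph_def)
  have sub: "?h \<subseteq> verts F \<rightarrow>\<^sub>E {..<n}" by (auto simp: homs_def)
  have fin: "finite ?h" by (rule finite_subset[OF sub]) (use fV in \<open>auto intro!: finite_PiE\<close>)
  have "real n ^ ?v * c ^ ?s \<le> real n ^ ?v * (real (card S) / real n ^ r0) ^ ?s"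
    using c by (intro mult_left_mono power_mono) auto
  also have "\<dots> \<le> real (card ?h)" by (rule sidorenko_homs_ge[OF sid S n])
  also have "card ?h = card {\<phi> \<in> ?h. inj_on \<phi> (verts F)} + card {\<phi> \<in> ?h. \<not> inj_on \<phi> (verts F)}"
    using fin by (subst card_Un_disjoint[symmetric]) (auto intro!: arg_cong[where f = card])
  also have "card {\<phi> \<in> ?h. \<not> inj_on \<phi> (verts F)} \<le> ?v ^ 2 * n ^ (?v - 1)"
  proof -
    have "card {\<phi> \<in> ?h. \<not> inj_on \<phi> (verts F)} \<le> card {\<phi> \<in> verts F \<rightarrow>\<^sub>E {..<n}. \<not> inj_on \<phi> (verts F)}"
      by (rule card_mono) (use fV sub in \<open>auto intro!: finite_PiE\<close>)
    also have "\<dots> \<le> ?v ^ 2 * n ^ (?v - 1)" by (rule card_not_inj_le[OF fV])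
    finally show ?thesis .
  qed
  finally have "real n ^ ?v * c ^ ?s \<le>
      real (card {\<phi> \<in> ?h. inj_on \<phi> (verts F)}) + real ?v ^ 2 * real n ^ (?v - 1)"
    by (simp flip: of_nat_power of_nat_mult of_nat_add)
  moreover have "2 * (real ?v ^ 2 * real n ^ (?v - 1)) \<le> real n ^ ?v * c ^ ?s"
  proof -
    have "2 * real ?v ^ 2 * real n ^ (?v - 1) \<le> n * c ^ ?s * real n ^ (?v - 1)"
      using large by (intro mult_right_mono) auto
    also have "\<dots> = real n ^ Suc (?v - 1) * c ^ ?s" by simp
    also have "Suc (?v - 1) = ?v" using V by simp
    finally show ?thesis by (simp add: mult_ac)
  qed
  ultimately show ?thesis by simp
qed

text \<open>\<open>\<phi>\<close> places the vertices of \<open>F\<close>, and \<open>g\<close>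
  lifts the image of each edge to an edge of \<open>H\<close> with that projection, so only copies
  compatible with \<open>\<pi>\<close> are counted. The new vertices of an edge are recorded as a
  set, without an order; the last two conditions keep them off the image of \<open>\<phi>\<close>
  and disjoint for different edges.\<close>

definition expansion_copies ::
  "'a hypergraph \<Rightarrow> nat \<Rightarrow> (nat set \<Rightarrow> nat set) \<Rightarrow> nat set set \<Rightarrow> (('a \<Rightarrow> nat) \<times> ('a set \<Rightarrow> nat set)) set" where
  "expansion_copies F n \<pi> H =
     {(\<phi>, g). \<phi> \<in> verts F \<rightarrow>\<^sub>E {..<n} \<and> inj_on \<phi> (verts F) \<and>
        g \<in> (\<Pi>\<^sub>E e\<in>edges F. {f \<in> H. \<pi> f = \<phi> ` e}) \<and>
        (\<forall>e\<in>edges F. (g e - \<phi> ` e) \<inter> \<phi> ` verts F = {}) \<and>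
        (\<forall>e\<in>edges F. \<forall>e'\<in>edges F. e \<noteq> e' \<longrightarrow> (g e - \<phi> ` e) \<inter> (g e' - \<phi> ` e') = {})}"

lemma expansion_copies_mono: "H \<subseteq> H' \<Longrightarrow> expansion_copies F n \<pi> H \<subseteq> expansion_copies F n \<pi> H'"
  by (fastforce simp: expansion_copies_def PiE_def Pi_def)

lemma r_graph_finite:
  assumes "r_graph r F"
  shows "finite (verts F)" "finite (edges F)" "\<And>e. e \<in> edges F \<Longrightarrow> finite e"
proof -
  show "finite (verts F)" using assms by (simp add: r_graph_def)
  then show "finite (edges F)" using assms by (rule_tac finite_subset[of _ "Pow (verts F)"]) (auto simp: r_graph_def)
  show "finite e" if "e \<in> edges F" for e
    by (rule finite_subset[of e "verts F"]) (use assms that in \<open>auto simp: r_graph_def\<close>)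
qed

lemma finite_expansion_copies:
  assumes F: "r_graph r0 F" and H: "finite H"
  shows "finite (expansion_copies F n \<pi> H)"
proof -
  note fin = r_graph_finite[OF F]
  have "expansion_copies F n \<pi> H \<subseteq> (verts F \<rightarrow>\<^sub>E {..<n}) \<times> (edges F \<rightarrow>\<^sub>E H)"
    by (auto simp: expansion_copies_def PiE_def Pi_def)
  then show ?thesis using fin H by (rule_tac finite_subset) (auto intro!: finite_PiE finite_cartesian_product)
qed

text \<open>The edges are lifted one at a time. At every moment at most
  \<open>num_verts F + num_edges F * r\<close> vertices are occupied, and each occupied vertex
  outside the image of \<open>e\<close> excludes at most n^(r - r0 - 1) of the edges above that
  image. The second summand in \<open>cls\<close> pays for these exclusions.\<close>

lemma card_extensions_ge:
  assumes F: "r_graph r0 F" and H: "H \<subseteq> complete_edges n r"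
    and \<pi>: "\<And>f. f \<in> H \<Longrightarrow> \<pi> f \<subseteq> f" and \<phi>: "inj_on \<phi> (verts F)" and m: "0 \<le> m"
    and cls: "\<And>e. e \<in> edges F \<Longrightarrow>
      m + (num_verts F + num_edges F * r) * real n ^ (r - r0 - 1) \<le> real (card {f \<in> H. \<pi> f = \<phi> ` e})"
  shows "m ^ num_edges F \<le> real (card {g \<in> (\<Pi>\<^sub>E e\<in>edges F. {f \<in> H. \<pi> f = \<phi> ` e}).
      (\<forall>e\<in>edges F. (g e - \<phi> ` e) \<inter> \<phi> ` verts F = {}) \<and>
      (\<forall>e\<in>edges F. \<forall>e'\<in>edges F. e \<noteq> e' \<longrightarrow> (g e - \<phi> ` e) \<inter> (g e' - \<phi> ` e') = {})})"
proof -
  note fin = r_graph_finite[OF F]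
  have finH: "finite H" using H by (rule finite_subset) simp
  define P where "P E0 g \<longleftrightarrow> (\<forall>e\<in>E0. (g e - \<phi> ` e) \<inter> \<phi> ` verts F = {}) \<and>
      (\<forall>e\<in>E0. \<forall>e'\<in>E0. e \<noteq> e' \<longrightarrow> (g e - \<phi> ` e) \<inter> (g e' - \<phi> ` e') = {})" for E0 g
  let ?A = "\<lambda>e. {f \<in> H. \<pi> f = \<phi> ` e}"
  have "m ^ num_edges F \<le> real (card {g \<in> PiE (edges F) ?A. P (edges F) g})"
  proof (rule card_choices_ge[OF fin(2) _ m])
    fix E0 e g assume E0: "E0 \<subseteq> edges F" "e \<in> edges F - E0" and g: "g \<in> PiE E0 ?A" and Pg: "P E0 g"
    have E0fin: "finite E0" using E0 fin finite_subset by blast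
    define Z where "Z = \<phi> ` verts F \<union> (\<Union>e'\<in>E0. g e')"
    have gH: "g e' \<in> H" if "e' \<in> E0" for e' using g that by auto
    have "finite (g e')" if "e' \<in> E0" for e'
      by (rule finite_subset[of _ "{..<n}"]) (use gH[OF that] H in auto)
    then have finZ: "finite Z" unfolding Z_def using fin E0fin by blast
    have "card Z \<le> card (\<phi> ` verts F) + card (\<Union>e'\<in>E0. g e')" unfolding Z_def by (rule card_Un_le)
    also have "\<dots> \<le> num_verts F + (\<Sum>e'\<in>E0. card (g e'))"
      using fin by (intro add_mono card_image_le card_UN_le E0fin) auto
    also have "(\<Sum>e'\<in>E0. card (g e')) = card E0 * r" using gH H by (subst sum.cong[OF refl, of _ _ "\<lambda>_. r"]) auto
    also have "\<dots> \<le> num_edges F * r" using E0 fin by (intro mult_right_mono card_mono) auto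
    finally have cZ: "card Z \<le> num_verts F + num_edges F * r" by simp
    have ce: "card (\<phi> ` e) = r0"
      using \<phi> E0 F by (subst card_image) (auto simp: r_graph_def intro: inj_on_subset)
    let ?bad = "\<Union>x\<in>Z - \<phi> ` e. {a. a \<subseteq> {..<n} \<and> card a = r \<and> insert x (\<phi> ` e) \<subseteq> a}"
    have fbad: "finite ?bad" using finZ by auto
    have "card ?bad \<le> (\<Sum>x\<in>Z - \<phi> ` e. card {a. a \<subseteq> {..<n} \<and> card a = r \<and> insert x (\<phi> ` e) \<subseteq> a})"
      using finZ by (intro card_UN_le) auto
    also have "\<dots> \<le> (\<Sum>x\<in>Z - \<phi> ` e. n ^ (r - r0 - 1))"
    proof (rule sum_mono)
      fix x assume x: "x \<in> Z - \<phi> ` e"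
      have fe: "finite (\<phi> ` e)" using fin E0 by auto
      have "card {a. a \<subseteq> {..<n} \<and> card a = r \<and> insert x (\<phi> ` e) \<subseteq> a} \<le> n ^ (r - card (insert x (\<phi> ` e)))"
        by (rule card_supersets_le) (use fe in auto)
      also have "card (insert x (\<phi> ` e)) = Suc r0" using x fe ce by simp
      finally show "card {a. a \<subseteq> {..<n} \<and> card a = r \<and> insert x (\<phi> ` e) \<subseteq> a} \<le> n ^ (r - r0 - 1)"
        by simp
    qed
    also have "\<dots> \<le> (num_verts F + num_edges F * r) * n ^ (r - r0 - 1)"
      using cZ card_mono[OF finZ, of "Z - \<phi> ` e"] by (simp add: mult_right_mono)
    finally have "real (card ?bad) \<le> real ((num_verts F + num_edges F * r) * n ^ (r - r0 - 1))"
      by (rule of_nat_mono)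
    then have "real (card ?bad) \<le> (num_verts F + num_edges F * r) * real n ^ (r - r0 - 1)"
      unfolding of_nat_mult of_nat_power .
    then have "m \<le> real (card (?A e)) - real (card ?bad)" using cls[of e] E0 by simp
    also have "\<dots> \<le> real (card (?A e - ?bad))"
      using diff_card_le_card_Diff[OF fbad, of "?A e"] by linarith
    also have "card (?A e - ?bad) \<le> card {a \<in> ?A e. P (insert e E0) (g(e := a))}"
    proof (rule card_mono)
      show "?A e - ?bad \<subseteq> {a \<in> ?A e. P (insert e E0) (g(e := a))}"
      proof
        fix a assume a: "a \<in> ?A e - ?bad"
        then have "\<phi> ` e \<subseteq> a" using \<pi> by fastforce
        then have dis: "(a - \<phi> ` e) \<inter> Z = {}" using a H by auto
        have "P (insert e E0) (g(e := a))"
          unfolding P_def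
        proof (intro conjI ballI impI)
          fix e1 assume "e1 \<in> insert e E0"
          then show "((g(e := a)) e1 - \<phi> ` e1) \<inter> \<phi> ` verts F = {}"
            using Pg dis unfolding P_def Z_def by (cases "e1 = e") auto
        next
          fix e1 e2 assume "e1 \<in> insert e E0" "e2 \<in> insert e E0" "e1 \<noteq> e2"
          moreover have "(a - \<phi> ` e) \<inter> (g e' - \<phi> ` e') = {}" if "e' \<in> E0" for e'
            using dis that unfolding Z_def by blast
          ultimately show "((g(e := a)) e1 - \<phi> ` e1) \<inter> ((g(e := a)) e2 - \<phi> ` e2) = {}"
            using Pg unfolding P_def by (cases "e1 = e"; cases "e2 = e") (auto simp: Int_commute)
        qed
        then show "a \<in> {a \<in> ?A e. P (insert e E0) (g(e := a))}" using a by simp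
      qed
    qed (use finH in auto)
    finally show "m \<le> real (card {a \<in> ?A e. P (insert e E0) (g(e := a))})" by simp
  qed (use finH in \<open>auto simp: P_def\<close>)
  then show ?thesis by (simp add: P_def)
qed

text \<open>The projection of \<open>H\<close> consists of about card H / D sets. The Sidorenko
  property contributes the s-th power of its density and the lifting about D^s, so \<open>D\<close>
  cancels and the bound involves only \<open>card H\<close>. It is stated for every
  \<open>H'\<close> containing half of \<open>H\<close> because the balanced selection of copies
  asks for copies that avoid an arbitrary half.\<close>

lemma card_expansion_copies_ge:
  fixes D c :: real
  assumes F: "r_graph r0 F" and sid: "sidorenko r0 F" and V: "0 < num_verts F"
    and H: "H \<subseteq> complete_edges n r" and n: "0 < n"
    and \<pi>: "\<And>f. f \<in> H \<Longrightarrow> \<pi> f \<subseteq> f \<and> card (\<pi> f) = r0" and D: "0 < D"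
    and cls: "\<And>\<sigma>. \<sigma> \<in> \<pi> ` H \<Longrightarrow> D \<le> card {f \<in> H. \<pi> f = \<sigma>} \<and> card {f \<in> H. \<pi> f = \<sigma>} \<le> 2 * D"
    and Dlarge: "8 * ((num_verts F + num_edges F * r) * real n ^ (r - r0 - 1)) \<le> D"
    and c: "0 \<le> c" "c \<le> real (card H) / (16 * D * real n ^ r0)"
    and large: "2 * real (num_verts F) ^ 2 \<le> n * c ^ num_edges F"
    and H': "H' \<subseteq> H" "real (card H) / 2 \<le> real (card H')"
  shows "real n ^ num_verts F * (real (card H) / (128 * real n ^ r0)) ^ num_edges F / 2
    \<le> real (card (expansion_copies F n \<pi> H'))"
proof -
  let ?v = "num_verts F" and ?s = "num_edges F"
  note fin = r_graph_finite[OF F]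
  have finH: "finite H" using H by (rule finite_subset) simp
  have finH': "finite H'" using finH H' finite_subset by blast
  define S where "S = \<pi> ` H"
  have finS: "finite S" using finH by (simp add: S_def)
  define S' where "S' = {\<sigma> \<in> S. D / 4 \<le> card {f \<in> H'. \<pi> f = \<sigma>}}"
  have split: "real (card A) = (\<Sum>\<sigma>\<in>S. real (card {f \<in> A. \<pi> f = \<sigma>}))" if "A \<subseteq> H" for A
  proof -
    have "finite A" using that finH finite_subset by blast
    then have "card A = (\<Sum>\<sigma>\<in>S. card {f \<in> A. \<pi> f = \<sigma>})"
      using that finS by (subst card_UN_disjoint[symmetric]) (auto simp: S_def intro!: arg_cong[where f = card])
    then show ?thesis by simp
  qed
  have ND: "real (card S) * D \<le> real (card H)" "real (card H) \<le> real (card S) * (2 * D)"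
    using sum_mono[of S "\<lambda>_. D" "\<lambda>\<sigma>. real (card {f \<in> H. \<pi> f = \<sigma>})"]
      sum_mono[of S "\<lambda>\<sigma>. real (card {f \<in> H. \<pi> f = \<sigma>})" "\<lambda>_. 2 * D"] cls
    unfolding split[OF order_refl] by (simp_all add: S_def)
  \<comment> \<open>Averaging: a set outside \<open>S'\<close> accounts for at most D / 4 edges of
    \<open>H'\<close>, one in \<open>S'\<close> for at most 2 D. So \<open>S'\<close> contains at
    least one eighth of \<open>S\<close>.\<close>
  have "real (card S) * D / 2 \<le> real (card H')" using ND H' by linarith
  also have "\<dots> \<le> (\<Sum>\<sigma>\<in>S. (if \<sigma> \<in> S' then 2 * D else 0) + D / 4)"
    unfolding split[OF H'(1)]
  proof (rule sum_mono)
    fix \<sigma> assume \<sigma>: "\<sigma> \<in> S"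
    have "card {f \<in> H'. \<pi> f = \<sigma>} \<le> card {f \<in> H. \<pi> f = \<sigma>}"
      using H' finH by (intro card_mono) auto
    then have "real (card {f \<in> H'. \<pi> f = \<sigma>}) \<le> 2 * D"
      using cls[of \<sigma>] \<sigma> by (auto simp: S_def)
    then show "real (card {f \<in> H'. \<pi> f = \<sigma>}) \<le> (if \<sigma> \<in> S' then 2 * D else 0) + D / 4"
      using \<sigma> D by (auto simp: S'_def)
  qed
  also have "\<dots> = real (card S') * (2 * D) + real (card S) * (D / 4)"
  proof -
    have "(\<Sum>\<sigma>\<in>S. if \<sigma> \<in> S' then 2 * D else 0) = (\<Sum>\<sigma>\<in>S'. 2 * D)"
      using finS by (intro sum.mono_neutral_cong_right) (auto simp: S'_def)
    then show ?thesis by (simp add: sum.distrib)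
  qed
  finally have "real (card S) / 8 * D \<le> real (card S') * D" by (simp add: algebra_simps)
  then have S'8: "real (card S) / 8 \<le> real (card S')" using D by (rule mult_right_le_imp_le)
  have S'sub: "S' \<subseteq> complete_edges n r0" using \<pi> H by (fastforce simp: S'_def S_def)
  define c' where "c' = real (card H) / (16 * D * real n ^ r0)"
  have c'0: "0 \<le> c'" using D by (simp add: c'_def)
  have "c' \<le> real (card S') / real n ^ r0"
  proof -
    have "real (card S) * (2 * D) \<le> (8 * real (card S')) * (2 * D)"
      using S'8 D by (intro mult_right_mono) auto
    then have "real (card H) \<le> (8 * real (card S')) * (2 * D)" using ND(2) by linarith
    then have "real (card H) / (16 * D) \<le> real (card S')"
      using D by (simp add: divide_le_eq algebra_simps)
    then show ?thesis using n by (simp add: c'_def divide_simps)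
  qed
  then have homs: "real n ^ ?v * c' ^ ?s / 2
    \<le> real (card {\<phi> \<in> homs F \<lparr>verts = {..<n}, edges = S'\<rparr>. inj_on \<phi> (verts F)})" (is "_ \<le> real (card ?I)")
  proof (rule card_injective_homs_ge[OF F sid S'sub n V c'0])
    have "n * c ^ ?s \<le> n * c' ^ ?s" using c c'0 by (intro mult_left_mono power_mono) (auto simp: c'_def)
    then show "2 * real ?v ^ 2 \<le> n * c' ^ ?s" using large by linarith
  qed
  let ?X = "\<lambda>\<phi>. {g \<in> (\<Pi>\<^sub>E e\<in>edges F. {f \<in> H'. \<pi> f = \<phi> ` e}).
      (\<forall>e\<in>edges F. (g e - \<phi> ` e) \<inter> \<phi> ` verts F = {}) \<and>
      (\<forall>e\<in>edges F. \<forall>e'\<in>edges F. e \<noteq> e' \<longrightarrow> (g e - \<phi> ` e) \<inter> (g e' - \<phi> ` e') = {})}"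
  have finI: "finite ?I"
    by (rule finite_subset[of _ "verts F \<rightarrow>\<^sub>E {..<n}"]) (use fin in \<open>auto simp: homs_def intro!: finite_PiE\<close>)
  \<comment> \<open>Of the D / 4 edges above the image of each edge, D / 8 remain after
    \<open>Dlarge\<close> has paid for the collisions.\<close>
  have X: "(D / 8) ^ ?s \<le> real (card (?X \<phi>))" if \<phi>: "\<phi> \<in> ?I" for \<phi>
  proof (rule card_extensions_ge[OF F])
    show "H' \<subseteq> complete_edges n r" "inj_on \<phi> (verts F)" "0 \<le> D / 8"
      using H H' \<phi> D by auto
    show "\<pi> f \<subseteq> f" if "f \<in> H'" for f using that \<pi> H' by auto
    show "D / 8 + (num_verts F + num_edges F * r) * real n ^ (r - r0 - 1)
        \<le> real (card {f \<in> H'. \<pi> f = \<phi> ` e})" if "e \<in> edges F" for e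
    proof -
      have "\<phi> ` e \<in> S'" using that \<phi> by (auto simp: homs_def)
      then have "D / 4 \<le> real (card {f \<in> H'. \<pi> f = \<phi> ` e})" by (simp add: S'_def)
      then show ?thesis using Dlarge by linarith
    qed
  qed
  have "finite (\<Pi>\<^sub>E e\<in>edges F. {f \<in> H'. \<pi> f = \<phi> ` e})" for \<phi>
    using fin finH' by (intro finite_PiE) auto
  then have finX: "finite (?X \<phi>)" for \<phi> by simp
  have "real n ^ ?v * (real (card H) / (128 * real n ^ r0)) ^ ?s / 2 = real n ^ ?v * c' ^ ?s / 2 * (D / 8) ^ ?s"
  proof -
    \<comment> \<open>The constant is 16 times 8; here \<open>D\<close> cancels between the density
      of \<open>S'\<close> and the number of liftings.\<close>
    have "real (card H) / (128 * real n ^ r0) = c' * (D / 8)" using D by (simp add: c'_def)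
    then show ?thesis by (simp only: power_mult_distrib) simp
  qed
  also have "\<dots> \<le> real (card ?I) * (D / 8) ^ ?s" using homs D by (intro mult_right_mono) auto
  also have "\<dots> = (\<Sum>\<phi>\<in>?I. (D / 8) ^ ?s)" by simp
  also have "\<dots> \<le> (\<Sum>\<phi>\<in>?I. real (card (?X \<phi>)))" by (rule sum_mono) (rule X)
  also have "\<dots> = real (card (SIGMA \<phi>:?I. ?X \<phi>))" using finI finX by (subst card_SigmaI) auto
  also have "card (SIGMA \<phi>:?I. ?X \<phi>) \<le> card (expansion_copies F n \<pi> H')"
    by (rule card_mono[OF finite_expansion_copies[OF F finH']]) (auto simp: expansion_copies_def homs_def)
  finally show ?thesis by simp
qed

text \<open>\<open>\<pi>\<close> recovers the image of \<open>e\<close> from \<open>g e\<close>, and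
  \<open>\<phi>\<close> is injective.\<close>

lemma expansion_copies_inj:
  assumes F: "r_graph r0 F" and "(\<phi>, g) \<in> expansion_copies F n \<pi> H"
  shows "inj_on g (edges F)"
proof (rule inj_onI)
  fix e e' assume e: "e \<in> edges F" "e' \<in> edges F" "g e = g e'"
  have "g \<in> (\<Pi>\<^sub>E e\<in>edges F. {f \<in> H. \<pi> f = \<phi> ` e})"
    using assms(2) by (simp add: expansion_copies_def)
  from PiE_mem[OF this e(1)] PiE_mem[OF this e(2)] have "\<phi> ` e = \<phi> ` e'" using e(3) by simp
  moreover have "inj_on \<phi> (verts F)" using assms(2) by (auto simp: expansion_copies_def)
  moreover have "e \<subseteq> verts F" "e' \<subseteq> verts F" using F e by (auto simp: r_graph_def)
  ultimately show "e = e'" by (simp add: inj_on_image_eq_iff)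
qed

lemma card_Sigma_le:
  fixes b :: real
  assumes "finite A" "\<And>a. a \<in> A \<Longrightarrow> finite (B a)" "\<And>a. a \<in> A \<Longrightarrow> real (card (B a)) \<le> b"
  shows "real (card (SIGMA a:A. B a)) \<le> real (card A) * b"
proof -
  have "real (card (SIGMA a:A. B a)) = (\<Sum>a\<in>A. real (card (B a)))"
    using assms by (subst card_SigmaI) auto
  also have "\<dots> \<le> (\<Sum>a\<in>A. b)" by (rule sum_mono) (rule assms)
  finally show ?thesis by simp
qed

text \<open>Fix which edge of \<open>J\<close> each member of \<open>A\<close> is lifted to. Every
  vertex of \<Union>A is then confined to a known set of size r0, and the edges in \<open>A\<close>
  are determined; what remains free are the vertices outside \<Union>A, with n choices each, and the
  edges outside \<open>A\<close>, with at most \<open>D\<close> choices each.\<close>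

lemma card_copies_through_le:
  fixes D :: real
  assumes F: "r_graph r0 F" and finH: "finite H" and r0: "1 \<le> r0"
    and \<pi>: "\<And>f. f \<in> H \<Longrightarrow> card (\<pi> f) = r0 \<and> finite (\<pi> f)"
    and cls: "\<And>\<sigma>. real (card {f \<in> H. \<pi> f = \<sigma>}) \<le> D"
    and A: "A \<subseteq> edges F" and J: "J \<subseteq> H" "card J = card A"
  shows "real (card {(\<phi>, g) \<in> expansion_copies F n \<pi> H. g ` A = J}) \<le>
    real (num_edges F ^ num_edges F * r0 ^ num_verts F) *
      (real n ^ (num_verts F - card (\<Union>A)) * D ^ (num_edges F - card A))"
proof -
  let ?s = "num_edges F" and ?v = "num_verts F"
  note fin = r_graph_finite[OF F]
  have finA: "finite A" using A fin finite_subset by blast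
  have UA: "\<Union>A \<subseteq> verts F" using A F by (auto simp: r_graph_def)
  have finUA: "finite (\<Union>A)" using UA fin finite_subset by blast
  have D0: "0 \<le> D" using cls[of "{}"] by (meson of_nat_0_le_iff order_trans)
  have finJ: "finite J" using J finH finite_subset by blast
  \<comment> \<open>\<open>ex x\<close> is some edge of \<open>A\<close> through \<open>x\<close>;
    its lift confines \<open>\<phi> x\<close>.\<close>
  define ex where "ex x = (SOME e. e \<in> A \<and> x \<in> e)" for x
  have ex: "ex x \<in> A \<and> x \<in> ex x" if "x \<in> \<Union>A" for x
    unfolding ex_def by (rule someI_ex) (use that in blast)
  define \<Gamma> where "\<Gamma> = (A \<rightarrow>\<^sub>E J)"
  define \<Phi> where "\<Phi> \<gamma> = (\<Pi>\<^sub>E x\<in>verts F. if x \<in> \<Union>A then \<pi> (\<gamma> (ex x)) else {..<n})" for \<gamma> :: "'a set \<Rightarrow> nat set"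
  define G where "G \<phi> = (\<Pi>\<^sub>E e\<in>edges F - A. {f \<in> H. \<pi> f = \<phi> ` e})" for \<phi> :: "'a \<Rightarrow> nat"
  have finG: "finite (G \<phi>)" for \<phi> unfolding G_def using fin finH by (intro finite_PiE) auto
  have \<gamma>H: "\<gamma> (ex x) \<in> H" if "\<gamma> \<in> \<Gamma>" "x \<in> \<Union>A" for \<gamma> x
    using that ex[OF that(2)] J unfolding \<Gamma>_def by (metis PiE_mem subsetD)
  have fin\<Phi>: "finite (\<Phi> \<gamma>)" if "\<gamma> \<in> \<Gamma>" for \<gamma>
    unfolding \<Phi>_def using fin \<gamma>H[OF that] \<pi> by (intro finite_PiE) auto
  have fin\<Gamma>: "finite \<Gamma>" unfolding \<Gamma>_def using finA finJ by (intro finite_PiE) auto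
  have c\<Gamma>: "real (card \<Gamma>) \<le> real (?s ^ ?s)"
  proof -
    have "card A \<le> ?s" using A fin by (simp add: card_mono)
    then have "card A ^ card A \<le> ?s ^ ?s"
      by (cases "?s = 0") (auto intro: order_trans[OF power_mono power_increasing])
    then show ?thesis unfolding \<Gamma>_def using finA J by (simp add: card_funcsetE flip: of_nat_power)
  qed
  have c\<Phi>: "real (card (\<Phi> \<gamma>)) \<le> real (r0 ^ ?v) * real n ^ (?v - card (\<Union>A))" if "\<gamma> \<in> \<Gamma>" for \<gamma>
  proof -
    have "card (\<Phi> \<gamma>) = (\<Prod>x\<in>verts F. if x \<in> \<Union>A then r0 else n)"
      unfolding \<Phi>_def card_PiE[OF fin(1)] by (rule prod.cong) (use \<gamma>H[OF that] \<pi> in auto)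
    also have "\<dots> = r0 ^ card (\<Union>A) * n ^ card (verts F - \<Union>A)"
      using fin UA by (subst prod.If_cases) (auto simp: Int_absorb1 Diff_eq simp del: Union_iff)
    also have "card (verts F - \<Union>A) = ?v - card (\<Union>A)" using finUA UA by (simp add: card_Diff_subset)
    also have "r0 ^ card (\<Union>A) \<le> r0 ^ ?v"
      using r0 UA fin by (intro power_increasing card_mono) auto
    finally have "card (\<Phi> \<gamma>) \<le> r0 ^ ?v * n ^ (?v - card (\<Union>A))" by simp
    then show ?thesis by (metis of_nat_mono of_nat_mult of_nat_power)
  qed
  have cG: "real (card (G \<phi>)) \<le> D ^ (?s - card A)" for \<phi>
  proof -
    have "real (card (G \<phi>)) = (\<Prod>e\<in>edges F - A. real (card {f \<in> H. \<pi> f = \<phi> ` e}))"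
      unfolding G_def using fin by (simp add: card_PiE)
    also have "\<dots> \<le> (\<Prod>e\<in>edges F - A. D)" by (rule prod_mono) (use cls in auto)
    finally show ?thesis using finA A by (simp add: card_Diff_subset)
  qed
  let ?C = "{(\<phi>, g) \<in> expansion_copies F n \<pi> H. g ` A = J}"
  let ?T = "SIGMA \<gamma>:\<Gamma>. SIGMA \<phi>:\<Phi> \<gamma>. G \<phi>"
  let ?f = "\<lambda>(\<phi>, g). (restrict g A, \<phi>, restrict g (edges F - A))"
  have finT: "finite ?T" using fin\<Gamma> fin\<Phi> finG by (intro finite_SigmaI) auto
  have "card ?C \<le> card ?T"
  proof (rule card_inj_on_le[OF _ _ finT])
    show "inj_on ?f ?C"
    proof (rule inj_onI)
      fix p p' assume p: "p \<in> ?C" "p' \<in> ?C" and eq: "?f p = ?f p'"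
      obtain \<phi> g \<phi>' g' where pp: "p = (\<phi>, g)" "p' = (\<phi>', g')" by (metis surj_pair)
      have a: "(\<phi>, g) \<in> expansion_copies F n \<pi> H" "(\<phi>', g') \<in> expansion_copies F n \<pi> H"
        using p pp by auto
      have \<phi>\<phi>: "\<phi> = \<phi>'" and e1: "restrict g A = restrict g' A"
        and e2: "restrict g (edges F - A) = restrict g' (edges F - A)"
        using eq pp by auto
      have "g e = g' e" if "e \<in> edges F" for e
      proof (cases "e \<in> A")
        case True then show ?thesis using e1 by (metis restrict_apply')
      next
        case False
        with that have "e \<in> edges F - A" by simp
        then show ?thesis using e2 by (metis restrict_apply')
      qed
      moreover have "g \<in> extensional (edges F)" "g' \<in> extensional (edges F)"
        using a by (auto simp: expansion_copies_def PiE_def)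
      ultimately have "g = g'" by (intro extensionalityI[of g "edges F"]) auto
      then show "p = p'" using \<phi>\<phi> pp by simp
    qed
    show "?f ` ?C \<subseteq> ?T"
    proof (rule image_subsetI)
      fix p assume p: "p \<in> ?C"
      obtain \<phi> g where pp: "p = (\<phi>, g)" by (metis surj_pair)
      have a: "(\<phi>, g) \<in> expansion_copies F n \<pi> H" and gA: "J = g ` A" using p pp by auto
      have \<phi>: "\<phi> \<in> verts F \<rightarrow>\<^sub>E {..<n}" and g: "\<And>e. e \<in> edges F \<Longrightarrow> g e \<in> H \<and> \<pi> (g e) = \<phi> ` e"
        using a by (auto simp: expansion_copies_def PiE_def Pi_def)
      have 1: "restrict g A \<in> \<Gamma>" using gA by (auto simp: \<Gamma>_def)
      have 2: "restrict g (edges F - A) \<in> G \<phi>" unfolding G_def restrict_PiE_iff using g by auto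
      have "\<phi> \<in> \<Phi> (restrict g A)"
        unfolding \<Phi>_def
      proof (rule PiE_I)
        fix x assume x: "x \<in> verts F"
        show "\<phi> x \<in> (if x \<in> \<Union>A then \<pi> (restrict g A (ex x)) else {..<n})"
        proof (cases "x \<in> \<Union>A")
          case True
          then have "\<pi> (restrict g A (ex x)) = \<phi> ` ex x" using ex[OF True] g A by auto
          then show ?thesis using True ex[OF True] by auto
        next
          case False
          then show ?thesis using \<phi> x by auto
        qed
      next
        fix x assume "x \<notin> verts F"
        then show "\<phi> x = undefined" using \<phi> by (auto simp: PiE_def extensional_def)
      qed
      then show "?f p \<in> ?T" using 1 2 pp by simp
    qed
  qed
  then have "real (card ?C) \<le> real (card ?T)" by (rule of_nat_mono)
  also have "\<dots> \<le> real (card \<Gamma>) * (real (r0 ^ ?v) * real n ^ (?v - card (\<Union>A)) * D ^ (?s - card A))"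
  proof (rule card_Sigma_le[OF fin\<Gamma>])
    fix \<gamma> assume \<gamma>: "\<gamma> \<in> \<Gamma>"
    show "finite (SIGMA \<phi>:\<Phi> \<gamma>. G \<phi>)" using fin\<Phi>[OF \<gamma>] finG by (intro finite_SigmaI) auto
    have "real (card (SIGMA \<phi>:\<Phi> \<gamma>. G \<phi>)) \<le> real (card (\<Phi> \<gamma>)) * D ^ (?s - card A)"
      by (rule card_Sigma_le[OF fin\<Phi>[OF \<gamma>] finG cG])
    also have "\<dots> \<le> real (r0 ^ ?v) * real n ^ (?v - card (\<Union>A)) * D ^ (?s - card A)"
      using c\<Phi>[OF \<gamma>] D0 by (intro mult_right_mono) auto
    finally show "real (card (SIGMA \<phi>:\<Phi> \<gamma>. G \<phi>)) \<le> \<dots>" .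
  qed
  also have "\<dots> \<le> real (?s ^ ?s) * (real (r0 ^ ?v) * real n ^ (?v - card (\<Union>A)) * D ^ (?s - card A))"
    using c\<Gamma> D0 by (intro mult_right_mono) auto
  finally show ?thesis by (simp add: mult_ac)
qed

text \<open>Since \<open>g\<close> is injective, the edges lifted into \<open>J\<close> form a set
  \<open>A\<close> of the same cardinality as \<open>J\<close>, and there are at most 2 ^ num_edges
  F candidates for \<open>A\<close>.\<close>

lemma card_copies_containing_le:
  fixes D B :: real
  assumes F: "r_graph r0 F" and finH: "finite H" and r0: "1 \<le> r0"
    and \<pi>: "\<And>f. f \<in> H \<Longrightarrow> card (\<pi> f) = r0 \<and> finite (\<pi> f)"
    and cls: "\<And>\<sigma>. real (card {f \<in> H. \<pi> f = \<sigma>}) \<le> D"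
    and J: "J \<subseteq> H"
    and B: "\<And>A. A \<subseteq> edges F \<Longrightarrow> card A = card J \<Longrightarrow>
      real n ^ (num_verts F - card (\<Union>A)) * D ^ (num_edges F - card A) \<le> B"
    and B0: "0 \<le> B"
  shows "real (card {(\<phi>, g) \<in> expansion_copies F n \<pi> H. J \<subseteq> g ` edges F}) \<le>
    2 ^ num_edges F * real (num_edges F ^ num_edges F * r0 ^ num_verts F) * B"
proof -
  let ?C = "\<lambda>A. {(\<phi>, g) \<in> expansion_copies F n \<pi> H. g ` A = J}"
  let ?k = "real (num_edges F ^ num_edges F * r0 ^ num_verts F)"
  note fin = r_graph_finite[OF F]
  let ?I = "{A. A \<subseteq> edges F \<and> card A = card J}"
  have finI: "finite ?I" using fin by simp
  have finC: "finite (?C A)" for A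
    by (rule finite_subset[OF _ finite_expansion_copies[OF F finH, of n \<pi>]]) auto
  have "{(\<phi>, g) \<in> expansion_copies F n \<pi> H. J \<subseteq> g ` edges F} \<subseteq> (\<Union>A\<in>?I. ?C A)"
  proof clarify
    fix \<phi> g assume a: "(\<phi>, g) \<in> expansion_copies F n \<pi> H" and sub: "J \<subseteq> g ` edges F"
    have inj: "inj_on g (edges F)" by (rule expansion_copies_inj[OF F a])
    define A where "A = {e \<in> edges F. g e \<in> J}"
    have "g ` A = J" using sub by (auto simp: A_def)
    moreover from this have "card A = card J"
      using card_image[OF inj_on_subset[OF inj, of A]] by (auto simp: A_def)
    moreover have "A \<subseteq> edges F" by (auto simp: A_def)
    ultimately show "(\<phi>, g) \<in> (\<Union>A\<in>?I. ?C A)" using a by (intro UN_I[of A]) auto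
  qed
  then have "card {(\<phi>, g) \<in> expansion_copies F n \<pi> H. J \<subseteq> g ` edges F} \<le> card (\<Union>A\<in>?I. ?C A)"
    using finI finC by (intro card_mono) auto
  also have "\<dots> \<le> (\<Sum>A\<in>?I. card (?C A))" by (rule card_UN_le[OF finI])
  finally have "real (card {(\<phi>, g) \<in> expansion_copies F n \<pi> H. J \<subseteq> g ` edges F}) \<le> (\<Sum>A\<in>?I. real (card (?C A)))"
    unfolding of_nat_sum[symmetric] by (rule of_nat_mono)
  also have "\<dots> \<le> (\<Sum>A\<in>?I. ?k * B)"
  proof (rule sum_mono)
    fix A assume A: "A \<in> ?I"
    have "real (card (?C A)) \<le> ?k * (real n ^ (num_verts F - card (\<Union>A)) * D ^ (num_edges F - card A))"
      by (rule card_copies_through_le[OF F finH r0 \<pi> cls]) (use A J in auto)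
    also have "\<dots> \<le> ?k * B" using A B by (intro mult_left_mono) auto
    finally show "real (card (?C A)) \<le> ?k * B" .
  qed
  also have "\<dots> = real (card ?I) * (?k * B)" by simp
  also have "\<dots> \<le> 2 ^ num_edges F * (?k * B)"
  proof (rule mult_right_mono)
    have "card ?I \<le> card (Pow (edges F))" using fin by (intro card_mono) auto
    then have "real (card ?I) \<le> real (card (Pow (edges F)))" by (rule of_nat_mono)
    then show "real (card ?I) \<le> 2 ^ num_edges F" using fin by (simp add: card_Pow)
  qed (use B0 in auto)
  finally show ?thesis by (simp add: mult_ac)
qed

section \<open>From abundant copies to a spread weight\<close>

lemma card_Collect_image_in:
  assumes "finite C" "finite B"
  shows "(\<Sum>e\<in>B. card {\<omega> \<in> C. img \<omega> = e}) = card {\<omega> \<in> C. img \<omega> \<in> B}"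
  using assms by (subst card_UN_disjoint[symmetric]) (auto intro!: arg_cong[where f = card])

text \<open>A largest admissible collection has the required size: otherwise fewer than half of the points
  are full, and the abundance hypothesis yields a new member that avoids all of them.\<close>

lemma balanced_selection:
  fixes img :: "'o \<Rightarrow> 'x set"
  assumes X: "finite X" "X \<noteq> {}" and \<Omega>: "finite \<Omega>" and s: "1 \<le> s"
    and img: "\<And>\<omega>. \<omega> \<in> \<Omega> \<Longrightarrow> img \<omega> \<subseteq> X \<and> card (img \<omega>) \<le> s" and M: "1 \<le> M"
    and abundant: "\<And>X'. X' \<subseteq> X \<Longrightarrow> real (card X) / 2 \<le> real (card X') \<Longrightarrow> M \<le> card {\<omega> \<in> \<Omega>. img \<omega> \<subseteq> X'}"
  obtains C where "C \<subseteq> \<Omega>" "card C = M"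
    "\<And>x. x \<in> X \<Longrightarrow> real (card {\<omega> \<in> C. x \<in> img \<omega>}) \<le> 2 * s * M / card X + 1"
proof -
  define N where "N = real (card X)"
  have N: "N > 0" using X by (simp add: N_def card_gt_0_iff)
  define dg where "dg C x = real (card {\<omega> \<in> C. x \<in> img \<omega>})" for C x
  define PP where "PP = {C. C \<subseteq> \<Omega> \<and> card C \<le> M \<and> (\<forall>x\<in>X. dg C x \<le> 2 * s * M / N + 1)}"
  have "finite PP" using \<Omega> by (simp add: PP_def)
  moreover have "{} \<in> PP" using N by (auto simp: PP_def dg_def)
  ultimately obtain C where C: "C \<in> PP" and max: "\<And>C'. C' \<in> PP \<Longrightarrow> card C' \<le> card C"
    using obtains_MAX[of PP card] by (metis Max_ge empty_iff finite_imageI imageI)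
  have "C \<subseteq> \<Omega>" using C by (simp add: PP_def)
  then have finC: "finite C" using \<Omega> finite_subset by blast
  have "card C = M"
  proof (rule ccontr)
    assume "card C \<noteq> M"
    then have less: "card C < M" using C by (simp add: PP_def)
    \<comment> \<open>The points that can take one more member: the \<open>+ 1\<close> in the degree
      bound is the room for it. Fewer than M s incidences are present, so fewer than half of the
      points exceed 2 s M / N.\<close>
    define X' where "X' = {x \<in> X. dg C x \<le> 2 * s * M / N}"
    have "real (card (X - X')) * (2 * s * M / N) \<le> (\<Sum>x\<in>X - X'. dg C x)"
      using sum_bounded_below[of "X - X'" "2 * s * M / N" "dg C"] by (force simp: X'_def)
    also have "\<dots> \<le> (\<Sum>x\<in>X. dg C x)" using X by (intro sum_mono2) (auto simp: dg_def)
    also have "\<dots> = (\<Sum>x\<in>X. \<Sum>\<omega>\<in>C. if x \<in> img \<omega> then 1 else 0)"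
      unfolding dg_def using finC by (intro sum.cong) (auto simp: sum.If_cases Int_def)
    also have "\<dots> = (\<Sum>\<omega>\<in>C. \<Sum>x\<in>X. if x \<in> img \<omega> then 1 else 0)" by (rule sum.swap)
    also have "\<dots> \<le> (\<Sum>\<omega>\<in>C. real s)"
    proof (rule sum_mono)
      fix \<omega> assume "\<omega> \<in> C"
      then have \<omega>: "img \<omega> \<subseteq> X" "card (img \<omega>) \<le> s" using img \<open>C \<subseteq> \<Omega>\<close> by auto
      then have "X \<inter> img \<omega> = img \<omega>" by blast
      then show "(\<Sum>x\<in>X. if x \<in> img \<omega> then 1 else 0) \<le> real s" using X \<omega> by (simp add: sum.If_cases)
    qed
    also have "\<dots> < M * s" using less s by simp
    finally have "real (card (X - X')) * 2 * (M * s) < N * (M * s)" using N by (simp add: field_simps)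
    then have "real (card (X - X')) * 2 < N" by (simp add: mult_less_cancel_right)
    moreover have "real (card (X - X')) = N - real (card X')"
      using X by (simp add: X'_def card_Diff_subset N_def of_nat_diff card_mono)
    ultimately have "M \<le> card {\<omega> \<in> \<Omega>. img \<omega> \<subseteq> X'}"
      by (intro abundant) (auto simp: X'_def N_def)
    then have "\<not> {\<omega> \<in> \<Omega>. img \<omega> \<subseteq> X'} \<subseteq> C" using less card_mono[OF finC] by (meson not_le order_trans)
    then obtain \<omega> where \<omega>: "\<omega> \<in> \<Omega>" "img \<omega> \<subseteq> X'" "\<omega> \<notin> C" by blast
    have "insert \<omega> C \<in> PP"
      unfolding PP_def
    proof (intro CollectI conjI ballI)
      show "insert \<omega> C \<subseteq> \<Omega>" using \<omega> \<open>C \<subseteq> \<Omega>\<close> by blast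
      show "card (insert \<omega> C) \<le> M" using less finC \<omega> by simp
      fix x assume x: "x \<in> X"
      show "dg (insert \<omega> C) x \<le> 2 * s * M / N + 1"
      proof (cases "x \<in> img \<omega>")
        case True
        then have "dg C x \<le> 2 * s * M / N" using \<omega> by (auto simp: X'_def)
        moreover have "{\<omega>' \<in> insert \<omega> C. x \<in> img \<omega>'} = insert \<omega> {\<omega>' \<in> C. x \<in> img \<omega>'}" using True by auto
        ultimately show ?thesis using finC \<omega> by (simp add: dg_def)
      next
        case False
        then have "{\<omega>' \<in> insert \<omega> C. x \<in> img \<omega>'} = {\<omega>' \<in> C. x \<in> img \<omega>'}" by auto
        then show ?thesis using C x by (simp add: PP_def dg_def)
      qed
    qed
    then have "card (insert \<omega> C) \<le> card C" by (rule max)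
    then show False using finC \<omega> by simp
  qed
  then show ?thesis using that[of C] C by (auto simp: PP_def dg_def N_def)
qed

text \<open>The weight is spread uniformly over a balanced subfamily of \<lceil>M\<rceil> members of
  \<Omega>, which settles the degrees of single points. The codegrees of larger sets can only
  decrease in a subfamily; the price is that \<open>codeg\<close> is normalised by \<open>M\<close>
  and not by card \<Omega>. The term card X / M in \<open>K\<close> stems from the
  \<open>+ 1\<close> of the selection.\<close>

proposition exists_spread_weight:
  fixes img :: "'o \<Rightarrow> 'x set" and K M \<tau> :: real
  assumes X: "finite X" "X \<noteq> {}" and \<Omega>: "finite \<Omega>" and s: "1 \<le> s"
    and img: "\<And>\<omega>. \<omega> \<in> \<Omega> \<Longrightarrow> img \<omega> \<subseteq> X \<and> card (img \<omega>) = s" and M: "0 < M"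
    and abundant: "\<And>X'. X' \<subseteq> X \<Longrightarrow> real (card X) / 2 \<le> real (card X') \<Longrightarrow> M \<le> real (card {\<omega> \<in> \<Omega>. img \<omega> \<subseteq> X'})"
    and K: "2 * s + card X / M \<le> K" and \<tau>: "0 < \<tau>"
    and codeg: "\<And>J. J \<subseteq> X \<Longrightarrow> 2 \<le> card J \<Longrightarrow> card J \<le> s \<Longrightarrow>
      real (card {\<omega> \<in> \<Omega>. J \<subseteq> img \<omega>}) \<le> M * (K / card X * \<tau> ^ (card J - 1))"
  shows "\<exists>w. spread_weight X \<tau> s K 1 w \<and> (\<forall>e. w e \<noteq> 0 \<longrightarrow> (\<exists>\<omega>\<in>\<Omega>. e = img \<omega>))"
proof -
  define N where "N = real (card X)"
  have N: "N > 0" using X by (simp add: N_def card_gt_0_iff)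
  have K0: "K > 0" using K s M by (smt (verit) divide_nonneg_pos of_nat_0_le_iff of_nat_1 of_nat_mono)
  define m where "m = nat \<lceil>M\<rceil>"
  have m: "M \<le> real m" "1 \<le> m" using M by (auto simp: m_def le_nat_iff)
  have le_m: "m \<le> k" if "M \<le> real k" for k using that by (simp add: m_def nat_le_iff ceiling_le_iff)
  obtain C where C: "C \<subseteq> \<Omega>" "card C = m"
    "\<And>x. x \<in> X \<Longrightarrow> real (card {\<omega> \<in> C. x \<in> img \<omega>}) \<le> 2 * s * m / card X + 1"
    by (rule balanced_selection[OF X \<Omega> s, of img m]) (use img m abundant le_m in auto)
  have finC: "finite C" using C \<Omega> finite_subset by blast
  define w where "w e = real (card {\<omega> \<in> C. img \<omega> = e}) / m" for e
  have wJ: "wdeg X w J = real (card {\<omega> \<in> C. J \<subseteq> img \<omega>}) / m" for J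
  proof -
    have "wdeg X w J = (\<Sum>e | e \<subseteq> X \<and> J \<subseteq> e. real (card {\<omega> \<in> C. img \<omega> = e})) / m"
      by (simp add: wdeg_def w_def sum_divide_distrib)
    also have "(\<Sum>e | e \<subseteq> X \<and> J \<subseteq> e. real (card {\<omega> \<in> C. img \<omega> = e})) =
        real (card {\<omega> \<in> C. img \<omega> \<in> {e. e \<subseteq> X \<and> J \<subseteq> e}})"
      using card_Collect_image_in[OF finC, of "{e. e \<subseteq> X \<and> J \<subseteq> e}" img] X(1)
      by (simp flip: of_nat_sum)
    also have "{\<omega> \<in> C. img \<omega> \<in> {e. e \<subseteq> X \<and> J \<subseteq> e}} = {\<omega> \<in> C. J \<subseteq> img \<omega>}"
      using img C by auto
    finally show ?thesis .
  qed
  have ex: "\<exists>\<omega>\<in>C. e = img \<omega>" if "w e \<noteq> 0" for e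
  proof -
    have "card {\<omega> \<in> C. img \<omega> = e} \<noteq> 0" using that by (auto simp: w_def)
    then have "{\<omega> \<in> C. img \<omega> = e} \<noteq> {}" by (metis card.empty)
    then show ?thesis by auto
  qed
  have "spread_weight X \<tau> s K 1 w"
    unfolding spread_weight_def
  proof (intro conjI allI impI)
    show "0 \<le> w e" for e by (simp add: w_def)
    show "e \<subseteq> X" "card e = s" if "w e \<noteq> 0" for e using ex[OF that] img C by auto
    show "1 \<le> wdeg X w {}" using m C by (simp add: wJ)
    fix J :: "'x set" assume J: "J \<noteq> {}"
    show "wdeg X w J \<le> K / card X * \<tau> ^ (card J - 1)"
    proof (cases "{\<omega> \<in> C. J \<subseteq> img \<omega>} = {}")
      case True
      have "wdeg X w J = 0" unfolding wJ True by simp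
      then show ?thesis using K0 \<tau> by simp
    next
      case False
      then obtain \<omega> where \<omega>: "\<omega> \<in> C" "J \<subseteq> img \<omega>" by auto
      have i: "img \<omega> \<subseteq> X" "card (img \<omega>) = s" using img[of \<omega>] \<omega> C by auto
      have fi: "finite (img \<omega>)" by (rule finite_subset[OF i(1) X(1)])
      have J': "J \<subseteq> X" "card J \<le> s" "finite J"
        using \<omega> i card_mono[OF fi \<omega>(2)] finite_subset[OF \<omega>(2) fi] by auto
      show ?thesis
      proof (cases "card J = 1")
        case True
        then obtain x where x: "J = {x}" by (auto simp: card_1_singleton_iff)
        have "wdeg X w J \<le> (2 * s * m / N + 1) / m"
          unfolding wJ using C(3)[of x] J' by (intro divide_right_mono) (auto simp: x N_def)
        also have "\<dots> = 2 * s / N + 1 / m" using m by (simp add: field_simps)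
        also have "\<dots> \<le> 2 * s / N + 1 / M" using frac_le[of 1 1 M m] m M by simp
        also have "\<dots> = (2 * s + N / M) / N" using N by (simp add: field_simps)
        also have "\<dots> \<le> K / N" using K N by (intro divide_right_mono) (auto simp: N_def)
        finally show ?thesis using True by (simp add: N_def)
      next
        case False
        then have J2: "2 \<le> card J" using J J' card_gt_0_iff[of J] by linarith
        have "real (card {\<omega> \<in> C. J \<subseteq> img \<omega>}) \<le> real (card {\<omega> \<in> \<Omega>. J \<subseteq> img \<omega>})"
          using C \<Omega> by (intro of_nat_mono card_mono) auto
        also have "\<dots> \<le> M * (K / card X * \<tau> ^ (card J - 1))" using codeg J' J2 by blast
        also have "\<dots> \<le> m * (K / card X * \<tau> ^ (card J - 1))"
          using m K0 \<tau> by (intro mult_right_mono) auto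
        finally show ?thesis unfolding wJ using m by (simp add: divide_le_eq mult.commute)
      qed
    qed
  qed
  then show ?thesis using ex C by blast
qed

section \<open>Containers for expansions\<close>

text \<open>The new vertices of \<open>e\<close> are mapped bijectively onto the part of
  \<open>g e\<close> outside the image of \<open>e\<close>, and the disjointness conditions make the
  whole map injective. Since every vertex of \<open>F\<close> lies in an edge, all values lie in
  edges of \<open>G\<close> and hence among its vertices.\<close>

lemma expansion_copy_contains:
  assumes F: "r_graph r0 F" and cov: "\<Union>(edges F) = verts F"
    and copy: "(\<phi>, g) \<in> expansion_copies F n \<pi> H" and r: "r0 \<le> r"
    and H: "\<And>f. f \<in> H \<Longrightarrow> finite f \<and> card f = r \<and> \<pi> f \<subseteq> f"
    and G: "g ` edges F \<subseteq> edges G" "\<And>e. e \<in> edges G \<Longrightarrow> e \<subseteq> verts G"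
  shows "contains_copy G (expansion r0 r F)"
proof -
  have \<phi>: "inj_on \<phi> (verts F)" and gP: "g \<in> (\<Pi>\<^sub>E e\<in>edges F. {f \<in> H. \<pi> f = \<phi> ` e})"
    and d1: "\<And>e. e \<in> edges F \<Longrightarrow> (g e - \<phi> ` e) \<inter> \<phi> ` verts F = {}"
    and d2: "\<And>e e'. e \<in> edges F \<Longrightarrow> e' \<in> edges F \<Longrightarrow> e \<noteq> e' \<Longrightarrow> (g e - \<phi> ` e) \<inter> (g e' - \<phi> ` e') = {}"
    using copy by (auto simp: expansion_copies_def)
  have g: "g e \<in> H" "\<pi> (g e) = \<phi> ` e" if "e \<in> edges F" for e using PiE_mem[OF gP that] by auto
  have sub: "\<phi> ` e \<subseteq> g e" "finite (g e)" "card (g e) = r" if "e \<in> edges F" for e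
    using H[OF g(1)[OF that]] g(2)[OF that] by auto
  have ce: "card (\<phi> ` e) = r0" if "e \<in> edges F" for e
    using that F \<phi> by (subst card_image) (auto simp: r_graph_def intro: inj_on_subset)
  have "\<exists>h. bij_betw h {0..<r - r0} (g e - \<phi> ` e)" if e: "e \<in> edges F" for e
  proof -
    have "card (g e - \<phi> ` e) = r - r0"
      using sub[OF e] ce[OF e] by (simp add: card_Diff_subset finite_subset)
    then show ?thesis using ex_bij_betw_nat_finite[of "g e - \<phi> ` e"] sub[OF e] by simp
  qed
  then obtain h where "\<And>e. e \<in> edges F \<Longrightarrow> bij_betw (h e) {0..<r - r0} (g e - \<phi> ` e)" by metis
  then have h: "\<And>e. e \<in> edges F \<Longrightarrow> inj_on (h e) {..<r - r0}"
    "\<And>e. e \<in> edges F \<Longrightarrow> h e ` {..<r - r0} = g e - \<phi> ` e"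
    by (auto simp: bij_betw_def atLeast0LessThan)
  define \<psi> where "\<psi> = restrict (case_sum \<phi> (\<lambda>(e, i). h e i)) (verts (expansion r0 r F))"
  have verts: "verts (expansion r0 r F) = Inl ` verts F \<union> Inr ` (edges F \<times> {..<r - r0})"
    by (simp add: expansion_def)
  have \<psi>l: "\<psi> (Inl x) = \<phi> x" if "x \<in> verts F" for x using that by (auto simp: \<psi>_def verts)
  have \<psi>r: "\<psi> (Inr (e, i)) = h e i" if "e \<in> edges F" "i < r - r0" for e i
    using that by (auto simp: \<psi>_def verts)
  have eF: "e \<subseteq> verts F" if "e \<in> edges F" for e using F that by (simp add: r_graph_def)
  have im: "\<psi> ` (Inl ` e \<union> Inr ` ({e} \<times> {..<r - r0})) = g e" if e: "e \<in> edges F" for e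
  proof -
    have "\<psi> ` (Inl ` e \<union> Inr ` ({e} \<times> {..<r - r0})) = \<phi> ` e \<union> h e ` {..<r - r0}"
      unfolding image_Un image_image using \<psi>l \<psi>r[OF e] eF[OF e]
      by (intro arg_cong2[where f = "(\<union>)"]) (force simp: image_iff)+
    then show ?thesis using h(2)[OF e] sub(1)[OF e] by auto
  qed
  have hn: "h e i \<in> g e - \<phi> ` e" if "e \<in> edges F" "i < r - r0" for e i
    using h(2)[OF that(1)] that(2) by blast
  have "\<psi> x \<in> verts G" if x: "x \<in> verts (expansion r0 r F)" for x
  proof -
    obtain e where e: "e \<in> edges F" "x \<in> Inl ` e \<union> Inr ` ({e} \<times> {..<r - r0})"
      using x unfolding verts cov[symmetric] by blast
    then have "\<psi> x \<in> g e" using im[OF e(1)] by blast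
    then show ?thesis using e G by blast
  qed
  then have "\<psi> \<in> verts (expansion r0 r F) \<rightarrow>\<^sub>E verts G" by (auto simp: \<psi>_def)
  moreover have "\<forall>e\<in>edges (expansion r0 r F). \<psi> ` e \<in> edges G"
    using im G by (auto simp: expansion_def)
  moreover have "inj_on \<psi> (verts (expansion r0 r F))"
  proof (rule inj_onI)
    fix x y assume x: "x \<in> verts (expansion r0 r F)" and y: "y \<in> verts (expansion r0 r F)" and eq: "\<psi> x = \<psi> y"
    show "x = y"
    proof (cases x)
      case (Inl a)
      then have a: "a \<in> verts F" "\<psi> x = \<phi> a" using x \<psi>l by (auto simp: verts)
      show ?thesis
      proof (cases y)
        case y': (Inl b)
        then have "b \<in> verts F" "\<psi> y = \<phi> b" using y \<psi>l by (auto simp: verts)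
        then show ?thesis using a eq \<phi> Inl y' by (auto simp: inj_on_def)
      next
        case (Inr p)
        then obtain e i where p: "y = Inr (e, i)" "e \<in> edges F" "i < r - r0" using y by (auto simp: verts)
        then have "\<psi> y \<in> g e - \<phi> ` e" using \<psi>r hn by auto
        moreover have "\<psi> y \<in> \<phi> ` verts F" using a eq by auto
        ultimately show ?thesis using d1[OF p(2)] by blast
      qed
    next
      case (Inr p)
      then obtain e i where p: "x = Inr (e, i)" "e \<in> edges F" "i < r - r0" using x by (auto simp: verts)
      have px: "\<psi> x = h e i" "h e i \<in> g e - \<phi> ` e" using p \<psi>r hn by auto
      show ?thesis
      proof (cases y)
        case (Inl b)
        then have "b \<in> verts F" "\<psi> y = \<phi> b" using y \<psi>l by (auto simp: verts)
        then have "h e i \<in> \<phi> ` verts F" using px eq by (metis imageI)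
        then show ?thesis using d1[OF p(2)] px by blast
      next
        case (Inr p')
        then obtain e' i' where p': "y = Inr (e', i')" "e' \<in> edges F" "i' < r - r0" using y by (auto simp: verts)
        have py: "\<psi> y = h e' i'" "h e' i' \<in> g e' - \<phi> ` e'" using p' \<psi>r hn by auto
        have "e = e'"
        proof (rule ccontr)
          assume "e \<noteq> e'"
          from d2[OF p(2) p'(2) this] show False using px py eq by auto
        qed
        moreover have "i = i'" using h(1)[OF p(2)] p p' px py eq \<open>e = e'\<close> by (auto simp: inj_on_def)
        ultimately show ?thesis using p p' by simp
      qed
    qed
  qed
  ultimately show ?thesis unfolding contains_copy_def homs_def by blast
qed

section \<open>Arithmetic of strict balancedness\<close>

lemma card_Union_two_edges_gt:
  assumes F: "r_graph r0 F" and A: "A \<subseteq> edges F" "2 \<le> card A"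
  shows "r0 < card (\<Union>A)"
proof -
  have finA: "finite A" using A by (simp add: card_ge_0_finite)
  obtain e where e: "e \<in> A" using A by fastforce
  have "A \<noteq> {e}" using A by auto
  then obtain e' where e': "e' \<in> A" "e' \<noteq> e" using e by blast
  have c: "card e = r0" "card e' = r0" "finite e" "finite e'"
    using A e e' r_graph_finite[OF F] F by (auto simp: r_graph_def)
  have fin: "finite (\<Union>A)" using finA A r_graph_finite(3)[OF F] by blast
  have "\<not> e' \<subseteq> e" using c e' card_subset_eq by metis
  then have "e \<subset> e \<union> e'" by blast
  then have "card e < card (e \<union> e')" using c by (intro psubset_card_mono) auto
  also have "\<dots> \<le> card (\<Union>A)" using e e' fin by (intro card_mono) auto
  finally show ?thesis using c by simp
qed

locale strictly_balanced_graph =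
  fixes F :: "'a hypergraph" and r0 :: nat
  assumes F: "r_graph r0 F" and sb: "strictly_balanced r0 F"
begin

abbreviation "s \<equiv> num_edges F"
abbreviation "v \<equiv> num_verts F"

lemma s3: "3 \<le> s" using sb by (simp add: strictly_balanced_def)

lemma r0_less_v: "r0 < v"
proof -
  have "r0 < card (\<Union>(edges F))" by (rule card_Union_two_edges_gt[OF F order_refl]) (use s3 in simp)
  also have "\<dots> \<le> v" using F r_graph_finite[OF F] by (intro card_mono) (auto simp: r_graph_def)
  finally show ?thesis .
qed

lemma max_density_eq: "max_density r0 F = (real s - 1) / (real v - real r0)"
  using sb by (simp add: strictly_balanced_def density_ratio_def)

definition e0 :: real where "e0 = real r0 - (real v - real r0) / (real s - 1)"

lemma e0_eq: "real r0 - 1 / max_density r0 F = e0"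
  by (simp add: max_density_eq e0_def)

text \<open>In exponential form: n^v m^(s-1) = n^(r0 s) for m = n powr e0. All later cancellations
  of exponents rest on this identity.\<close>

lemma e0_mult: "(real s - 1) * e0 = real r0 * real s - real v"
  using s3 by (simp add: e0_def field_simps)

lemma subgraph_edges:
  assumes "A \<subseteq> edges F"
  shows "subgraph \<lparr>verts = \<Union>A, edges = A\<rparr> F"
  using assms F by (auto simp: subgraph_def r_graph_def)

text \<open>The comparison of densities is cleared of denominators and moved to the natural numbers,
  where strictness is worth a full unit; \<open>balanced_exponent\<close> spends that unit.\<close>

lemma density_less:
  assumes A: "A \<subseteq> edges F" "2 \<le> card A" and ne: "\<lparr>verts = \<Union>A, edges = A\<rparr> \<noteq> F"
  shows "(card A - 1) * (v - r0) < (s - 1) * (card (\<Union>A) - r0)"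
proof -
  have u: "r0 < card (\<Union>A)" by (rule card_Union_two_edges_gt[OF F A])
  have "(real (card A) - 1) / (real (card (\<Union>A)) - real r0) < (real s - 1) / (real v - real r0)"
    using sb subgraph_edges[OF A(1)] ne A(2)
    by (auto simp: strictly_balanced_def density_ratio_def)
  then have "(real (card A) - 1) * (real v - real r0) < (real s - 1) * (real (card (\<Union>A)) - real r0)"
    using u r0_less_v by (simp add: divide_simps split: if_splits)
  then have "real ((card A - 1) * (v - r0)) < real ((s - 1) * (card (\<Union>A) - r0))"
    using u r0_less_v A s3 by (simp add: of_nat_diff)
  then show ?thesis by (simp only: of_nat_less_iff)
qed

text \<open>Deleting isolated vertices would give a proper subgraph with the same edges and fewer
  vertices, hence of larger density.\<close>

lemma Union_edges: "\<Union>(edges F) = verts F"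
proof (rule ccontr)
  assume ne: "\<Union>(edges F) \<noteq> verts F"
  then have "\<lparr>verts = \<Union>(edges F), edges = edges F\<rparr> \<noteq> F" by (metis hypergraph.select_convs(1))
  then have "(s - 1) * (v - r0) < (s - 1) * (card (\<Union>(edges F)) - r0)"
    by (intro density_less) (use s3 in auto)
  moreover have "card (\<Union>(edges F)) \<le> v"
    using F r_graph_finite[OF F] by (intro card_mono) (auto simp: r_graph_def)
  ultimately show False by (meson diff_le_mono mult_le_mono2 not_less)
qed

text \<open>For proper subgraphs, strict balancedness leaves a slack of \<open>1 / (s - 1)\<close>, which pays for \<open>\<delta>\<close>.\<close>

lemma balanced_exponent:
  assumes A: "A \<subseteq> edges F" "2 \<le> card A" and \<delta>: "0 \<le> \<delta>" "\<delta> * (real s - 2) * (real s - 1) \<le> 1"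
  shows "real r0 * card A - card (\<Union>A) + \<delta> * (real s - card A) \<le> (real (card A) - 1) * e0"
proof (cases "A = edges F")
  case True
  \<comment> \<open>For the full edge set equality holds, and the \<delta> term vanishes because s -
    card A = 0.\<close>
  then show ?thesis using e0_mult by (simp add: Union_edges)
next
  case False
  then have "\<lparr>verts = \<Union>A, edges = A\<rparr> \<noteq> F" by auto
  from density_less[OF A this] have "(card A - 1) * (v - r0) + 1 \<le> (s - 1) * (card (\<Union>A) - r0)" by simp
  then have "real ((card A - 1) * (v - r0) + 1) \<le> real ((s - 1) * (card (\<Union>A) - r0))"
    by (rule of_nat_mono)
  then have 1: "(real (card A) - 1) * (real v - real r0) + 1 \<le> (real s - 1) * (real (card (\<Union>A)) - real r0)"
    using card_Union_two_edges_gt[OF F A] r0_less_v A s3 by (simp add: of_nat_diff)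
  have "\<delta> * (real s - card A) * (real s - 1) \<le> \<delta> * (real s - 2) * (real s - 1)"
    using A \<delta> s3 by (intro mult_right_mono mult_left_mono) auto
  then have 2: "\<delta> * (real s - card A) * (real s - 1) \<le> 1" using \<delta> by linarith
  have "(real r0 * card A - card (\<Union>A) + \<delta> * (real s - card A)) * (real s - 1) \<le>
      (real (card A) - 1) * ((real s - 1) * e0)"
  proof -
    have "(real r0 * card A - card (\<Union>A) + \<delta> * (real s - card A)) * (real s - 1) \<le>
      (real r0 * card A - card (\<Union>A)) * (real s - 1) + 1"
      using 2 by (simp add: algebra_simps)
    also have "\<dots> \<le> (real (card A) - 1) * (real r0 * real s - real v)"
      using 1 by (simp add: algebra_simps)
    finally show ?thesis by (simp only: e0_mult)
  qed
  also have "\<dots> = ((real (card A) - 1) * e0) * (real s - 1)" by simp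
  finally show ?thesis using s3 by (simp add: mult_le_cancel_right)
qed

text \<open>Two edges through a common vertex span at most 2 r0 - 1 vertices and form a proper
  subgraph of ratio at least 1 / (r0 - 1). Strict balancedness makes d larger than that, which means
  e0 > 1.\<close>

lemma e0_gt_1:
  assumes "2 \<le> max_degree F"
  shows "2 \<le> r0" "1 < e0"
proof -
  have V: "verts F \<noteq> {}" "finite (verts F)" using r0_less_v r_graph_finite[OF F] by auto
  have "max_degree F \<in> (\<lambda>x. card {e \<in> edges F. x \<in> e}) ` verts F"
    unfolding max_degree_def using V by (intro Max_in) auto
  then obtain x where x: "x \<in> verts F" "2 \<le> card {e \<in> edges F. x \<in> e}"
    using assms by auto
  have finE: "finite (edges F)" using r_graph_finite[OF F] by simp
  obtain A where A: "A \<subseteq> {e \<in> edges F. x \<in> e}" "card A = 2"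
    using obtain_subset_with_card_n[OF x(2)] by metis
  then obtain e e' where ee: "A = {e, e'}" "e \<noteq> e'" by (auto simp: card_2_iff)
  have e: "e \<in> edges F" "e' \<in> edges F" "x \<in> e" "x \<in> e'" using A ee by auto
  have c: "card e = r0" "card e' = r0" "finite e" "finite e'"
    using e F r_graph_finite[OF F] by (auto simp: r_graph_def)
  have "card e + card e' = card (e \<union> e') + card (e \<inter> e')" using c by (intro card_Un_Int) auto
  moreover have "card (e \<inter> e') \<noteq> 0" using e c by auto
  moreover have "card (\<Union>A) = card (e \<union> e')" by (simp add: ee)
  ultimately have u: "card (\<Union>A) + 1 \<le> 2 * r0" using c(1,2) by linarith
  have "\<lparr>verts = \<Union>A, edges = A\<rparr> \<noteq> F" using A s3 by auto
  then have 1: "(card A - 1) * (v - r0) < (s - 1) * (card (\<Union>A) - r0)"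
    by (intro density_less) (use A in auto)
  have "(s - 1) * (card (\<Union>A) - r0) \<le> (s - 1) * (r0 - 1)" using u by (intro mult_le_mono2) auto
  from less_le_trans[OF 1 this] have 2: "v - r0 < (s - 1) * (r0 - 1)" using A(2) by simp
  show r02: "2 \<le> r0"
  proof (rule ccontr)
    assume "\<not> 2 \<le> r0"
    then have "r0 - 1 = 0" by simp
    then show False using 2 by simp
  qed
  from 2 have "real (v - r0) < real ((s - 1) * (r0 - 1))" by (simp only: of_nat_less_iff)
  then have "real v - real r0 < (real s - 1) * (real r0 - 1)"
    using r0_less_v s3 r02 by (simp add: of_nat_diff)
  then show "1 < e0" using s3 by (simp add: e0_def field_simps)
qed

lemma e0_less_r0: "e0 < r0" using r0_less_v s3 by (simp add: e0_def)

end

context strictly_balanced_graph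
begin

text \<open>Each edge is cut into \<open>nblocks\<close> blocks, so that \<open>\<delta> = 2 / nblocks\<close> in \<open>regular_projection\<close>.
  Containers are refined as long as they have at least \<open>container_size r * n ^ (r - 1)\<close> edges; the factor
  makes the degrees \<open>D\<close> large enough to choose the new vertices of an expansion disjointly.\<close>

definition nblocks :: nat where "nblocks = s ^ 2 * v"

definition container_size :: "nat \<Rightarrow> real" where "container_size r = 64 * real nblocks * (real v + real s * real r)"

text \<open>The factor by which the regular part found by \<open>regular_projection\<close> may be
  smaller than \<open>H\<close>: 4 q for the choice of a block and the discarded classes, the rest
  for the number of dyadic levels.\<close>

definition pigeonhole_loss :: "nat \<Rightarrow> nat \<Rightarrow> real" where "pigeonhole_loss r n = 4 * real nblocks * (real r * log 2 n + 1)"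

text \<open>The constant 2 * 128 ^ s is the denominator in the guaranteed number of copies. It
  multiplies the codegree count of \<open>card_copies_containing_le\<close> in one summand and
  bounds the ratio of edges to copies in another; 2 s is the share of the balanced
  selection.\<close>

definition spreadness :: "nat \<Rightarrow> nat \<Rightarrow> real" where
  "spreadness r n = 2 * 128 ^ s * (2 ^ s * real (s ^ s * r0 ^ v) * (2 * pigeonhole_loss r n) ^ s + 1) + 2 * real s"

lemma nblocks_pos: "0 < nblocks"
  using s3 r0_less_v by (auto simp: nblocks_def)

text \<open>One refinement of the container \<open>H\<close>. The spread weight lives on the regular
  part \<open>H3\<close> only, and the containers obtained there are completed by all of H - H3. As
  \<open>H3\<close> makes up at least 1 / \<Lambda> of \<open>H\<close>, the relative loss inside
  \<open>H3\<close> is divided by \<Lambda>.\<close>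

lemma container_step:
  assumes sid: "sidorenko r0 F" and r: "nblocks * r0 < r" and r0: "2 \<le> r0" and n: "2 \<le> n"
    and h1: "2 * real v ^ 2 \<le> n * (real n powr (- 2 / nblocks) / (16 * pigeonhole_loss r n)) ^ s"
    and h2: "pigeonhole_loss r n \<le> container_size r * n" and h3: "2 \<le> container_size r * n"
    and H: "H \<subseteq> complete_edges n r" "container_size r * real n ^ (r - 1) \<le> real (card H)"
    and b: "8 * real n powr e0 * spreadness r n \<le> real b * container_const s"
  shows "\<exists>\<C>. finite \<C> \<and> card \<C> \<le> (n ^ r + 1) ^ (b * s) \<and>
    (\<forall>C\<in>\<C>. C \<subseteq> H \<and> real (card C) \<le> (1 - container_const s / (spreadness r n * pigeonhole_loss r n)) * real (card H)) \<and>
    (\<forall>I\<subseteq>H. \<not> contains_copy \<lparr>verts = {..<n}, edges = I\<rparr> (expansion r0 r F) \<longrightarrow> (\<exists>C\<in>\<C>. I \<subseteq> C))"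
proof -
  let ?n = "real n" and ?q = nblocks
  define \<delta> where "\<delta> = 2 / real ?q"
  define \<Lambda> where "\<Lambda> = pigeonhole_loss r n"
  define K where "K = spreadness r n"
  define k0 where "k0 = real (s ^ s * r0 ^ v)"
  define N where "N = real (card H)"
  define m0 where "m0 = ?n powr e0"
  note fin = r_graph_finite[OF F]
  have n0: "0 < ?n" using n by simp
  have q: "1 \<le> ?q" using nblocks_pos by simp
  have \<delta>: "\<delta> * ?q = 2" "0 \<le> \<delta>" using q by (auto simp: \<delta>_def)
  have v3: "3 \<le> v" using r0 r0_less_v by simp
  have "3 * 3 * 2 \<le> s * s * v" using s3 v3 by (intro mult_le_mono) auto
  then have q18: "18 \<le> ?q" by (simp add: nblocks_def power2_eq_square)
  have rr: "r0 + 2 \<le> r"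
  proof -
    have "r0 + 2 \<le> 18 * r0" using r0 by simp
    also have "\<dots> \<le> ?q * r0" using q18 by (rule mult_le_mono1)
    finally show ?thesis using r by simp
  qed
  have \<delta>2: "\<delta> * (real s - 2) * (real s - 1) \<le> 1"
  proof -
    have "2 * ((real s - 2) * (real s - 1)) \<le> real v * (real s * real s)"
      using s3 v3 by (intro mult_mono) auto
    then have "2 * ((real s - 2) * (real s - 1)) \<le> real ?q"
      by (simp add: nblocks_def power2_eq_square mult_ac)
    then show ?thesis using q by (simp add: \<delta>_def field_simps)
  qed
  have \<Lambda>1: "1 \<le> \<Lambda>"
  proof -
    have "1 * 1 \<le> 4 * real ?q * (real r * log 2 n + 1)" using q n by (intro mult_mono) auto
    then show ?thesis by (simp add: \<Lambda>_def pigeonhole_loss_def)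
  qed
  have K1: "2 * 128 ^ s + 2 * real s \<le> K"
    using \<Lambda>1 unfolding K_def spreadness_def \<Lambda>_def[symmetric] by (simp add: algebra_simps)
  have K0: "0 < K" using K1 s3 zero_less_power[of "128 :: real" s] by linarith
  have sz: "0 < container_size r" using q v3 by (simp add: container_size_def add_pos_nonneg)
  have Npos: "0 < N" using H(2) mult_pos_pos[OF sz zero_less_power[OF n0, of "r - 1"]] unfolding N_def by linarith
  have r1: "?q * r0 \<le> r" "2 \<le> r" "1 \<le> n" using r rr n by auto
  obtain \<pi> H3 and D :: real where \<pi>: "\<And>f. f \<in> H \<Longrightarrow> \<pi> f \<subseteq> f \<and> card (\<pi> f) = r0" and H3: "H3 \<subseteq> H"
    and NL: "N \<le> real (4 * ?q) * (r * log 2 n + 1) * real (card H3)" and D1: "(1::real) \<le> D"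
    and cls: "\<And>\<sigma>. \<sigma> \<in> \<pi> ` H3 \<Longrightarrow> D \<le> card {f \<in> H3. \<pi> f = \<sigma>} \<and> card {f \<in> H3. \<pi> f = \<sigma>} \<le> 2 * D"
    and Dlo: "N / real (8 * ?q) * ?n powr (- real r0) \<le> D" and Dhi: "D \<le> N * ?n powr (\<delta> - real r0)"
    unfolding N_def by (rule regular_projection[OF H(1) q r1(1,2) \<delta>(1) H(2) h3 r1(3)]) blast
  define N3 where "N3 = real (card H3)"
  have finH: "finite H" using H(1) by (rule finite_subset) simp
  have finH3: "finite H3" using H3 finH finite_subset by blast
  have NL': "N \<le> \<Lambda> * N3" using NL by (simp add: \<Lambda>_def pigeonhole_loss_def N3_def)
  have N3pos: "0 < N3"
  proof (rule ccontr)
    assume "\<not> 0 < N3"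
    then have "\<Lambda> * N3 \<le> 0" using \<Lambda>1 by (simp add: mult_nonneg_nonpos)
    then show False using NL' Npos by linarith
  qed
  have neH3: "H3 \<noteq> {}" using N3pos by (auto simp: N3_def)
  have D3: "D \<le> \<Lambda> * N3 * ?n powr (\<delta> - real r0)"
    using Dhi mult_right_mono[OF NL' powr_ge_zero[of ?n "\<delta> - real r0"]] by linarith
  \<comment> \<open>The 64 in \<open>container_size\<close> is the 8 here times the 8 in the lower
    bound for \<open>D\<close>.\<close>
  have Dlarge: "8 * ((v + s * r) * ?n ^ (r - r0 - 1)) \<le> D"
  proof -
    have "?n ^ (r - 1) * ?n powr (- real r0) = ?n powr (real (r - 1) - real r0)"
      using n0 by (simp add: powr_realpow[symmetric] powr_add[symmetric])
    also have "real (r - 1) - real r0 = real (r - r0 - 1)" using rr by (simp add: of_nat_diff)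
    finally have e: "?n ^ (r - 1) * ?n powr (- real r0) = ?n ^ (r - r0 - 1)" using n0 by (simp add: powr_realpow)
    have "8 * ((v + s * r) * ?n ^ (r - r0 - 1)) = container_size r / (8 * ?q) * (?n ^ (r - 1) * ?n powr (- real r0))"
      unfolding e using q by (simp add: container_size_def)
    also have "\<dots> = (container_size r * ?n ^ (r - 1)) / (8 * ?q) * ?n powr (- real r0)" by simp
    also have "\<dots> \<le> N / (8 * ?q) * ?n powr (- real r0)"
      using H(2) by (intro mult_right_mono divide_right_mono) (auto simp: N_def)
    finally show ?thesis using Dlo by linarith
  qed
  \<comment> \<open>The lower bound for the density of the projection that results from the upper
    bound for \<open>D\<close>; its s-th power enters \<open>h1\<close>.\<close>
  define c where "c = ?n powr (- \<delta>) / (16 * \<Lambda>)"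
  have c: "0 \<le> c" "c \<le> N3 / (16 * D * ?n ^ r0)"
  proof -
    show "0 \<le> c" using \<Lambda>1 by (simp add: c_def)
    have "16 * D * ?n ^ r0 \<le> 16 * (\<Lambda> * N3 * ?n powr (\<delta> - real r0)) * ?n ^ r0"
      using D3 by (intro mult_right_mono) auto
    also have "\<dots> = 16 * \<Lambda> * N3 * ?n powr \<delta>" using n0 by (simp add: powr_diff powr_realpow)
    finally have "N3 / (16 * \<Lambda> * N3 * ?n powr \<delta>) \<le> N3 / (16 * D * ?n ^ r0)"
      using D1 n0 N3pos \<Lambda>1 by (intro divide_left_mono) (auto intro!: mult_pos_pos)
    moreover have "N3 / (16 * \<Lambda> * N3 * ?n powr \<delta>) = c" using N3pos by (simp add: c_def powr_minus field_simps)
    ultimately show "c \<le> N3 / (16 * D * ?n ^ r0)" by simp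
  qed
  \<comment> \<open>The number of copies that \<open>card_expansion_copies_ge\<close> guarantees in
    every half of \<open>H3\<close>.\<close>
  define M where "M = ?n ^ v * (N3 / (128 * ?n ^ r0)) ^ s / 2"
  have Meq: "M = ?n powr (real v - real r0 * real s) * N3 ^ s / (2 * 128 ^ s)"
  proof -
    have "?n powr (real v - real r0 * real s) = ?n ^ v / (?n ^ r0) ^ s"
      using n0 by (simp add: powr_diff powr_realpow flip: power_mult of_nat_mult)
    then show ?thesis by (simp add: M_def power_divide power_mult_distrib)
  qed
  have Mpos: "0 < M" using N3pos n0 by (simp add: M_def)
  have m0: "0 < m0" using n0 by (simp add: m0_def)
  have m0p: "m0 ^ j = ?n powr (real j * e0)" for j
    using n0 by (simp add: m0_def powr_realpow[symmetric] powr_powr mult.commute)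
  \<comment> \<open>e0 < r0 \<le> r - 2, whereas \<open>H3\<close> has at least n ^ (r - 2) edges by
    \<open>h2\<close>. So the ratio m0 / N3, which becomes \<open>\<tau>\<close>, is at most
    1.\<close>
  have N3m0: "m0 \<le> N3"
  proof -
    have "m0 \<le> ?n powr real (r - 2)"
      unfolding m0_def using e0_less_r0 rr n by (intro powr_mono) auto
    also have "\<dots> = ?n ^ (r - 2)" using n0 by (simp add: powr_realpow)
    also have "\<dots> \<le> N3"
    proof -
      have "\<Lambda> * ?n ^ (r - 2) \<le> container_size r * ?n * ?n ^ (r - 2)"
        using h2 by (intro mult_right_mono) (auto simp: \<Lambda>_def)
      also have "\<dots> = container_size r * ?n ^ Suc (r - 2)" by simp
      also have "Suc (r - 2) = r - 1" using rr by simp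
      also have "container_size r * ?n ^ (r - 1) \<le> \<Lambda> * N3" using H(2) NL' by (simp add: N_def)
      finally show ?thesis using \<Lambda>1 by (simp add: mult_le_cancel_left)
    qed
    finally show ?thesis .
  qed
  \<comment> \<open>By \<open>e0_mult\<close>, N3 / M equals 2 * 128 ^ s times the power (m0 / N3) ^
    (s - 1).\<close>
  have MN3: "N3 / M \<le> 2 * 128 ^ s"
  proof -
    have "m0 ^ (s - 1) \<le> N3 ^ (s - 1)" using N3m0 m0 by (intro power_mono) auto
    moreover have "m0 ^ (s - 1) = ?n powr (real r0 * real s - real v)"
      unfolding m0p using s3 e0_mult by (simp add: of_nat_diff)
    ultimately have e1: "?n powr (real r0 * real s - real v) * (?n powr (real v - real r0 * real s) * N3) \<le>
        N3 ^ (s - 1) * (?n powr (real v - real r0 * real s) * N3)"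
      using N3pos by (intro mult_right_mono) auto
    have e2: "?n powr (real r0 * real s - real v) * (?n powr (real v - real r0 * real s) * N3) = N3"
      using n0 by (simp add: powr_add[symmetric] flip: mult.assoc)
    have e3: "N3 ^ (s - 1) * (?n powr (real v - real r0 * real s) * N3) = ?n powr (real v - real r0 * real s) * N3 ^ s"
    proof -
      have "N3 ^ s = N3 ^ Suc (s - 1)" using s3 by simp
      then show ?thesis by (simp del: power_Suc add: power_Suc2)
    qed
    have "N3 \<le> M * (2 * 128 ^ s)" using e1 unfolding e2 e3 by (simp add: Meq)
    then show ?thesis using Mpos by (simp add: divide_le_eq mult.commute)
  qed
  define \<tau> where "\<tau> = m0 / N3"
  have \<tau>: "0 < \<tau>" using m0 N3pos by (simp add: \<tau>_def)
  let ?\<Omega> = "expansion_copies F n \<pi> H3"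
  let ?img = "\<lambda>\<omega>. snd \<omega> ` edges F"
  have fin\<Omega>: "finite ?\<Omega>" by (rule finite_expansion_copies[OF F finH3])
  have abundant: "M \<le> real (card {\<omega> \<in> ?\<Omega>. ?img \<omega> \<subseteq> X'})" if X': "X' \<subseteq> H3" "real (card H3) / 2 \<le> real (card X')" for X'
  proof -
    have \<pi>3: "\<pi> f \<subseteq> f \<and> card (\<pi> f) = r0" if "f \<in> H3" for f using \<pi> H3 that by blast
    have H3n: "H3 \<subseteq> complete_edges n r" using H(1) H3 by blast
    have "M \<le> real (card (expansion_copies F n \<pi> X'))"
      unfolding M_def N3_def
      by (rule card_expansion_copies_ge[OF F sid _ H3n _ \<pi>3 _ cls Dlarge, of c])
        (use n v3 D1 c h1 X' in \<open>auto simp: c_def \<delta>_def \<Lambda>_def N3_def\<close>)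
    also have "card (expansion_copies F n \<pi> X') \<le> card {\<omega> \<in> ?\<Omega>. ?img \<omega> \<subseteq> X'}"
    proof (rule card_mono)
      show "expansion_copies F n \<pi> X' \<subseteq> {\<omega> \<in> ?\<Omega>. ?img \<omega> \<subseteq> X'}"
      proof
        fix \<omega> assume \<omega>: "\<omega> \<in> expansion_copies F n \<pi> X'"
        then have "\<omega> \<in> ?\<Omega>" using expansion_copies_mono[OF X'(1)] by blast
        moreover have "?img \<omega> \<subseteq> X'" using \<omega> by (auto simp: expansion_copies_def PiE_def Pi_def)
        ultimately show "\<omega> \<in> {\<omega> \<in> ?\<Omega>. ?img \<omega> \<subseteq> X'}" by blast
      qed
    qed (use fin\<Omega> in simp)
    finally show ?thesis by simp
  qed
  have codeg: "real (card {\<omega> \<in> ?\<Omega>. J \<subseteq> ?img \<omega>}) \<le> M * (K / real (card H3) * \<tau> ^ (card J - 1))"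
    if J: "J \<subseteq> H3" "2 \<le> card J" "card J \<le> s" for J
  proof -
    define j where "j = card J"
    \<comment> \<open>Chosen so that B / M is m0 ^ (j - 1) / N3 ^ j up to the factor (2 \<Lambda>) ^
      s and constants, which \<open>K\<close> absorbs.\<close>
    define B where "B = N3 ^ (s - j) * (2 * \<Lambda>) ^ s * ?n powr (real v - real r0 * real s + (real j - 1) * e0)"
    have B0: "0 \<le> B" using N3pos \<Lambda>1 by (simp add: B_def)
    have clsle: "real (card {f \<in> H3. \<pi> f = \<sigma>}) \<le> 2 * D" for \<sigma>
    proof (cases "\<sigma> \<in> \<pi> ` H3")
      case True then show ?thesis using cls by blast
    next
      case False
      then have "{f \<in> H3. \<pi> f = \<sigma>} = {}" by auto
      then have "card {f \<in> H3. \<pi> f = \<sigma>} = 0" by (simp only: card.empty)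
      then show ?thesis using D1 by simp
    qed
    have BA: "?n ^ (v - card (\<Union>A)) * (2 * D) ^ (s - card A) \<le> B" if A: "A \<subseteq> edges F" "card A = card J" for A
    proof -
      let ?u = "card (\<Union>A)"
      have UA: "?u \<le> v" using A F fin by (intro card_mono) (auto simp: r_graph_def)
      have jA: "card A = j" "2 \<le> j" "j \<le> s" using A J by (auto simp: j_def)
      have "(2 * D) ^ (s - j) \<le> (2 * (\<Lambda> * N3 * ?n powr (\<delta> - real r0))) ^ (s - j)"
        using D3 D1 by (intro power_mono) auto
      also have "\<dots> = (2 * \<Lambda>) ^ (s - j) * N3 ^ (s - j) * ?n powr ((\<delta> - real r0) * real (s - j))"
        using n0 by (simp add: power_mult_distrib powr_realpow[symmetric] powr_powr flip: powr_realpow)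
      also have "\<dots> \<le> (2 * \<Lambda>) ^ s * N3 ^ (s - j) * ?n powr ((\<delta> - real r0) * real (s - j))"
        using \<Lambda>1 N3pos by (intro mult_right_mono power_increasing) auto
      finally have "?n ^ (v - ?u) * (2 * D) ^ (s - j) \<le>
          ?n ^ (v - ?u) * ((2 * \<Lambda>) ^ s * N3 ^ (s - j) * ?n powr ((\<delta> - real r0) * real (s - j)))"
        by (intro mult_left_mono) auto
      also have "\<dots> = N3 ^ (s - j) * (2 * \<Lambda>) ^ s * ?n powr (real (v - ?u) + (\<delta> - real r0) * real (s - j))"
        using n0 by (simp add: powr_add powr_realpow)
      also have "\<dots> \<le> B"
        unfolding B_def
      proof (rule mult_left_mono)
        \<comment> \<open>Each free vertex contributes 1 and each of the s - j free edges \<delta> -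
          r0 to the exponent; \<open>balanced_exponent\<close> bounds the total.\<close>
        have "real (v - ?u) + (\<delta> - real r0) * real (s - j) \<le> real v - real r0 * real s + (real j - 1) * e0"
          using balanced_exponent[OF A(1) _ \<delta>(2) \<delta>2] jA UA by (simp add: of_nat_diff algebra_simps)
        then show "?n powr (real (v - ?u) + (\<delta> - real r0) * real (s - j)) \<le>
            ?n powr (real v - real r0 * real s + (real j - 1) * e0)"
          using n by (intro powr_mono) auto
      qed (use N3pos \<Lambda>1 in auto)
      finally show ?thesis by (simp add: jA)
    qed
    have \<pi>f: "card (\<pi> f) = r0 \<and> finite (\<pi> f)" if "f \<in> H3" for f
    proof -
      have "card (\<pi> f) = r0" using \<pi> H3 that by blast
      then show ?thesis using r0 card_ge_0_finite[of "\<pi> f"] by simp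
    qed
    have r01: "1 \<le> r0" using r0 by simp
    have eq: "{\<omega> \<in> ?\<Omega>. J \<subseteq> ?img \<omega>} = {(\<phi>, g) \<in> ?\<Omega>. J \<subseteq> g ` edges F}" by auto
    have "real (card {\<omega> \<in> ?\<Omega>. J \<subseteq> ?img \<omega>}) \<le> 2 ^ s * k0 * B"
      unfolding eq k0_def by (rule card_copies_containing_le[OF F finH3 r01 \<pi>f clsle J(1) BA B0])
    also have "\<dots> \<le> M * (K / N3 * \<tau> ^ (j - 1))"
    proof -
      have "2 ^ s * k0 * (2 * \<Lambda>) ^ s \<le> K / (2 * 128 ^ s)"
        unfolding K_def spreadness_def \<Lambda>_def[symmetric] k0_def[symmetric] by (simp add: field_simps)
      then have "2 ^ s * k0 * (2 * \<Lambda>) ^ s * (N3 ^ (s - j) * ?n powr (real v - real r0 * real s + (real j - 1) * e0)) \<le>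
          K / (2 * 128 ^ s) * (N3 ^ (s - j) * ?n powr (real v - real r0 * real s + (real j - 1) * e0))"
        using N3pos by (intro mult_right_mono) auto
      also have "\<dots> = M * (K / N3 * \<tau> ^ (j - 1))"
      proof -
        have "N3 ^ s = N3 ^ (s - j) * N3 ^ Suc (j - 1)" using J by (simp add: j_def flip: power_add power_Suc)
        moreover have "?n powr ((real j - 1) * e0) = m0 ^ (j - 1)"
          unfolding m0p using J by (simp add: j_def of_nat_diff)
        ultimately show ?thesis
          using N3pos unfolding Meq \<tau>_def power_divide powr_add by (simp add: field_simps)
      qed
      finally show ?thesis by (simp add: B_def mult_ac)
    qed
    finally show ?thesis by (simp add: j_def N3_def)
  qed
  have img: "?img \<omega> \<subseteq> H3 \<and> card (?img \<omega>) = s" if \<omega>: "\<omega> \<in> ?\<Omega>" for \<omega>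
  proof -
    obtain \<phi> g where p: "\<omega> = (\<phi>, g)" by (metis surj_pair)
    have "inj_on g (edges F)" using expansion_copies_inj[OF F] \<omega> p by blast
    moreover have "g ` edges F \<subseteq> H3" using \<omega> p by (auto simp: expansion_copies_def PiE_def Pi_def)
    ultimately show ?thesis using p by (simp add: card_image)
  qed
  have "\<exists>w. spread_weight H3 \<tau> s K 1 w \<and> (\<forall>e. w e \<noteq> 0 \<longrightarrow> (\<exists>\<omega>\<in>?\<Omega>. e = ?img \<omega>))"
  proof (rule exists_spread_weight[OF finH3 neH3 fin\<Omega> _ img Mpos abundant _ \<tau> codeg])
    show "1 \<le> s" using s3 by simp
    show "2 * real s + real (card H3) / M \<le> K" using MN3 K1 by (simp add: N3_def)
  qed
  then obtain w where w: "spread_weight H3 \<tau> s K 1 w" "\<And>e. w e \<noteq> 0 \<Longrightarrow> \<exists>\<omega>\<in>?\<Omega>. e = ?img \<omega>" by blast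
  have "\<exists>\<C>. finite \<C> \<and> card \<C> \<le> (card H3 + 1) ^ (b * s) \<and>
     (\<forall>C\<in>\<C>. C \<subseteq> H3 \<and> real (card C) \<le> (1 - container_const s / K) * real (card H3)) \<and>
     (\<forall>I\<subseteq>H3. avoids w I \<longrightarrow> (\<exists>C\<in>\<C>. I \<subseteq> C))"
  proof (rule hypergraph_container[OF finH3 neH3 \<tau> _ _ K0 w(1)])
    show "8 * real (card H3) * \<tau> * K \<le> real b * (container_const s * 1)"
      using b N3pos by (simp add: \<tau>_def N3_def K_def m0_def)
  qed (use s3 K0 in auto)
  then obtain \<C> where \<C>': "finite \<C> \<and> card \<C> \<le> (card H3 + 1) ^ (b * s) \<and>
     (\<forall>C\<in>\<C>. C \<subseteq> H3 \<and> real (card C) \<le> (1 - container_const s / K) * real (card H3)) \<and>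
     (\<forall>I\<subseteq>H3. avoids w I \<longrightarrow> (\<exists>C\<in>\<C>. I \<subseteq> C))" ..
  have \<C>: "finite \<C>" "card \<C> \<le> (card H3 + 1) ^ (b * s)" using \<C>' by auto
  have \<C>3: "C \<subseteq> H3 \<and> real (card C) \<le> (1 - container_const s / K) * real (card H3)" if "C \<in> \<C>" for C
    using \<C>' that by blast
  have \<C>4: "\<exists>C\<in>\<C>. I \<subseteq> C" if "I \<subseteq> H3" "avoids w I" for I using \<C>' that by blast
  let ?D = "(\<lambda>C. C \<union> (H - H3)) ` \<C>"
  have "card ?D \<le> (n ^ r + 1) ^ (b * s)"
  proof -
    have "card H3 \<le> card (complete_edges n r)" using H(1) H3 by (intro card_mono) auto
    also have "\<dots> \<le> n ^ r" by (rule card_ksubsets_le)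
    finally have "(card H3 + 1) ^ (b * s) \<le> (n ^ r + 1) ^ (b * s)" by (intro power_mono) auto
    then show ?thesis using card_image_le[OF \<C>(1), of "\<lambda>C. C \<union> (H - H3)"] \<C>(2) by linarith
  qed
  moreover have "C' \<subseteq> H \<and> real (card C') \<le> (1 - container_const s / (K * \<Lambda>)) * N" if "C' \<in> ?D" for C'
  proof -
    obtain C where C: "C \<in> \<C>" "C' = C \<union> (H - H3)" using \<open>C' \<in> ?D\<close> by blast
    have "card C' \<le> card C + card (H - H3)" unfolding C(2) by (rule card_Un_le)
    then have "real (card C') \<le> real (card C) + real (card (H - H3))" by linarith
    also have "real (card (H - H3)) = N - N3"
      using H3 finH finH3 by (simp add: card_Diff_subset N_def N3_def of_nat_diff card_mono)
    finally have "real (card C') \<le> (1 - container_const s / K) * N3 + (N - N3)" using \<C>3[OF C(1)] by (simp add: N3_def)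
    also have "\<dots> = N - container_const s / K * N3" by (simp add: algebra_simps)
    also have "\<dots> \<le> N - container_const s / K * (N / \<Lambda>)"
    proof -
      have "N / \<Lambda> \<le> N3" using NL' \<Lambda>1 by (simp add: divide_le_eq mult.commute)
      then have "container_const s / K * (N / \<Lambda>) \<le> container_const s / K * N3"
        using K0 container_const_pos[of s] by (intro mult_left_mono) auto
      then show ?thesis by simp
    qed
    finally have "real (card C') \<le> (1 - container_const s / (K * \<Lambda>)) * N" by (simp add: algebra_simps)
    then show ?thesis using C \<C>3[OF C(1)] H3 by auto
  qed
  moreover have "\<exists>C\<in>?D. I \<subseteq> C"
    if I: "I \<subseteq> H" "\<not> contains_copy \<lparr>verts = {..<n}, edges = I\<rparr> (expansion r0 r F)" for I
  proof -
    \<comment> \<open>\<open>w\<close> is supported on edge sets of copies, so no member of its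
      support lies in a copy-free set.\<close>
    have "avoids w (I \<inter> H3)"
      unfolding avoids_def
    proof (intro allI impI notI)
      fix e assume "w e \<noteq> 0" and eI: "e \<subseteq> I \<inter> H3"
      then obtain \<omega> where \<omega>: "\<omega> \<in> ?\<Omega>" "e = ?img \<omega>" using w(2) by blast
      obtain \<phi> g where "\<omega> = (\<phi>, g)" by (metis surj_pair)
      then have g: "(\<phi>, g) \<in> ?\<Omega>" "e = g ` edges F" using \<omega> by auto
      have "contains_copy \<lparr>verts = {..<n}, edges = I\<rparr> (expansion r0 r F)"
      proof (rule expansion_copy_contains[OF F Union_edges g(1)])
        show "finite f \<and> card f = r \<and> \<pi> f \<subseteq> f" if "f \<in> H3" for f
        proof -
          have "f \<in> H" using that H3 by blast
          then have "f \<subseteq> {..<n}" "card f = r" "\<pi> f \<subseteq> f" using H(1) \<pi> by blast+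
          then show ?thesis using finite_subset[of f "{..<n}"] by blast
        qed
      qed (use g eI rr I H(1) in auto)
      then show False using I by simp
    qed
    then obtain C where "C \<in> \<C>" "I \<inter> H3 \<subseteq> C" using \<C>4[of "I \<inter> H3"] by auto
    then show ?thesis using I by (intro bexI[of _ "C \<union> (H - H3)"]) auto
  qed
  ultimately show ?thesis using \<C>(1) by (intro exI[of _ ?D]) (auto simp: K_def \<Lambda>_def N_def)
qed

end

text \<open>A set below \<theta> is kept as it is, any other set is replaced by its refinement. So
  after \<open>l\<close> rounds a set either is small or has shrunk by 1 - \<beta> in every
  round.\<close>

lemma iterate_containers:
  fixes \<beta> \<theta> :: real
  assumes fin: "finite K" and \<beta>: "0 \<le> \<beta>" "\<beta> \<le> 1" and Q: "1 \<le> Q"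
    and step: "\<And>X. X \<subseteq> K \<Longrightarrow> \<theta> \<le> real (card X) \<Longrightarrow> \<exists>\<C>. finite \<C> \<and> card \<C> \<le> Q \<and>
      (\<forall>C\<in>\<C>. C \<subseteq> X \<and> real (card C) \<le> (1 - \<beta>) * real (card X)) \<and> (\<forall>I\<subseteq>X. P I \<longrightarrow> (\<exists>C\<in>\<C>. I \<subseteq> C))"
  shows "\<exists>\<C>. finite \<C> \<and> card \<C> \<le> Q ^ l \<and>
      (\<forall>C\<in>\<C>. C \<subseteq> K \<and> (real (card C) \<le> \<theta> \<or> real (card C) \<le> (1 - \<beta>) ^ l * real (card K))) \<and>
      (\<forall>I\<subseteq>K. P I \<longrightarrow> (\<exists>C\<in>\<C>. I \<subseteq> C))"
proof (induction l)
  case 0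
  then show ?case by (intro exI[of _ "{K}"]) auto
next
  case (Suc l)
  then obtain \<C> where \<C>: "finite \<C>" "card \<C> \<le> Q ^ l"
    and \<C>2: "\<forall>C\<in>\<C>. C \<subseteq> K \<and> (real (card C) \<le> \<theta> \<or> real (card C) \<le> (1 - \<beta>) ^ l * real (card K))"
    and \<C>3: "\<forall>I\<subseteq>K. P I \<longrightarrow> (\<exists>C\<in>\<C>. I \<subseteq> C)" by blast
  have "\<exists>\<D>. finite \<D> \<and> card \<D> \<le> Q \<and>
      (\<forall>C'\<in>\<D>. C' \<subseteq> K \<and> (real (card C') \<le> \<theta> \<or> real (card C') \<le> (1 - \<beta>) ^ Suc l * real (card K))) \<and>
      (\<forall>I\<subseteq>C. P I \<longrightarrow> (\<exists>C'\<in>\<D>. I \<subseteq> C'))" if C: "C \<in> \<C>" for C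
  proof (cases "\<theta> \<le> real (card C)")
    case False
    then show ?thesis using C \<C>2 Q by (intro exI[of _ "{C}"]) auto
  next
    case True
    have CK: "C \<subseteq> K" using C \<C>2 by blast
    obtain \<D> where \<D>: "finite \<D>" "card \<D> \<le> Q"
      "\<forall>C'\<in>\<D>. C' \<subseteq> C \<and> real (card C') \<le> (1 - \<beta>) * real (card C)" "\<forall>I\<subseteq>C. P I \<longrightarrow> (\<exists>C'\<in>\<D>. I \<subseteq> C')"
      using step[OF CK True] by blast
    have "C' \<subseteq> K \<and> (real (card C') \<le> \<theta> \<or> real (card C') \<le> (1 - \<beta>) ^ Suc l * real (card K))"
      if C': "C' \<in> \<D>" for C'
    proof -
      have sub: "C' \<subseteq> C" and le: "real (card C') \<le> (1 - \<beta>) * real (card C)" using C' \<D>(3) by auto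
      have "(1 - \<beta>) * real (card C) \<le> 1 * real (card C)" using \<beta> by (intro mult_right_mono) auto
      then have le2: "real (card C') \<le> real (card C)" using le by linarith
      have "real (card C') \<le> (1 - \<beta>) ^ Suc l * real (card K)" if "real (card C) \<le> (1 - \<beta>) ^ l * real (card K)"
      proof -
        have "(1 - \<beta>) * real (card C) \<le> (1 - \<beta>) * ((1 - \<beta>) ^ l * real (card K))"
          using that \<beta> by (intro mult_left_mono) auto
        then show ?thesis using le by (simp add: mult.assoc)
      qed
      then show ?thesis using \<C>2 C sub CK le2 by force
    qed
    then show ?thesis using \<D> by (intro exI[of _ \<D>]) blast
  qed
  then obtain \<D> where \<D>: "\<And>C. C \<in> \<C> \<Longrightarrow> finite (\<D> C) \<and> card (\<D> C) \<le> Q \<and>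
      (\<forall>C'\<in>\<D> C. C' \<subseteq> K \<and> (real (card C') \<le> \<theta> \<or> real (card C') \<le> (1 - \<beta>) ^ Suc l * real (card K))) \<and>
      (\<forall>I\<subseteq>C. P I \<longrightarrow> (\<exists>C'\<in>\<D> C. I \<subseteq> C'))" by metis
  have "card (\<Union>C\<in>\<C>. \<D> C) \<le> (\<Sum>C\<in>\<C>. card (\<D> C))" by (rule card_UN_le[OF \<C>(1)])
  also have "\<dots> \<le> (\<Sum>C\<in>\<C>. Q)" by (rule sum_mono) (use \<D> in auto)
  also have "\<dots> \<le> Q ^ Suc l" using \<C>(2) by (simp add: mult.commute)
  finally have card: "card (\<Union>C\<in>\<C>. \<D> C) \<le> Q ^ Suc l" .
  have sz: "\<forall>C'\<in>(\<Union>C\<in>\<C>. \<D> C). C' \<subseteq> K \<and> (real (card C') \<le> \<theta> \<or> real (card C') \<le> (1 - \<beta>) ^ Suc l * real (card K))"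
    using \<D> by blast
  have cov: "\<exists>C'\<in>(\<Union>C\<in>\<C>. \<D> C). I \<subseteq> C'" if I: "I \<subseteq> K" "P I" for I
  proof -
    obtain C where C: "C \<in> \<C>" "I \<subseteq> C" using \<C>3 I by blast
    then obtain C' where "C' \<in> \<D> C" "I \<subseteq> C'" using \<D>[OF C(1)] I by blast
    then show ?thesis using C by blast
  qed
  have "finite (\<Union>C\<in>\<C>. \<D> C)" using \<C>(1) \<D> by blast
  then show ?case using card sz cov by (intro exI[of _ "\<Union>C\<in>\<C>. \<D> C"]) blast
qed

section \<open>Logarithmic factors and the final family of containers\<close>

context strictly_balanced_graph
begin

lemma pigeonhole_loss_bounds:
  assumes "exp 1 \<le> real n"
  shows "1 \<le> pigeonhole_loss r n" "pigeonhole_loss r n \<le> 4 * real nblocks * (real r / ln 2 + 1) * ln n"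
proof -
  have n: "1 \<le> ln (real n)" "0 < real n" "1 \<le> real n"
    using assms one_le_exp_iff[of 1] ln_ge_iff[of "real n" 1] exp_gt_zero[of "1::real"] by linarith+
  have "1 * 1 \<le> (4 * real nblocks) * (real r * log 2 n + 1)"
    using nblocks_pos n by (intro mult_mono) auto
  then show "1 \<le> pigeonhole_loss r n" by (simp add: pigeonhole_loss_def)
  have "real r * log 2 n + 1 \<le> (real r / ln 2 + 1) * ln n"
    using n by (simp add: log_def algebra_simps)
  then have "4 * real nblocks * (real r * log 2 n + 1) \<le> 4 * real nblocks * ((real r / ln 2 + 1) * ln n)"
    by (intro mult_left_mono) auto
  then show "pigeonhole_loss r n \<le> 4 * real nblocks * (real r / ln 2 + 1) * ln n" by (simp add: pigeonhole_loss_def mult_ac)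
qed

lemma spreadness_bounds:
  fixes n r :: nat
  assumes "exp 1 \<le> real n"
  defines "a \<equiv> 4 * real nblocks * (real r / ln 2 + 1)"
  shows "1 \<le> spreadness r n"
    "spreadness r n \<le> (2 * 128 ^ s * (2 ^ s * real (s ^ s * r0 ^ v) * (2 * a) ^ s + 1) + 2 * real s) * ln n ^ s"
proof -
  have n: "1 \<le> ln (real n)"
    using assms one_le_exp_iff[of 1] ln_ge_iff[of "real n" 1] exp_gt_zero[of "1::real"] by linarith
  note l = pigeonhole_loss_bounds[OF assms(1), of r, folded a_def]
  have k: "0 \<le> 2 ^ s * real (s ^ s * r0 ^ v)" by simp
  have "0 \<le> 2 * 128 ^ s * (2 ^ s * real (s ^ s * r0 ^ v) * (2 * pigeonhole_loss r n) ^ s + 1)"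
    using l k by (intro mult_nonneg_nonneg add_nonneg_nonneg) auto
  then show "1 \<le> spreadness r n" using s3 unfolding spreadness_def by linarith
  have L1: "1 \<le> ln n ^ s" using n by simp
  have "(2 * pigeonhole_loss r n) ^ s \<le> (2 * a * ln n) ^ s" using l by (intro power_mono) auto
  then have "2 ^ s * real (s ^ s * r0 ^ v) * (2 * pigeonhole_loss r n) ^ s + 1 \<le>
      2 ^ s * real (s ^ s * r0 ^ v) * ((2 * a) ^ s * ln n ^ s) + ln n ^ s"
    using k L1 by (intro add_mono mult_left_mono) (auto simp: power_mult_distrib)
  also have "\<dots> = (2 ^ s * real (s ^ s * r0 ^ v) * (2 * a) ^ s + 1) * ln n ^ s" by (simp add: algebra_simps)
  finally have "2 * 128 ^ s * (2 ^ s * real (s ^ s * r0 ^ v) * (2 * pigeonhole_loss r n) ^ s + 1) + 2 * real s * 1 \<le>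
    2 * 128 ^ s * ((2 ^ s * real (s ^ s * r0 ^ v) * (2 * a) ^ s + 1) * ln n ^ s) + 2 * real s * ln n ^ s"
    using L1 by (intro add_mono mult_left_mono) auto
  then show "spreadness r n \<le> (2 * 128 ^ s * (2 ^ s * real (s ^ s * r0 ^ v) * (2 * a) ^ s + 1) + 2 * real s) * ln n ^ s"
    unfolding spreadness_def by (simp add: algebra_simps)
qed

text \<open>Up to the factor n powr e0, the left side bounds the logarithm of the number of
  containers: rounds, fingerprint length, uniformity, and the logarithm of the number of possible
  edges. Their powers of ln n are s + 2, s, 0 and 1; one further power swallows all
  constants.\<close>

lemma container_count_exponent:
  assumes r: "1 \<le> r"
  shows "\<forall>\<^sub>F n in sequentially.
    (real r * ln n * spreadness r n * pigeonhole_loss r n / container_const s + 1) *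
    (8 * spreadness r n / container_const s + 1) * real s * (real r * ln n + 1) \<le> ln n ^ (2 * s + 4)"
proof -
  define a where "a = 4 * real nblocks * (real r / ln 2 + 1)"
  define k where "k = 2 * 128 ^ s * (2 ^ s * real (s ^ s * r0 ^ v) * (2 * a) ^ s + 1) + 2 * real s"
  define cc where "cc = container_const s"
  have cc: "0 < cc" by (simp add: cc_def container_const_pos)
  have a: "0 \<le> a" using r by (simp add: a_def)
  have k: "0 \<le> k" using a by (simp add: k_def)
  define W where "W = (real r * k * a / cc + 1) * (8 * k / cc + 1) * real s * (real r + 1)"
  have "\<forall>\<^sub>F n in sequentially. exp 1 \<le> real n" by real_asymp
  moreover have "\<forall>\<^sub>F n in sequentially. W \<le> ln (real n)" by real_asymp
  ultimately show ?thesis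
  proof eventually_elim
    case (elim n)
    define L where "L = ln (real n)"
    define \<Lambda> where "\<Lambda> = pigeonhole_loss r n"
    define K where "K = spreadness r n"
    have L: "1 \<le> L"
      using elim one_le_exp_iff[of 1] ln_ge_iff[of "real n" 1] exp_gt_zero[of "1::real"] unfolding L_def by linarith
    have \<Lambda>: "1 \<le> \<Lambda>" "\<Lambda> \<le> a * L" using pigeonhole_loss_bounds[OF elim(1), of r] by (auto simp: \<Lambda>_def a_def L_def)
    have K: "1 \<le> K" "K \<le> k * L ^ s"
      using spreadness_bounds[OF elim(1), of r] by (auto simp: K_def k_def a_def L_def)
    have Lp: "1 \<le> L ^ j" for j using L by simp
    have "real r * L * K * \<Lambda> / cc + 1 \<le> (real r * k * a / cc + 1) * L ^ (s + 2)"
    proof -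
      have "real r * L * K * \<Lambda> \<le> real r * L * (k * L ^ s) * (a * L)"
        using \<Lambda> K L k by (intro mult_mono) auto
      also have "\<dots> = real r * k * a * L ^ (s + 2)" by (simp add: power_add power2_eq_square)
      finally have "real r * L * K * \<Lambda> / cc \<le> real r * k * a * L ^ (s + 2) / cc"
        using cc by (intro divide_right_mono) auto
      moreover have "(real r * k * a / cc + 1) * L ^ (s + 2) = real r * k * a * L ^ (s + 2) / cc + L ^ (s + 2)"
        by (simp add: distrib_right)
      ultimately show ?thesis using Lp[of "s + 2"] by linarith
    qed
    moreover have "8 * K / cc + 1 \<le> (8 * k / cc + 1) * L ^ s"
    proof -
      have "8 * K / cc \<le> 8 * (k * L ^ s) / cc" using K cc by (intro divide_right_mono) auto
      moreover have "(8 * k / cc + 1) * L ^ s = 8 * (k * L ^ s) / cc + L ^ s" by (simp add: distrib_right)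
      ultimately show ?thesis using Lp[of s] by linarith
    qed
    moreover have "real r * L + 1 \<le> (real r + 1) * L" using L by (simp add: algebra_simps)
    ultimately have "(real r * L * K * \<Lambda> / cc + 1) * (8 * K / cc + 1) * real s * (real r * L + 1) \<le>
       ((real r * k * a / cc + 1) * L ^ (s + 2)) * ((8 * k / cc + 1) * L ^ s) * real s * ((real r + 1) * L)"
      using K \<Lambda> L cc a k by (intro mult_mono) (auto intro!: mult_nonneg_nonneg add_nonneg_nonneg divide_nonneg_nonneg)
    also have "\<dots> = W * (L ^ (s + 2) * L ^ s * L)" by (simp add: W_def mult_ac)
    also have "L ^ (s + 2) * L ^ s * L = L ^ (2 * s + 3)"
    proof -
      have "2 * s + 3 = (s + 2) + s + 1" by simp
      then show ?thesis by (simp only: power_add power_one_right)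
    qed
    also have "W * L ^ (2 * s + 3) \<le> L * L ^ (2 * s + 3)"
      using elim L by (intro mult_right_mono) (auto simp: L_def)
    also have "\<dots> = L ^ (2 * s + 4)" by (simp add: numeral_eq_Suc)
    finally show ?case by (simp add: L_def \<Lambda>_def K_def cc_def)
  qed
qed

text \<open>The condition with v ^ 2 says that n powr (1 - 2 s / q) beats a power of ln n, where q =
  \<open>nblocks\<close> = s^2 v exceeds 2 s. The proof works with s-th roots, whence the exponent
  \<open>e\<close>.\<close>

lemma eventually_step_conditions:
  assumes r0: "2 \<le> r0"
  shows "\<forall>\<^sub>F n in sequentially. 2 \<le> n \<and> exp 1 \<le> real n \<and>
    2 * real v ^ 2 \<le> n * (real n powr (- 2 / nblocks) / (16 * pigeonhole_loss r n)) ^ s \<and>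
    pigeonhole_loss r n \<le> container_size r * n \<and> 2 \<le> container_size r * n \<and> 1 \<le> container_size r"
proof -
  define a where "a = 4 * real nblocks * (real r / ln 2 + 1)"
  have a: "0 < a" using nblocks_pos by (simp add: a_def add_nonneg_pos)
  have v3: "3 \<le> v" using r0 r0_less_v by simp
  define e where "e = 1 / real s - 2 / real nblocks"
  have e: "0 < e"
  proof -
    have "2 * s < s * s * v"
    proof -
      have "2 * s < 3 * 3 * s" using s3 by simp
      also have "\<dots> \<le> v * s * s" using s3 v3 by (intro mult_mono) auto
      finally show ?thesis by (simp add: mult_ac)
    qed
    then have "2 * real s < real nblocks"
      unfolding nblocks_def power2_eq_square by (simp flip: of_nat_mult add: numeral_eq_Suc)
    then show ?thesis using s3 by (simp add: e_def field_simps)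
  qed
  have sz: "1 \<le> container_size r"
  proof -
    have "1 * 1 * 1 \<le> 64 * real nblocks * (real v + real s * real r)"
      using nblocks_pos v3 by (intro mult_mono) (auto intro: add_increasing2)
    then show ?thesis by (simp add: container_size_def)
  qed
  have "\<forall>\<^sub>F n in sequentially. 2 \<le> n" by (rule eventually_ge_at_top)
  moreover have "\<forall>\<^sub>F n in sequentially. exp 1 \<le> real n" by real_asymp
  moreover have "\<forall>\<^sub>F n in sequentially. a * ln (real n) \<le> real n" using a by real_asymp
  moreover have "\<forall>\<^sub>F n in sequentially. 2 * real v ^ 2 + 1 \<le> real n powr e / (16 * (a * ln (real n)))"
    using a e by real_asymp
  ultimately show ?thesis
  proof eventually_elim
    case (elim n)
    have l: "1 \<le> pigeonhole_loss r n" "pigeonhole_loss r n \<le> a * ln n" using pigeonhole_loss_bounds[OF elim(2), of r] by (auto simp: a_def)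
    have n: "0 < real n" using elim(1) by simp
    have "real n powr e / (16 * (a * ln n)) \<le> real n powr e / (16 * pigeonhole_loss r n)"
      using l by (intro frac_le) auto
    then have big: "2 * real v ^ 2 + 1 \<le> real n powr e / (16 * pigeonhole_loss r n)" using elim(4) by linarith
    have "2 * real v ^ 2 \<le> (2 * real v ^ 2 + 1) ^ 1" by simp
    also have "\<dots> \<le> (2 * real v ^ 2 + 1) ^ s" using s3 by (intro power_increasing) auto
    also have "\<dots> \<le> (real n powr e / (16 * pigeonhole_loss r n)) ^ s" using big by (intro power_mono) auto
    also have "\<dots> = (real n powr (1 / s) * (real n powr (- 2 / nblocks) / (16 * pigeonhole_loss r n))) ^ s"
      by (simp add: e_def powr_diff powr_minus field_simps)
    also have "\<dots> = (real n powr (1 / s)) ^ s * (real n powr (- 2 / nblocks) / (16 * pigeonhole_loss r n)) ^ s"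
      by (simp only: power_mult_distrib)
    also have "(real n powr (1 / s)) ^ s = n" using n s3 by (simp add: powr_realpow[symmetric] powr_powr)
    finally have h1: "2 * real v ^ 2 \<le> n * (real n powr (- 2 / nblocks) / (16 * pigeonhole_loss r n)) ^ s" .
    have "1 * real n \<le> container_size r * real n" using sz by (intro mult_right_mono) auto
    then have "pigeonhole_loss r n \<le> container_size r * real n" "2 \<le> container_size r * real n" using l elim by linarith+
    then show ?case using h1 elim sz by auto
  qed
qed

theorem expansion_containers:
  assumes sid: "sidorenko r0 F" and r: "nblocks * r0 < r" and r0: "2 \<le> r0" and e0: "0 \<le> e0"
  shows "\<forall>\<^sub>F n in sequentially. \<exists>\<C>. finite \<C> \<and>
     real (card \<C>) \<le> exp (real n powr e0 * ln n ^ (2 * s + 4)) \<and>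
     (\<forall>C\<in>\<C>. C \<subseteq> complete_edges n r \<and> real (card C) \<le> container_size r * real n ^ (r - 1)) \<and>
     (\<forall>I\<subseteq>complete_edges n r.
        \<not> contains_copy \<lparr>verts = {..<n}, edges = I\<rparr> (expansion r0 r F) \<longrightarrow> (\<exists>C\<in>\<C>. I \<subseteq> C))"
proof -
  have r1: "1 \<le> r" using r by simp
  show ?thesis
    using container_count_exponent[OF r1] eventually_step_conditions[OF r0, of r]
  proof eventually_elim
    case (elim n)
    define L where "L = ln (real n)"
    define \<Lambda> where "\<Lambda> = pigeonhole_loss r n"
    define K where "K = spreadness r n"
    define cc where "cc = container_const s"
    define m0 where "m0 = real n powr e0"
    have n: "2 \<le> n" "exp 1 \<le> real n" using elim(2) by auto
    have L: "1 \<le> L"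
      using n one_le_exp_iff[of 1] ln_ge_iff[of "real n" 1] exp_gt_zero[of "1::real"] unfolding L_def by linarith
    have \<Lambda>: "1 \<le> \<Lambda>" using pigeonhole_loss_bounds[OF n(2), of r] by (simp add: \<Lambda>_def)
    have K: "1 \<le> K" using spreadness_bounds[OF n(2), of r] by (simp add: K_def)
    have cc: "0 < cc" "cc \<le> 1" by (auto simp: cc_def container_const_pos container_const_le_1)
    have m0: "1 \<le> m0" using n e0 by (simp add: m0_def ge_one_powr_ge_zero)
    \<comment> \<open>The fingerprint length demanded by \<open>hypergraph_container\<close>: its
      product card X * \<tau> is n powr e0 for every container that is refined.\<close>
    define b where "b = nat \<lceil>8 * m0 * K / cc\<rceil>"
    \<comment> \<open>Enough rounds to shrink the complete \<open>r\<close>-graph by the factor n ^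
      r, which would leave at most one edge.\<close>
    define l where "l = nat \<lceil>real r * L * K * \<Lambda> / cc\<rceil>"
    define Q where "Q = (n ^ r + 1) ^ (b * s)"
    let ?K = "complete_edges n r"
    have bK: "8 * m0 * K \<le> real b * cc"
    proof -
      have "8 * m0 * K / cc \<le> real b" by (simp add: b_def real_nat_ceiling_ge)
      then show ?thesis using cc by (simp add: divide_le_eq)
    qed
    have \<beta>: "0 \<le> cc / (K * \<Lambda>)" "cc / (K * \<Lambda>) \<le> 1"
    proof -
      have "1 * 1 \<le> K * \<Lambda>" using K \<Lambda> by (intro mult_mono) auto
      then show "0 \<le> cc / (K * \<Lambda>)" "cc / (K * \<Lambda>) \<le> 1" using cc by (simp_all add: divide_le_eq)
    qed
    have "\<exists>\<C>. finite \<C> \<and> card \<C> \<le> Q ^ l \<and>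
      (\<forall>C\<in>\<C>. C \<subseteq> ?K \<and> (real (card C) \<le> container_size r * real n ^ (r - 1) \<or> real (card C) \<le> (1 - cc / (K * \<Lambda>)) ^ l * real (card ?K))) \<and>
      (\<forall>I\<subseteq>?K. \<not> contains_copy \<lparr>verts = {..<n}, edges = I\<rparr> (expansion r0 r F) \<longrightarrow> (\<exists>C\<in>\<C>. I \<subseteq> C))"
    proof (rule iterate_containers[OF _ \<beta>])
      show "finite ?K" by simp
      show "1 \<le> Q" by (simp add: Q_def)
      fix X assume X: "X \<subseteq> ?K" "container_size r * real n ^ (r - 1) \<le> real (card X)"
      show "\<exists>\<C>. finite \<C> \<and> card \<C> \<le> Q \<and> (\<forall>C\<in>\<C>. C \<subseteq> X \<and> real (card C) \<le> (1 - cc / (K * \<Lambda>)) * real (card X)) \<and>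
          (\<forall>I\<subseteq>X. \<not> contains_copy \<lparr>verts = {..<n}, edges = I\<rparr> (expansion r0 r F) \<longrightarrow> (\<exists>C\<in>\<C>. I \<subseteq> C))"
        unfolding Q_def cc_def K_def \<Lambda>_def
        by (rule container_step[OF sid r r0 n(1) _ _ _ X]) (use elim(2) bK in \<open>auto simp: m0_def K_def cc_def\<close>)
    qed
    then obtain \<C> where \<C>: "finite \<C>" "card \<C> \<le> Q ^ l"
      and \<C>2: "\<forall>C\<in>\<C>. C \<subseteq> ?K \<and> (real (card C) \<le> container_size r * real n ^ (r - 1) \<or> real (card C) \<le> (1 - cc / (K * \<Lambda>)) ^ l * real (card ?K))"
      and \<C>3: "\<forall>I\<subseteq>?K. \<not> contains_copy \<lparr>verts = {..<n}, edges = I\<rparr> (expansion r0 r F) \<longrightarrow> (\<exists>C\<in>\<C>. I \<subseteq> C)"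
      by blast
    have small: "(1 - cc / (K * \<Lambda>)) ^ l * real (card ?K) \<le> container_size r * real n ^ (r - 1)"
    proof -
      have "real r * L \<le> cc / (K * \<Lambda>) * l"
      proof -
        have "real r * L * K * \<Lambda> / cc \<le> real l" by (simp add: l_def real_nat_ceiling_ge)
        then show ?thesis using cc K \<Lambda> by (simp add: field_simps)
      qed
      have "(1 - cc / (K * \<Lambda>)) ^ l \<le> exp (- (cc / (K * \<Lambda>))) ^ l"
        using \<beta> exp_ge_add_one_self[of "- (cc / (K * \<Lambda>))"] by (intro power_mono) auto
      also have "\<dots> = exp (- (cc / (K * \<Lambda>) * l))" by (simp add: exp_of_nat_mult[symmetric] mult.commute)
      also have "\<dots> \<le> exp (- (real r * L))" using \<open>real r * L \<le> cc / (K * \<Lambda>) * l\<close> by simp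
      also have "\<dots> = inverse (real n ^ r)" using n by (simp add: L_def exp_minus exp_of_nat_mult)
      finally have "(1 - cc / (K * \<Lambda>)) ^ l \<le> inverse (real n ^ r)" .
      moreover have "real (card ?K) \<le> real n ^ r"
        using of_nat_mono[OF card_ksubsets_le[of n r], where 'a = real] by simp
      ultimately have "(1 - cc / (K * \<Lambda>)) ^ l * real (card ?K) \<le> inverse (real n ^ r) * real n ^ r"
        by (intro mult_mono) auto
      also have "\<dots> = 1 * 1" using n by simp
      also have "\<dots> \<le> container_size r * real n ^ (r - 1)" using elim(2) n by (intro mult_mono) auto
      finally show ?thesis .
    qed
    have "real (card \<C>) \<le> real (Q ^ l)" using \<C>(2) by (rule of_nat_mono)
    also have "\<dots> = exp (real (l * (b * s)) * ln (real n ^ r + 1))"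
    proof -
      have "0 < real n ^ r + 1" by (simp add: add_nonneg_pos)
      then have "exp (real (l * (b * s)) * ln (real n ^ r + 1)) = (real n ^ r + 1) ^ (l * (b * s))"
        by (simp only: exp_of_nat_mult exp_ln)
      then show ?thesis unfolding Q_def by (simp add: mult.commute add.commute flip: power_mult)
    qed
    also have "\<dots> \<le> exp (m0 * L ^ (2 * s + 4))"
    proof -
      have lnn: "ln (real n ^ r + 1) \<le> real r * L + 1"
      proof -
        have "ln (real n ^ r + 1) \<le> ln (real n ^ r * exp 1)"
        proof -
          have "1 \<le> real n ^ r" using n by simp
          moreover have "2 \<le> exp (1::real)" using exp_ge_add_one_self[of 1] by simp
          ultimately have "real n ^ r * 2 \<le> real n ^ r * exp 1" by (intro mult_left_mono) auto
          then have "real n ^ r + 1 \<le> real n ^ r * exp 1" using \<open>1 \<le> real n ^ r\<close> by linarith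
          then show ?thesis using n by (simp add: add_pos_pos)
        qed
        also have "\<dots> = real r * L + 1" using n by (simp add: ln_mult ln_realpow L_def)
        finally show ?thesis .
      qed
      have lb: "real l \<le> real r * L * K * \<Lambda> / cc + 1"
      proof -
        have "0 \<le> real r * L * K * \<Lambda> / cc" using L K \<Lambda> cc by (intro divide_nonneg_pos mult_nonneg_nonneg) auto
        then show ?thesis unfolding l_def by linarith
      qed
      have bb: "real b \<le> m0 * (8 * K / cc + 1)"
      proof -
        have "0 \<le> 8 * m0 * K / cc" using m0 K cc by (intro divide_nonneg_pos mult_nonneg_nonneg) auto
        then have "real b \<le> 8 * m0 * K / cc + 1" unfolding b_def by linarith
        also have "\<dots> \<le> m0 * (8 * K / cc + 1)" using m0 by (simp add: algebra_simps)
        finally show ?thesis .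
      qed
      have "real (l * (b * s)) * ln (real n ^ r + 1) = real l * real b * real s * ln (real n ^ r + 1)" by simp
      also have "\<dots> \<le> (real r * L * K * \<Lambda> / cc + 1) * (m0 * (8 * K / cc + 1)) * real s * (real r * L + 1)"
        using lb bb lnn m0 L K \<Lambda> cc
        by (intro mult_mono) (auto intro!: mult_nonneg_nonneg add_nonneg_nonneg divide_nonneg_nonneg)
      also have "\<dots> = m0 * ((real r * L * K * \<Lambda> / cc + 1) * (8 * K / cc + 1) * real s * (real r * L + 1))"
        by (simp add: mult_ac)
      also have "\<dots> \<le> m0 * L ^ (2 * s + 4)"
        using elim(1) m0 by (intro mult_left_mono) (auto simp: L_def K_def \<Lambda>_def cc_def)
      finally show ?thesis by simp
    qed
    finally have "real (card \<C>) \<le> exp (real n powr e0 * ln n ^ (2 * s + 4))" by (simp add: m0_def L_def)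
    moreover have "\<forall>C\<in>\<C>. C \<subseteq> ?K \<and> real (card C) \<le> container_size r * real n ^ (r - 1)"
      using \<C>2 small by force
    ultimately show ?case using \<C>(1) \<C>3 by blast
  qed
qed

end

section \<open>Subgraphs of the random hypergraph\<close>

lemma finite_set_pmf_random_r_graph: "finite (set_pmf (random_r_graph r n p))"
proof -
  let ?K = "complete_edges n r"
  have "set_pmf (random_r_graph r n p) \<subseteq> (\<lambda>E. \<lparr>verts = {..<n}, edges = E\<rparr>) ` Pow ?K"
    by (auto simp: random_r_graph_def Let_def)
  then show ?thesis by (rule finite_subset) simp
qed

lemma set_pmf_random_r_graph:
  assumes "G \<in> set_pmf (random_r_graph r n p)"
  shows "verts G = {..<n}" "edges G \<subseteq> complete_edges n r"
  using assms by (auto simp: random_r_graph_def Let_def)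

lemma prob_edges_superset:
  assumes p: "0 \<le> p" "p \<le> 1" and A: "A \<subseteq> complete_edges n r"
  shows "measure_pmf.prob (random_r_graph r n p) {G. A \<subseteq> edges G} = p ^ card A"
proof -
  let ?K = "complete_edges n r"
  let ?B = "\<lambda>e. if e \<in> A then {True} else UNIV"
  have fin: "finite ?K" by simp
  have "measure_pmf.prob (random_r_graph r n p) {G. A \<subseteq> edges G} =
      measure_pmf.prob (Pi_pmf ?K False (\<lambda>_. bernoulli_pmf p)) (Pi ?K ?B)"
    unfolding random_r_graph_def Let_def measure_map_pmf
    by (rule arg_cong[where f = "measure_pmf.prob _"]) (use A in \<open>auto simp: Pi_def subset_iff\<close>)
  also have "\<dots> = (\<Prod>e\<in>?K. measure_pmf.prob (bernoulli_pmf p) (?B e))"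
    by (rule measure_Pi_pmf_Pi[OF fin])
  also have "\<dots> = (\<Prod>e\<in>?K. if e \<in> A then p else 1)"
    using p by (intro prod.cong refl) (auto simp: measure_pmf_single)
  also have "\<dots> = p ^ card A"
    using fin A by (subst prod.If_cases) (auto simp: Int_absorb1)
  finally show ?thesis .
qed

lemma integrable_random_r_graph: "integrable (measure_pmf (random_r_graph r n p)) (f :: _ \<Rightarrow> real)"
  by (rule integrable_measure_pmf_finite[OF finite_set_pmf_random_r_graph])

lemma expectation_of_bool_superset:
  assumes "0 \<le> p" "p \<le> 1" "A \<subseteq> complete_edges n r"
  shows "measure_pmf.expectation (random_r_graph r n p) (\<lambda>G. of_bool (A \<subseteq> edges G) :: real) = p ^ card A"
proof -
  have eq: "(\<lambda>G. of_bool (A \<subseteq> edges G) :: real) = indicat_real {G. A \<subseteq> edges G}"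
    by (auto simp: fun_eq_iff indicator_def)
  show ?thesis unfolding eq using prob_edges_superset[OF assms] by simp
qed

text \<open>Chebyshev's inequality; edges are pairwise independent, so the variance is at most the
  mean.\<close>

lemma prob_card_edges_deviation:
  assumes p: "0 \<le> p" "p \<le> 1" and H: "H \<subseteq> complete_edges n r" and a: "0 < a"
  shows "measure_pmf.prob (random_r_graph r n p) {G. a \<le> \<bar>real (card (edges G \<inter> H)) - p * real (card H)\<bar>}
    \<le> p * real (card H) / a\<^sup>2"
proof -
  let ?M = "random_r_graph r n p"
  let ?E = "measure_pmf.expectation ?M"
  note int = integrable_random_r_graph
  have finH: "finite H" using H by (rule finite_subset) simp
  define X where "X G = real (card (edges G \<inter> H))" for G :: "nat hypergraph"
  have X: "X = (\<lambda>G. \<Sum>e\<in>H. of_bool ({e} \<subseteq> edges G))"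
    using finH by (auto simp: X_def fun_eq_iff sum.If_cases of_bool_def Int_commute Int_def)
  have EX: "?E X = p * real (card H)"
  proof -
    have "?E X = (\<Sum>e\<in>H. ?E (\<lambda>G. of_bool ({e} \<subseteq> edges G)))"
      unfolding X by (rule Bochner_Integration.integral_sum) (rule int)
    also have "\<dots> = (\<Sum>e\<in>H. p)"
      using H by (intro sum.cong refl) (subst expectation_of_bool_superset[OF p], auto)
    finally show ?thesis by simp
  qed
  have EX2: "?E (\<lambda>G. X G ^ 2) \<le> p * real (card H) + (p * real (card H)) ^ 2"
  proof -
    have "(\<lambda>G. X G ^ 2) = (\<lambda>G. \<Sum>e\<in>H. \<Sum>f\<in>H. of_bool ({e, f} \<subseteq> edges G))"
      by (auto simp: X power2_eq_square sum_product fun_eq_iff of_bool_conj)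
    then have "?E (\<lambda>G. X G ^ 2) = (\<Sum>e\<in>H. \<Sum>f\<in>H. ?E (\<lambda>G. of_bool ({e, f} \<subseteq> edges G)))"
      using int by (simp only: Bochner_Integration.integral_sum)
    also have "\<dots> = (\<Sum>e\<in>H. \<Sum>f\<in>H. p ^ card {e, f})"
      using H by (intro sum.cong refl) (subst expectation_of_bool_superset[OF p], auto)
    also have "\<dots> \<le> (\<Sum>e\<in>H. \<Sum>f\<in>H. (if f = e then p else 0) + p ^ 2)"
      using p by (intro sum_mono) (auto simp: card_insert_if power2_eq_square)
    also have "\<dots> = p * real (card H) + (p * real (card H)) ^ 2"
      using finH by (simp add: sum.distrib sum.delta power2_eq_square algebra_simps)
    finally show ?thesis .
  qed
  have var: "measure_pmf.variance ?M X \<le> p * real (card H)"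
    unfolding measure_pmf.variance_eq[OF int int] using EX2 by (simp add: EX)
  have "measure_pmf.prob ?M {G \<in> space (measure_pmf ?M). a \<le> \<bar>X G - ?E X\<bar>} \<le> measure_pmf.variance ?M X / a\<^sup>2"
    by (rule measure_pmf.Chebyshev_inequality[OF _ int a]) simp
  also have "\<dots> \<le> p * real (card H) / a\<^sup>2" using var by (intro divide_right_mono) auto
  finally show ?thesis by (simp add: EX X_def)
qed

text \<open>Copies are counted with labels. The repetitions due to automorphisms are harmless,
  because only upper bounds for this number are used.\<close>

definition copies_in :: "'b hypergraph \<Rightarrow> nat \<Rightarrow> nat set set \<Rightarrow> ('b \<Rightarrow> nat) set" where
  "copies_in F n H = {\<phi> \<in> homs F \<lparr>verts = {..<n}, edges = H\<rparr>. inj_on \<phi> (verts F)}"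

lemma finite_copies_in: "finite (verts F) \<Longrightarrow> finite (copies_in F n H)"
  by (rule finite_subset[of _ "verts F \<rightarrow>\<^sub>E {..<n}"]) (auto simp: copies_in_def homs_def intro!: finite_PiE)

lemma copies_in_edges:
  assumes "\<And>e. e \<in> edges F \<Longrightarrow> e \<subseteq> verts F" "\<phi> \<in> copies_in F n H"
  shows "card ((`) \<phi> ` edges F) = num_edges F"
proof (rule card_image, rule inj_onI)
  fix e e' assume "e \<in> edges F" "e' \<in> edges F" "\<phi> ` e = \<phi> ` e'"
  moreover have "inj_on \<phi> (verts F)" using assms by (simp add: copies_in_def)
  ultimately show "e = e'" using assms(1) by (simp add: inj_on_image_eq_iff)
qed

lemma copies_in_card_le:
  assumes "finite (verts F)"
  shows "real (card (copies_in F n H)) \<le> real n ^ num_verts F"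
proof -
  have "card (copies_in F n H) \<le> card (verts F \<rightarrow>\<^sub>E {..<n})"
    using assms by (intro card_mono) (auto simp: copies_in_def homs_def intro!: finite_PiE)
  also have "\<dots> = n ^ num_verts F" using assms by (simp add: card_funcsetE)
  finally show ?thesis by (metis of_nat_mono of_nat_power)
qed

section \<open>Lower bounds by deletion\<close>

lemma finite_subgraph_sizes:
  assumes "finite (edges G)"
  shows "finite (num_edges ` {G'. subgraph G' G \<and> \<not> contains_copy G' F})"
  by (rule finite_subset[of _ "{..card (edges G)}"])
    (use assms in \<open>auto simp: subgraph_def intro!: card_mono\<close>)

lemma ex_number_ge:
  assumes "finite (edges G)" "subgraph G' G" "\<not> contains_copy G' F"
  shows "num_edges G' \<le> ex_number G F"
  unfolding ex_number_def using assms finite_subgraph_sizes by (intro Max_ge) auto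

lemma ex_number_attained:
  fixes G :: "'c hypergraph"
  assumes "finite (edges G)" "edges F \<noteq> {}"
  obtains G' where "subgraph G' G" "\<not> contains_copy G' F" "num_edges G' = ex_number G F"
proof -
  have "\<lparr>verts = {}, edges = {}\<rparr> \<in> {G'. subgraph G' G \<and> \<not> contains_copy G' F}"
    using assms by (auto simp: subgraph_def contains_copy_def homs_def)
  then have "ex_number G F \<in> num_edges ` {G'. subgraph G' G \<and> \<not> contains_copy G' F}"
    unfolding ex_number_def using finite_subgraph_sizes[OF assms(1)] by (intro Max_in) auto
  then show ?thesis using that by auto
qed

lemma ex_number_le:
  fixes G :: "'c hypergraph"
  assumes "finite (edges G)" "edges F \<noteq> {}"
  shows "ex_number G F \<le> num_edges G"
proof -
  obtain G' :: "'c hypergraph" where "subgraph G' G" "num_edges G' = ex_number G F"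
    by (rule ex_number_attained[OF assms]) blast
  then show ?thesis using assms by (metis card_mono subgraph_def)
qed

text \<open>Remove from \<open>edges G \<inter> H\<close> the image of one fixed edge of
  \<open>F\<close> for each copy present. The host \<open>H\<close> is chosen before the random
  hypergraph, so that it can be arranged to have few copies.\<close>

lemma ex_number_ge_deletion:
  assumes F: "finite (verts F)" "edges F \<noteq> {}"
    and G: "verts G = {..<n}" "edges G \<subseteq> complete_edges n r"
  shows "real (card (edges G \<inter> H)) - real (card {\<phi> \<in> copies_in F n H. (`) \<phi> ` edges F \<subseteq> edges G})
    \<le> real (ex_number G F)"
proof -
  let ?Y = "{\<phi> \<in> copies_in F n H. (`) \<phi> ` edges F \<subseteq> edges G}"
  obtain e0 where e0: "e0 \<in> edges F" using F by blast
  have finG: "finite (edges G)" using G(2) by (rule finite_subset) simp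
  have finY: "finite ?Y" using finite_copies_in[OF F(1)] by simp
  define G' where "G' = \<lparr>verts = {..<n}, edges = edges G \<inter> H - (\<lambda>\<phi>. \<phi> ` e0) ` ?Y\<rparr>"
  have "\<not> contains_copy G' F"
  proof
    assume "contains_copy G' F"
    then obtain \<phi> where \<phi>: "\<phi> \<in> homs F G'" "inj_on \<phi> (verts F)" by (auto simp: contains_copy_def)
    then have "\<phi> \<in> ?Y" by (auto simp: G'_def copies_in_def homs_def)
    moreover have "\<phi> ` e0 \<in> edges G'" using \<phi> e0 by (auto simp: homs_def)
    ultimately show False by (auto simp: G'_def)
  qed
  moreover have "subgraph G' G" using G by (auto simp: subgraph_def G'_def)
  ultimately have "num_edges G' \<le> ex_number G F" using finG by (intro ex_number_ge)
  moreover have "card (edges G \<inter> H) - card ((\<lambda>\<phi>. \<phi> ` e0) ` ?Y) \<le> num_edges G'"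
    unfolding G'_def using finY by (simp add: diff_card_le_card_Diff)
  moreover have "card ((\<lambda>\<phi>. \<phi> ` e0) ` ?Y) \<le> card ?Y" using finY by (rule card_image_le)
  ultimately show ?thesis by linarith
qed

lemma prob_many_copies:
  assumes F: "finite (verts F)" "\<And>e. e \<in> edges F \<Longrightarrow> e \<subseteq> verts F" "edges F \<noteq> {}"
    and p: "0 \<le> p" "p \<le> 1" and H: "H \<subseteq> complete_edges n r" and a: "0 < a"
  shows "measure_pmf.prob (random_r_graph r n p)
      {G. a \<le> real (card {\<phi> \<in> copies_in F n H. (`) \<phi> ` edges F \<subseteq> edges G})}
    \<le> real (card (copies_in F n H)) * p ^ num_edges F / a"
proof -
  let ?M = "random_r_graph r n p"
  let ?E = "measure_pmf.expectation ?M"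
  define Y where "Y G = real (card {\<phi> \<in> copies_in F n H. (`) \<phi> ` edges F \<subseteq> edges G})" for G :: "nat hypergraph"
  have Y: "Y = (\<lambda>G. \<Sum>\<phi>\<in>copies_in F n H. of_bool ((`) \<phi> ` edges F \<subseteq> edges G))"
    using finite_copies_in[OF F(1), of n H] by (auto simp: Y_def fun_eq_iff sum.If_cases of_bool_def Int_def)
  have "?E Y = (\<Sum>\<phi>\<in>copies_in F n H. ?E (\<lambda>G. of_bool ((`) \<phi> ` edges F \<subseteq> edges G)))"
    unfolding Y by (rule Bochner_Integration.integral_sum) (rule integrable_random_r_graph)
  also have "\<dots> = (\<Sum>\<phi>\<in>copies_in F n H. p ^ num_edges F)"
  proof (rule sum.cong[OF refl])
    fix \<phi> assume \<phi>: "\<phi> \<in> copies_in F n H"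
    then have "(`) \<phi> ` edges F \<subseteq> complete_edges n r"
      using H by (auto simp: copies_in_def homs_def)
    then show "?E (\<lambda>G. of_bool ((`) \<phi> ` edges F \<subseteq> edges G)) = p ^ num_edges F"
      using expectation_of_bool_superset[OF p] copies_in_edges[OF F(2) \<phi>] by simp
  qed
  finally have EY: "?E Y = real (card (copies_in F n H)) * p ^ num_edges F" by simp
  have "measure_pmf.prob ?M {G \<in> space (measure_pmf ?M). a \<le> Y G} \<le> ?E Y / a"
    by (rule integral_Markov_inequality_measure[OF integrable_random_r_graph, where A = UNIV])
      (use a in \<open>auto simp: Y_def\<close>)
  then show ?thesis by (simp add: EY Y_def)
qed

text \<open>A union bound over two failure events. Only outcomes in the support have to be
  inspected, so the structure of the random hypergraph is available there.\<close>

lemma prob_ge_1_minus: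
  fixes M :: "'c pmf"
  assumes "\<And>x. x \<in> set_pmf M \<Longrightarrow> x \<notin> A \<Longrightarrow> x \<notin> B \<Longrightarrow> x \<in> C"
  shows "1 - measure_pmf.prob M A - measure_pmf.prob M B \<le> measure_pmf.prob M C"
proof -
  have "measure_pmf.prob M UNIV = measure_pmf.prob M (set_pmf M \<inter> UNIV)"
    using measure_Int_set_pmf[of M UNIV] by simp
  also have "\<dots> \<le> measure_pmf.prob M ((A \<union> B) \<union> C)"
    using assms by (intro measure_pmf.finite_measure_mono) auto
  also have "\<dots> \<le> measure_pmf.prob M (A \<union> B) + measure_pmf.prob M C"
    by (rule measure_Un_le) auto
  also have "measure_pmf.prob M (A \<union> B) \<le> measure_pmf.prob M A + measure_pmf.prob M B"
    by (rule measure_Un_le) auto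
  finally show ?thesis by simp
qed

text \<open>One \<epsilon> is lost to the deviation of the number of edges, the other to the deleted
  copies, whose number Markov's inequality controls.\<close>

proposition prob_ex_number_ge:
  assumes F: "finite (verts F)" "\<And>e. e \<in> edges F \<Longrightarrow> e \<subseteq> verts F" "edges F \<noteq> {}"
    and p: "0 < p" "p \<le> 1" and H: "H \<subseteq> complete_edges n r" "H \<noteq> {}" and \<epsilon>: "0 < \<epsilon>"
  shows "1 - 1 / (\<epsilon>\<^sup>2 * (p * real (card H))) - real (card (copies_in F n H)) * p ^ num_edges F / (\<epsilon> * (p * real (card H)))
    \<le> measure_pmf.prob (random_r_graph r n p) {G. (1 - 2 * \<epsilon>) * (p * real (card H)) \<le> real (ex_number G F)}"
proof -
  let ?M = "random_r_graph r n p" and ?\<mu> = "p * real (card H)"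
  have finH: "finite H" using H(1) by (rule finite_subset) simp
  have \<mu>: "0 < ?\<mu>" using p finH H(2) by (simp add: card_gt_0_iff)
  let ?A = "{G. \<epsilon> * ?\<mu> \<le> \<bar>real (card (edges G \<inter> H)) - ?\<mu>\<bar>}"
  let ?B = "{G. \<epsilon> * ?\<mu> \<le> real (card {\<phi> \<in> copies_in F n H. (`) \<phi> ` edges F \<subseteq> edges G})}"
  have "measure_pmf.prob ?M ?A \<le> ?\<mu> / (\<epsilon> * ?\<mu>)\<^sup>2"
    using p \<epsilon> \<mu> by (intro prob_card_edges_deviation[OF _ _ H(1)]) auto
  also have "\<dots> = 1 / (\<epsilon>\<^sup>2 * ?\<mu>)" using \<mu> \<epsilon> by (simp add: power2_eq_square)
  finally have A: "measure_pmf.prob ?M ?A \<le> 1 / (\<epsilon>\<^sup>2 * ?\<mu>)" .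
  have B: "measure_pmf.prob ?M ?B \<le> real (card (copies_in F n H)) * p ^ num_edges F / (\<epsilon> * ?\<mu>)"
    using p \<epsilon> \<mu> by (intro prob_many_copies[OF F _ _ H(1)]) auto
  have "1 - measure_pmf.prob ?M ?A - measure_pmf.prob ?M ?B \<le>
      measure_pmf.prob ?M {G. (1 - 2 * \<epsilon>) * ?\<mu> \<le> real (ex_number G F)}"
  proof (rule prob_ge_1_minus)
    fix G assume G: "G \<in> set_pmf ?M" "G \<notin> ?A" "G \<notin> ?B"
    have "real (card (edges G \<inter> H)) - real (card {\<phi> \<in> copies_in F n H. (`) \<phi> ` edges F \<subseteq> edges G})
        \<le> real (ex_number G F)"
      by (rule ex_number_ge_deletion[OF F(1,3) set_pmf_random_r_graph[OF G(1)]])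
    then show "G \<in> {G. (1 - 2 * \<epsilon>) * ?\<mu> \<le> real (ex_number G F)}"
      using G(2,3) by (simp add: algebra_simps abs_less_iff not_le)
  qed
  then show ?thesis using A B by linarith
qed

section \<open>Upper bounds from containers\<close>

lemma power_div_exp_le_fact: "real k ^ k / exp (real k) \<le> fact k"
proof -
  have "(\<Sum>i\<in>{k}. real k ^ i /\<^sub>R fact i) \<le> exp (real k)"
    unfolding exp_def by (rule sum_le_suminf[OF summable_exp_generic]) auto
  then show ?thesis by (simp add: divide_simps mult.commute)
qed

text \<open>A copy-free subgraph with more than \<open>m\<close> edges lies in a container and has a
  subset of k = \<lceil>m\<rceil> edges. In one container the expected number of such subsets that
  are present is at most (e a p / k)^k, and \<open>small\<close> makes this at most e^(-k).\<close>

proposition prob_ex_number_gt: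
  fixes m a :: real
  assumes F: "edges F \<noteq> {}" "verts F \<subseteq> \<Union>(edges F)" and p: "0 \<le> p" "p \<le> 1" and m: "0 < m" and a: "0 \<le> a"
    and \<C>: "finite \<C>" "\<And>C. C \<in> \<C> \<Longrightarrow> C \<subseteq> complete_edges n r \<and> real (card C) \<le> a"
    and cov: "\<And>I. I \<subseteq> complete_edges n r \<Longrightarrow> \<not> contains_copy \<lparr>verts = {..<n}, edges = I\<rparr> F \<Longrightarrow>
      \<exists>C\<in>\<C>. I \<subseteq> C"
    and small: "exp 2 * (a * p) \<le> m"
  shows "measure_pmf.prob (random_r_graph r n p) {G. m < real (ex_number G F)} \<le> real (card \<C>) * exp (- m)"
proof -
  let ?M = "random_r_graph r n p"
  define k where "k = nat \<lceil>m\<rceil>"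
  have k: "m \<le> real k" "0 < k" using m by (auto simp: k_def real_nat_ceiling_ge)
  let ?T = "\<lambda>C. {T. T \<subseteq> C \<and> card T = k}"
  have finC: "finite C" if "C \<in> \<C>" for C
    by (rule finite_subset[of C "complete_edges n r"]) (use \<C>(2)[OF that] in auto)
  have sub: "{G. m < real (ex_number G F)} \<inter> set_pmf ?M \<subseteq> (\<Union>C\<in>\<C>. \<Union>T\<in>?T C. {G. T \<subseteq> edges G})"
  proof
    fix G assume "G \<in> {G. m < real (ex_number G F)} \<inter> set_pmf ?M"
    then have ex: "m < real (ex_number G F)" and G: "G \<in> set_pmf ?M" by auto
    note G' = set_pmf_random_r_graph[OF G]
    have finG: "finite (edges G)" using G'(2) by (rule finite_subset) simp
    obtain G1 :: "nat hypergraph" where G1: "subgraph G1 G" "\<not> contains_copy G1 F" "num_edges G1 = ex_number G F"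
      by (rule ex_number_attained[OF finG F(1)]) blast
    have sub: "edges G1 \<subseteq> edges G" "verts G1 \<subseteq> {..<n}" "\<And>e. e \<in> edges G1 \<Longrightarrow> e \<subseteq> verts G1"
      using G1(1) G' by (auto simp: subgraph_def)
    \<comment> \<open>Containers refer to the full vertex set. Adding vertices to \<open>G1\<close>
      creates no copy, because every vertex of \<open>F\<close> lies in an edge.\<close>
    have "\<not> contains_copy \<lparr>verts = {..<n}, edges = edges G1\<rparr> F"
    proof
      assume "contains_copy \<lparr>verts = {..<n}, edges = edges G1\<rparr> F"
      then obtain \<phi> where \<phi>: "\<phi> \<in> verts F \<rightarrow>\<^sub>E {..<n}" "\<And>e. e \<in> edges F \<Longrightarrow> \<phi> ` e \<in> edges G1" "inj_on \<phi> (verts F)"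
        by (auto simp: contains_copy_def homs_def)
      have "\<phi> x \<in> verts G1" if x: "x \<in> verts F" for x
      proof -
        obtain e where "e \<in> edges F" "x \<in> e" using F(2) x by blast
        then show ?thesis using \<phi>(2)[of e] sub(3)[of "\<phi> ` e"] by blast
      qed
      then have "\<phi> \<in> homs F G1" using \<phi> by (auto simp: homs_def PiE_iff)
      then show False using G1(2) \<phi>(3) by (auto simp: contains_copy_def)
    qed
    then obtain C where C: "C \<in> \<C>" "edges G1 \<subseteq> C" using cov[of "edges G1"] sub G'(2) by blast
    have "k \<le> num_edges G1" unfolding G1(3) k_def using ex by linarith
    then obtain T where "T \<subseteq> edges G1" "card T = k" using obtain_subset_with_card_n by metis
    then show "G \<in> (\<Union>C\<in>\<C>. \<Union>T\<in>?T C. {G. T \<subseteq> edges G})" using C sub by blast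
  qed
  have per: "measure_pmf.prob ?M (\<Union>T\<in>?T C. {G. T \<subseteq> edges G}) \<le> exp (- m)" if C: "C \<in> \<C>" for C
  proof -
    have fT: "finite (?T C)" using finC[OF C] by simp
    have "measure_pmf.prob ?M (\<Union>T\<in>?T C. {G. T \<subseteq> edges G}) \<le> (\<Sum>T\<in>?T C. measure_pmf.prob ?M {G. T \<subseteq> edges G})"
      by (rule measure_pmf.finite_measure_subadditive_finite[OF fT]) simp
    also have "\<dots> = (\<Sum>T\<in>?T C. p ^ k)"
    proof (rule sum.cong[OF refl])
      fix T assume T: "T \<in> ?T C"
      have "T \<subseteq> complete_edges n r" using T \<C>(2)[OF C] by blast
      then show "measure_pmf.prob ?M {G. T \<subseteq> edges G} = p ^ k" using prob_edges_superset[OF p] T by simp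
    qed
    also have "\<dots> = real (card C choose k) * p ^ k" using n_subsets[OF finC[OF C]] by simp
    also have "\<dots> \<le> (a ^ k / fact k) * p ^ k"
    proof (rule mult_right_mono)
      have "real ((card C choose k) * fact k) \<le> real (card C ^ k)" by (rule of_nat_mono) (rule binomial_fact_pow)
      also have "\<dots> \<le> a ^ k" using \<C>(2)[OF C] by (simp add: power_mono)
      finally show "real (card C choose k) \<le> a ^ k / fact k" by (simp add: le_divide_eq)
    qed (use p in simp)
    also have "\<dots> \<le> (a ^ k / (real k ^ k / exp (real k))) * p ^ k"
      using power_div_exp_le_fact[of k] k a p by (intro mult_right_mono divide_left_mono) auto
    also have "\<dots> = (exp 1 * (a * p) / real k) ^ k"
      by (simp add: power_mult_distrib power_divide exp_of_nat_mult[symmetric])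
    also have "\<dots> \<le> exp (- 1) ^ k"
    proof (rule power_mono)
      have "exp 1 * (exp 1 * (a * p)) \<le> real k"
        using small k by (simp add: mult.assoc[symmetric] exp_add[symmetric])
      then show "exp 1 * (a * p) / real k \<le> exp (- 1)"
        using k by (simp add: exp_minus field_simps)
    qed (use a p in auto)
    also have "\<dots> = exp (- real k)" by (simp add: exp_of_nat_mult[symmetric])
    also have "\<dots> \<le> exp (- m)" using k by simp
    finally show ?thesis .
  qed
  have "measure_pmf.prob ?M {G. m < real (ex_number G F)} =
      measure_pmf.prob ?M ({G. m < real (ex_number G F)} \<inter> set_pmf ?M)"
    by (simp add: measure_Int_set_pmf)
  also have "\<dots> \<le> measure_pmf.prob ?M (\<Union>C\<in>\<C>. \<Union>T\<in>?T C. {G. T \<subseteq> edges G})"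
    by (rule measure_pmf.finite_measure_mono[OF sub]) simp
  also have "\<dots> \<le> (\<Sum>C\<in>\<C>. measure_pmf.prob ?M (\<Union>T\<in>?T C. {G. T \<subseteq> edges G}))"
    by (rule measure_pmf.finite_measure_subadditive_finite[OF \<C>(1)]) simp
  also have "\<dots> \<le> (\<Sum>C\<in>\<C>. exp (- m))" by (rule sum_mono) (rule per)
  finally show ?thesis by simp
qed

section \<open>Sidorenko hypergraphs\<close>

lemma aasI:
  assumes "\<forall>\<^sub>F n in sequentially. 1 - g n \<le> measure_pmf.prob (M n) {x. A n x}" "g \<longlonglongrightarrow> 0"
  shows "aas M A"
  unfolding aas_def
proof (rule tendsto_sandwich[OF assms(1)])
  show "\<forall>\<^sub>F n in sequentially. measure_pmf.prob (M n) {x. A n x} \<le> 1" by simp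
  show "(\<lambda>n. 1 - g n) \<longlonglongrightarrow> 1" using tendsto_diff[OF tendsto_const[of 1] assms(2)] by simp
qed simp

lemma aas_compl: "aas M A \<Longrightarrow> (\<lambda>n. 1 - measure_pmf.prob (M n) {x. A n x}) \<longlonglongrightarrow> 0"
  unfolding aas_def using tendsto_diff[OF tendsto_const[of 1]] by fastforce

lemma aas_conj:
  assumes "aas M A" "aas M B"
  shows "aas M (\<lambda>n x. A n x \<and> B n x)"
proof (rule aasI)
  show "(\<lambda>n. (1 - measure_pmf.prob (M n) {x. A n x}) + (1 - measure_pmf.prob (M n) {x. B n x})) \<longlonglongrightarrow> 0"
    using tendsto_add[OF aas_compl[OF assms(1)] aas_compl[OF assms(2)]] by simp
  show "\<forall>\<^sub>F n in sequentially. 1 - ((1 - measure_pmf.prob (M n) {x. A n x}) + (1 - measure_pmf.prob (M n) {x. B n x}))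
      \<le> measure_pmf.prob (M n) {x. A n x \<and> B n x}"
  proof (rule always_eventually, rule allI)
    fix n
    have c: "measure_pmf.prob (M n) (- {x. P x}) = 1 - measure_pmf.prob (M n) {x. P x}" for P
      using measure_pmf.prob_compl[of "{x. P x}" "M n"] by (simp add: Compl_eq_Diff_UNIV)
    have "1 - measure_pmf.prob (M n) (- {x. A n x}) - measure_pmf.prob (M n) (- {x. B n x})
        \<le> measure_pmf.prob (M n) {x. A n x \<and> B n x}"
      by (rule prob_ge_1_minus) auto
    then show "1 - ((1 - measure_pmf.prob (M n) {x. A n x}) + (1 - measure_pmf.prob (M n) {x. B n x}))
      \<le> measure_pmf.prob (M n) {x. A n x \<and> B n x}" unfolding c by linarith
  qed
qed

lemma aas_mono:
  assumes "aas M A" "\<forall>\<^sub>F n in sequentially. \<forall>x\<in>set_pmf (M n). A n x \<longrightarrow> B n x"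
  shows "aas M B"
proof (rule aasI[OF _ aas_compl[OF assms(1)]])
  show "\<forall>\<^sub>F n in sequentially. 1 - (1 - measure_pmf.prob (M n) {x. A n x}) \<le> measure_pmf.prob (M n) {x. B n x}"
    using assms(2)
  proof eventually_elim
    case (elim n)
    have "measure_pmf.prob (M n) {x. A n x} = measure_pmf.prob (M n) ({x. A n x} \<inter> set_pmf (M n))"
      by (simp add: measure_Int_set_pmf)
    also have "\<dots> \<le> measure_pmf.prob (M n) {x. B n x}"
      using elim by (intro measure_pmf.finite_measure_mono) auto
    finally show ?case by simp
  qed
qed

lemma much_less_at_top:
  assumes "f \<lless> g" "\<forall>\<^sub>F n in sequentially. 0 < f n \<and> 0 < g n"
  shows "filterlim (\<lambda>n. g n / f n) at_top sequentially"
proof -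
  have "filterlim (\<lambda>n. inverse (f n / g n)) at_top sequentially"
    using assms by (intro filterlim_inverse_at_top) (auto simp: much_less_def elim!: eventually_mono)
  then show ?thesis by (simp add: inverse_eq_divide)
qed

text \<open>\<open>few\<close> says that the expected number of surviving copies is of smaller order
  than the expected number p * card H of surviving edges; one power of p is cancelled.\<close>

proposition aas_ex_number_ge:
  fixes F :: "'b hypergraph"
  assumes F: "finite (verts F)" "\<And>e. e \<in> edges F \<Longrightarrow> e \<subseteq> verts F" "edges F \<noteq> {}"
    and p: "\<And>n. 0 < p n \<and> p n \<le> 1"
    and H: "\<forall>\<^sub>F n in sequentially. H n \<subseteq> complete_edges n r"
    and large: "filterlim (\<lambda>n. p n * real (card (H n))) at_top sequentially"
    and few: "(\<lambda>n. real (card (copies_in F n (H n))) * p n ^ (num_edges F - 1) / real (card (H n))) \<longlonglongrightarrow> 0"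
    and \<epsilon>: "0 < \<epsilon>"
  shows "aas (\<lambda>n. random_r_graph r n (p n))
    (\<lambda>n G. (1 - 2 * \<epsilon>) * (p n * real (card (H n))) \<le> real (ex_number G F))"
proof -
  let ?\<mu> = "\<lambda>n. p n * real (card (H n))"
  let ?x = "\<lambda>n. real (card (copies_in F n (H n))) * p n ^ (num_edges F - 1) / real (card (H n))"
  have finF: "finite (edges F)" by (rule finite_subset[of _ "Pow (verts F)"]) (use F in auto)
  show ?thesis
  proof (rule aasI)
    have "(\<lambda>n. inverse (?\<mu> n)) \<longlonglongrightarrow> 0" by (rule tendsto_inverse_0_at_top[OF large])
    then have "(\<lambda>n. inverse (\<epsilon>\<^sup>2) * inverse (?\<mu> n) + inverse \<epsilon> * ?x n) \<longlonglongrightarrow> inverse (\<epsilon>\<^sup>2) * 0 + inverse \<epsilon> * 0"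
      by (intro tendsto_intros few)
    then show "(\<lambda>n. inverse (\<epsilon>\<^sup>2) * inverse (?\<mu> n) + inverse \<epsilon> * ?x n) \<longlonglongrightarrow> 0" by simp
    have "\<forall>\<^sub>F n in sequentially. 0 < ?\<mu> n" using large by (auto simp: filterlim_at_top_dense)
    then show "\<forall>\<^sub>F n in sequentially. 1 - (inverse (\<epsilon>\<^sup>2) * inverse (?\<mu> n) + inverse \<epsilon> * ?x n)
      \<le> measure_pmf.prob (random_r_graph r n (p n)) {G. (1 - 2 * \<epsilon>) * ?\<mu> n \<le> real (ex_number G F)}"
      using H
    proof eventually_elim
      case (elim n)
      have ne: "H n \<noteq> {}" using elim(1) by auto
      have "p n ^ num_edges F = p n * p n ^ (num_edges F - 1)"
        using F(3) finF by (simp add: power_eq_if card_gt_0_iff)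
      then have "real (card (copies_in F n (H n))) * p n ^ num_edges F / (\<epsilon> * ?\<mu> n) = inverse \<epsilon> * ?x n"
        using p[of n] \<epsilon> by (simp add: divide_simps)
      moreover have "1 / (\<epsilon>\<^sup>2 * ?\<mu> n) = inverse (\<epsilon>\<^sup>2) * inverse (?\<mu> n)" by (simp add: divide_simps)
      ultimately show ?case
        using prob_ex_number_ge[OF F _ _ elim(2) ne \<epsilon>, of "p n"] p[of n] by simp
    qed
  qed
qed

lemma choose_ge_power:
  assumes "r \<le> n" "1 \<le> r"
  shows "real n ^ r / real r ^ r \<le> real (n choose r)"
  using binomial_ge_n_over_k_pow_k[of r n, where 'a = real] assms by (simp add: power_divide)

section \<open>The expansion at and around the critical probability\<close>

context strictly_balanced_graph
begin

context
  fixes r :: nat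
  assumes r: "r0 \<le> r"
begin

lemma expansion_finite: "finite (verts (expansion r0 r F))"
  using r_graph_finite[OF F] by (simp add: expansion_def)

lemma expansion_edges_sub: "e \<in> edges (expansion r0 r F) \<Longrightarrow> e \<subseteq> verts (expansion r0 r F)"
  using F by (auto simp: expansion_def r_graph_def)

lemma expansion_edges_nonempty: "edges (expansion r0 r F) \<noteq> {}"
  using s3 by (auto simp: expansion_def)

lemma expansion_verts_covered: "verts (expansion r0 r F) \<subseteq> \<Union>(edges (expansion r0 r F))"
proof
  fix x assume x: "x \<in> verts (expansion r0 r F)"
  show "x \<in> \<Union>(edges (expansion r0 r F))"
  proof (cases x)
    case (Inl y)
    then have "y \<in> \<Union>(edges F)" using x Union_edges by (auto simp: expansion_def)
    then obtain e where "e \<in> edges F" "y \<in> e" by blast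
    then show ?thesis using Inl unfolding expansion_def by auto
  next
    case (Inr q)
    then show ?thesis using x unfolding expansion_def by auto
  qed
qed

lemma num_edges_expansion: "num_edges (expansion r0 r F) = s"
proof -
  have "inj_on (\<lambda>e. Inl ` e \<union> Inr ` ({e} \<times> {..<r - r0})) (edges F)"
  proof (rule inj_onI)
    fix e e' assume "Inl ` e \<union> Inr ` ({e} \<times> {..<r - r0}) = Inl ` e' \<union> Inr ` ({e'} \<times> {..<r - r0})"
    then have "Inl -` (Inl ` e \<union> Inr ` ({e} \<times> {..<r - r0})) = Inl -` (Inl ` e' \<union> Inr ` ({e'} \<times> {..<r - r0}))"
      by simp
    then show "e = e'" by auto
  qed
  then show ?thesis by (simp add: expansion_def card_image)
qed

lemma num_verts_expansion: "num_verts (expansion r0 r F) = v + s * (r - r0)"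
proof -
  let ?A = "Inl ` verts F :: ('a + 'a set \<times> nat) set" and ?B = "Inr ` (edges F \<times> {..<r - r0}) :: ('a + 'a set \<times> nat) set"
  have "card (?A \<union> ?B) = card ?A + card ?B"
    using r_graph_finite[OF F] by (intro card_Un_disjoint) auto
  then show ?thesis by (simp add: expansion_def card_image card_cartesian_product)
qed

text \<open>At p = n powr (e0 - r) the crude bound n ^ num_verts * p ^ s for the expected number of
  copies equals n ^ r * p, the order of the number of edges. This is the threshold between the two
  ranges.\<close>

lemma critical_probability:
  assumes "0 < n"
  shows "real n ^ num_verts (expansion r0 r F) * (real n powr (e0 - real r)) ^ (s - 1) = real n ^ r"
proof -
  have "(real n powr (e0 - real r)) ^ (s - 1) = real n powr ((real s - 1) * (e0 - real r))"
    using assms s3 by (simp add: powr_realpow[symmetric] powr_powr of_nat_diff mult.commute)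
  then have "real n ^ num_verts (expansion r0 r F) * (real n powr (e0 - real r)) ^ (s - 1) =
      real n powr (real (v + s * (r - r0)) + (real s - 1) * (e0 - real r))"
    using assms by (simp add: num_verts_expansion powr_add powr_realpow del: of_nat_add of_nat_mult)
  also have "real (v + s * (r - r0)) = real v + real s * (real r - real r0)" using r by (simp add: of_nat_diff)
  also have "real v + real s * (real r - real r0) + (real s - 1) * (e0 - real r) = real r"
    using e0_mult by (simp add: algebra_simps)
  finally show ?thesis using assms by (simp add: powr_realpow)
qed

text \<open>In a copy all edges would contain 0, so some vertex of the expansion would lie in all
  its edges. An old vertex would then have degree s > \<open>max_degree F\<close>, and a new vertex
  lies in only one edge.\<close>

lemma star_no_copies:
  assumes deg: "max_degree F < s"
  shows "copies_in (expansion r0 r F) n {e. e \<subseteq> {..<n} \<and> card e = r \<and> 0 \<in> e} = {}"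
proof (rule ccontr)
  assume "\<not> ?thesis"
  then obtain \<phi> where "\<phi> \<in> copies_in (expansion r0 r F) n {e. e \<subseteq> {..<n} \<and> card e = r \<and> 0 \<in> e}" by blast
  then have \<phi>: "\<And>e. e \<in> edges (expansion r0 r F) \<Longrightarrow> 0 \<in> \<phi> ` e" "inj_on \<phi> (verts (expansion r0 r F))"
    by (auto simp: copies_in_def homs_def)
  obtain e1 where e1: "e1 \<in> edges (expansion r0 r F)" using expansion_edges_nonempty by blast
  obtain x0 where "x0 \<in> e1" and x00: "\<phi> x0 = 0" using \<phi>(1)[OF e1] by (metis imageE)
  then have x0: "x0 \<in> verts (expansion r0 r F)" "\<phi> x0 = 0" using expansion_edges_sub[OF e1] by auto
  have all: "x0 \<in> e" if e: "e \<in> edges (expansion r0 r F)" for e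
  proof -
    have "0 \<in> \<phi> ` e" using e by (rule \<phi>(1))
    then obtain x where "x \<in> e" "\<phi> x = 0" by (metis imageE)
    then show ?thesis using \<phi>(2) x0 expansion_edges_sub[of e] e by (metis inj_onD subsetD)
  qed
  have all': "x0 \<in> Inl ` e \<union> Inr ` ({e} \<times> {..<r - r0})" if "e \<in> edges F" for e
  proof -
    have "Inl ` e \<union> Inr ` ({e} \<times> {..<r - r0}) \<in> edges (expansion r0 r F)"
      using that by (simp add: expansion_def)
    then show ?thesis by (rule all)
  qed
  have "1 < card (edges F)" using s3 by simp
  then obtain e1 e2 where e12: "e1 \<in> edges F" "e2 \<in> edges F" "e1 \<noteq> e2"
    by (metis One_nat_def card_le_Suc0_iff_eq card.infinite not_le not_less_zero zero_less_one)
  show False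
  proof (cases x0)
    case (Inl y)
    then have "{e \<in> edges F. y \<in> e} = edges F" using all' by auto
    then have "card {e \<in> edges F. y \<in> e} = s" by (simp only:)
    moreover have "y \<in> verts F" using x0 Inl by (auto simp: expansion_def)
    moreover from this have "card {e \<in> edges F. y \<in> e} \<le> max_degree F"
      unfolding max_degree_def using r_graph_finite[OF F] by (intro Max_ge) (auto intro!: image_eqI[where x = y])
    ultimately have "s \<le> max_degree F" by simp
    then show False using deg by simp
  next
    case (Inr q)
    then show False using all'[OF e12(1)] all'[OF e12(2)] e12(3) by auto
  qed
qed

lemma card_star_ge:
  assumes "2 \<le> r" "r \<le> n" "2 \<le> n"
  shows "real n ^ (r - 1) / (2 * real r) ^ (r - 1) \<le> real (card {e. e \<subseteq> {..<n} \<and> card e = r \<and> 0 \<in> e})"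
proof -
  let ?A = "{T. T \<subseteq> {1..<n} \<and> card T = r - 1}"
  have "(n - 1) choose (r - 1) = card ?A" using n_subsets[of "{1..<n}" "r - 1"] by simp
  also have "\<dots> \<le> card {e. e \<subseteq> {..<n} \<and> card e = r \<and> 0 \<in> e}"
  proof (rule card_inj_on_le[where f = "insert 0"])
    show "inj_on (insert 0) ?A"
    proof (rule inj_onI)
      fix T T' assume T: "T \<in> ?A" "T' \<in> ?A" "insert 0 T = insert 0 T'"
      have "0 \<notin> T" "0 \<notin> T'" using T by auto
      then show "T = T'" using T(3) by (metis insert_ident)
    qed
    show "insert 0 ` ?A \<subseteq> {e. e \<subseteq> {..<n} \<and> card e = r \<and> 0 \<in> e}"
    proof (rule image_subsetI)
      fix T assume T: "T \<in> ?A"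
      then have "finite T" "0 \<notin> T" using finite_subset[of T "{1..<n}"] by auto
      then show "insert 0 T \<in> {e. e \<subseteq> {..<n} \<and> card e = r \<and> 0 \<in> e}" using T assms by auto
    qed
  qed simp
  finally have le: "(n - 1) choose (r - 1) \<le> card {e. e \<subseteq> {..<n} \<and> card e = r \<and> 0 \<in> e}" .
  have "real n / (2 * real r) = (real n / 2) / real r" by simp
  also have "\<dots> \<le> real (n - 1) / real (r - 1)" using assms by (intro frac_le) (auto simp: of_nat_diff)
  finally have "(real n / (2 * real r)) ^ (r - 1) \<le> (real (n - 1) / real (r - 1)) ^ (r - 1)"
    by (intro power_mono) auto
  also have "\<dots> \<le> real ((n - 1) choose (r - 1))"
    using binomial_ge_n_over_k_pow_k[of "r - 1" "n - 1", where 'a = real] assms by simp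
  finally show ?thesis using of_nat_mono[OF le, where 'a = real] by (simp add: power_divide)
qed

text \<open>There are no copies to delete, so only the number of edges of the star has to be
  concentrated. Its mean tends to infinity because p is far above n powr (e0 - r) and e0 \<ge>
  1.\<close>

lemma aas_star_bound:
  assumes deg: "max_degree F < s" and r2: "2 \<le> r" and e0: "1 \<le> e0"
    and p: "\<And>n. 0 < p n \<and> p n \<le> 1" and thr: "(\<lambda>n. real n powr (e0 - real r)) \<lless> p"
  shows "aas (\<lambda>n. random_r_graph r n (p n))
    (\<lambda>n G. 1 / (2 * (2 * real r) ^ (r - 1)) * p n * real n ^ (r - 1) \<le> real (ex_number G (expansion r0 r F)))"
proof -
  let ?H = "\<lambda>n. {e. e \<subseteq> {..<n} \<and> card e = r \<and> 0 \<in> e}"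
  have ev: "\<forall>\<^sub>F n in sequentially. p n * real n ^ (r - 1) / (2 * real r) ^ (r - 1) \<le> p n * real (card (?H n))"
    using eventually_ge_at_top[of r]
  proof eventually_elim
    case (elim n)
    then have "p n * (real n ^ (r - 1) / (2 * real r) ^ (r - 1)) \<le> p n * real (card (?H n))"
      using p[of n] r2 by (intro mult_left_mono card_star_ge) auto
    then show ?case by simp
  qed
  have lim: "filterlim (\<lambda>n. p n / real n powr (e0 - real r)) at_top sequentially"
    by (rule much_less_at_top[OF thr]) (use p in \<open>auto intro: eventually_mono[OF eventually_gt_at_top[of 0]]\<close>)
  have "filterlim (\<lambda>n. inverse ((2 * real r) ^ (r - 1)) * (p n / real n powr (e0 - real r))) at_top sequentially"
    by (rule filterlim_tendsto_pos_mult_at_top[OF tendsto_const _ lim]) (use r2 in auto)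
  then have "filterlim (\<lambda>n. p n * real (card (?H n))) at_top sequentially"
  proof (rule filterlim_at_top_mono)
    show "\<forall>\<^sub>F n in sequentially. inverse ((2 * real r) ^ (r - 1)) * (p n / real n powr (e0 - real r)) \<le> p n * real (card (?H n))"
      using ev eventually_ge_at_top[of 1]
    proof eventually_elim
      case (elim n)
      have "1 / real n powr (e0 - real r) = real n powr (real r - e0)" by (simp add: powr_minus_divide[symmetric])
      also have "\<dots> \<le> real n powr real (r - 1)" using e0 r2 elim(2) by (intro powr_mono) (auto simp: of_nat_diff)
      also have "\<dots> = real n ^ (r - 1)" using elim(2) by (simp add: powr_realpow)
      finally have "p n * (1 / real n powr (e0 - real r)) \<le> p n * real n ^ (r - 1)" using p[of n] by (intro mult_left_mono) auto
      then have "p n / real n powr (e0 - real r) \<le> p n * real n ^ (r - 1)" by simp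
      then have "inverse ((2 * real r) ^ (r - 1)) * (p n / real n powr (e0 - real r)) \<le>
          inverse ((2 * real r) ^ (r - 1)) * (p n * real n ^ (r - 1))"
        by (intro mult_left_mono) auto
      also have "\<dots> = p n * real n ^ (r - 1) / (2 * real r) ^ (r - 1)" by (simp add: field_simps)
      finally show ?case using elim(1) by linarith
    qed
  qed
  then have "aas (\<lambda>n. random_r_graph r n (p n))
    (\<lambda>n G. (1 - 2 * (1 / 4)) * (p n * real (card (?H n))) \<le> real (ex_number G (expansion r0 r F)))"
    by (intro aas_ex_number_ge[OF expansion_finite expansion_edges_sub expansion_edges_nonempty p])
      (auto simp: star_no_copies[OF deg] intro!: always_eventually)
  then show ?thesis
  proof (rule aas_mono)
    show "\<forall>\<^sub>F n in sequentially. \<forall>G\<in>set_pmf (random_r_graph r n (p n)).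
        (1 - 2 * (1 / 4)) * (p n * real (card (?H n))) \<le> real (ex_number G (expansion r0 r F)) \<longrightarrow>
        1 / (2 * (2 * real r) ^ (r - 1)) * p n * real n ^ (r - 1) \<le> real (ex_number G (expansion r0 r F))"
      using ev
    proof eventually_elim
      case (elim n)
      have "1 / (2 * (2 * real r) ^ (r - 1)) * p n * real n ^ (r - 1) = 1 / 2 * (p n * real n ^ (r - 1) / (2 * real r) ^ (r - 1))"
        by simp
      then show ?case using elim by auto
    qed
  qed
qed

text \<open>First moment of edges minus \<omega> times copies in the random hypergraph of density
  \<rho>. Working with one linear combination secures many edges and few copies in the same
  outcome.\<close>

lemma exists_sparse_hypergraph:
  assumes \<rho>: "0 \<le> \<rho>" "\<rho> \<le> 1" and \<omega>: "0 \<le> \<omega>"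
  shows "\<exists>H\<subseteq>complete_edges n r.
    \<rho> * real (n choose r) - \<omega> * (real n ^ num_verts (expansion r0 r F) * \<rho> ^ s)
      \<le> real (card H) - \<omega> * real (card (copies_in (expansion r0 r F) n H))"
proof -
  let ?F = "expansion r0 r F" and ?M = "random_r_graph r n \<rho>" and ?K = "complete_edges n r"
  let ?E = "measure_pmf.expectation ?M"
  let ?b = "\<rho> * real (n choose r) - \<omega> * (real n ^ num_verts ?F * \<rho> ^ s)"
  define Y where "Y G = (\<Sum>\<phi>\<in>copies_in ?F n ?K. of_bool ((`) \<phi> ` edges ?F \<subseteq> edges G) :: real)" for G :: "nat hypergraph"
  define X where "X G = (\<Sum>e\<in>?K. of_bool ({e} \<subseteq> edges G) :: real)" for G :: "nat hypergraph"
  have finc: "finite (copies_in ?F n ?K)" by (rule finite_copies_in[OF expansion_finite])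
  have EX: "?E X = \<rho> * real (n choose r)"
  proof -
    have "?E X = (\<Sum>e\<in>?K. ?E (\<lambda>G. of_bool ({e} \<subseteq> edges G)))"
      unfolding X_def by (rule Bochner_Integration.integral_sum) (rule integrable_random_r_graph)
    also have "\<dots> = (\<Sum>e\<in>?K. \<rho>)"
      by (intro sum.cong refl) (subst expectation_of_bool_superset[OF \<rho>], auto)
    finally show ?thesis by (simp add: card_ksubsets)
  qed
  have "?E Y = (\<Sum>\<phi>\<in>copies_in ?F n ?K. ?E (\<lambda>G. of_bool ((`) \<phi> ` edges ?F \<subseteq> edges G)))"
    unfolding Y_def by (rule Bochner_Integration.integral_sum) (rule integrable_random_r_graph)
  also have "\<dots> = (\<Sum>\<phi>\<in>copies_in ?F n ?K. \<rho> ^ s)"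
  proof (rule sum.cong[OF refl])
    fix \<phi> assume \<phi>: "\<phi> \<in> copies_in ?F n ?K"
    then have "(`) \<phi> ` edges ?F \<subseteq> ?K" by (auto simp: copies_in_def homs_def)
    moreover have "card ((`) \<phi> ` edges ?F) = s"
      using copies_in_edges[OF expansion_edges_sub \<phi>] num_edges_expansion by simp
    ultimately show "?E (\<lambda>G. of_bool ((`) \<phi> ` edges ?F \<subseteq> edges G)) = \<rho> ^ s"
      using expectation_of_bool_superset[OF \<rho>] by simp
  qed
  also have "\<dots> \<le> real n ^ num_verts ?F * \<rho> ^ s"
    using copies_in_card_le[OF expansion_finite, of n ?K] \<rho> by (simp add: mult_right_mono)
  finally have "\<omega> * ?E Y \<le> \<omega> * (real n ^ num_verts ?F * \<rho> ^ s)" using \<omega> by (rule mult_left_mono)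
  then have "?b \<le> ?E X - \<omega> * ?E Y" by (simp add: EX)
  also have "\<dots> = ?E (\<lambda>G. X G - \<omega> * Y G)"
    using integrable_random_r_graph by (simp add: Bochner_Integration.integral_diff)
  finally have b: "?b \<le> ?E (\<lambda>G. X G - \<omega> * Y G)" .
  have "\<exists>G\<in>set_pmf ?M. ?b \<le> X G - \<omega> * Y G"
  proof (rule ccontr)
    assume "\<not> ?thesis"
    then have "AE G in measure_pmf ?M. X G - \<omega> * Y G < ?b" by (auto simp: AE_measure_pmf_iff)
    from measure_pmf.expectation_less[OF integrable_random_r_graph this] show False using b by linarith
  qed
  then obtain G where G: "G \<in> set_pmf ?M" "?b \<le> X G - \<omega> * Y G" by blast
  note G' = set_pmf_random_r_graph[OF G(1)]
  have "X G = real (card (edges G))"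
    using G'(2) by (simp add: X_def sum.If_cases of_bool_def Int_absorb1)
  moreover have "real (card (copies_in ?F n (edges G))) \<le> Y G"
  proof -
    have "copies_in ?F n (edges G) \<subseteq> {\<phi> \<in> copies_in ?F n ?K. (`) \<phi> ` edges ?F \<subseteq> edges G}"
    proof
      fix \<phi> assume "\<phi> \<in> copies_in ?F n (edges G)"
      then have h: "\<phi> \<in> verts ?F \<rightarrow>\<^sub>E {..<n}" "\<forall>e\<in>edges ?F. \<phi> ` e \<in> edges G" "inj_on \<phi> (verts ?F)"
        by (auto simp: copies_in_def homs_def)
      moreover from this have "\<forall>e\<in>edges ?F. \<phi> ` e \<in> ?K" using G'(2) by blast
      ultimately show "\<phi> \<in> {\<phi> \<in> copies_in ?F n ?K. (`) \<phi> ` edges ?F \<subseteq> edges G}"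
        by (simp add: copies_in_def homs_def image_subset_iff)
    qed
    then have "card (copies_in ?F n (edges G)) \<le> card {\<phi> \<in> copies_in ?F n ?K. (`) \<phi> ` edges ?F \<subseteq> edges G}"
      using finc by (intro card_mono) auto
    also have "real \<dots> = Y G" using finc by (simp add: Y_def sum.If_cases of_bool_def Int_def)
    finally show ?thesis by simp
  qed
  ultimately have "?b \<le> real (card (edges G)) - \<omega> * real (card (copies_in ?F n (edges G)))"
    using G(2) mult_left_mono[OF _ \<omega>] by fastforce
  then show ?thesis using G'(2) by blast
qed

text \<open>The factor ln n in the hypothesis makes the expected ratio of surviving copies to
  surviving edges at most 1 / ln n, hence o(1).\<close>

lemma aas_ex_number_ge_of_few_copies:
  fixes f :: "nat \<Rightarrow> real"
  assumes p: "\<And>n. 0 < p n \<and> p n \<le> 1" and f: "filterlim f at_top sequentially"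
    and ex: "\<forall>\<^sub>F n in sequentially. \<exists>H\<subseteq>complete_edges n r. f n \<le> p n * real (card H) \<and>
      p n ^ (s - 1) * ln n * real (card (copies_in (expansion r0 r F) n H)) \<le> real (card H)"
  shows "aas (\<lambda>n. random_r_graph r n (p n)) (\<lambda>n G. f n / 2 \<le> real (ex_number G (expansion r0 r F)))"
proof -
  let ?F = "expansion r0 r F"
  let ?K = "\<lambda>n. complete_edges n r"
  define P where "P n H \<longleftrightarrow> H \<subseteq> ?K n \<and> f n \<le> p n * real (card H) \<and>
     p n ^ (s - 1) * ln n * real (card (copies_in ?F n H)) \<le> real (card H)" for n H
  have "\<forall>\<^sub>F n in sequentially. \<exists>H. P n H" using ex by (rule eventually_mono) (auto simp: P_def)
  then have evS: "\<forall>\<^sub>F n in sequentially. P n (SOME H. P n H)" by (rule eventually_mono) (rule someI_ex)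
  define H where "H n = (SOME H. P n H)" for n
  have ev: "\<forall>\<^sub>F n in sequentially. P n (H n)" using evS by (simp only: H_def)
  have H: "\<forall>\<^sub>F n in sequentially. H n \<subseteq> ?K n"
    and Hl: "\<forall>\<^sub>F n in sequentially. f n \<le> p n * real (card (H n))"
    and Hc: "\<forall>\<^sub>F n in sequentially. p n ^ (s - 1) * ln n * real (card (copies_in ?F n (H n))) \<le> real (card (H n))"
    by (rule eventually_mono[OF ev], simp add: P_def)+
  have "aas (\<lambda>n. random_r_graph r n (p n))
    (\<lambda>n G. (1 - 2 * (1 / 4)) * (p n * real (card (H n))) \<le> real (ex_number G ?F))"
  proof (rule aas_ex_number_ge[OF expansion_finite expansion_edges_sub expansion_edges_nonempty p H])
    show "filterlim (\<lambda>n. p n * real (card (H n))) at_top sequentially"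
      using f Hl by (rule filterlim_at_top_mono)
    show "(\<lambda>n. real (card (copies_in ?F n (H n))) * p n ^ (num_edges ?F - 1) / real (card (H n))) \<longlonglongrightarrow> 0"
    proof (rule tendsto_sandwich[OF _ _ tendsto_const])
      show "(\<lambda>n. 1 / ln (real n)) \<longlonglongrightarrow> 0" by real_asymp
      show "\<forall>\<^sub>F n in sequentially. 0 \<le> real (card (copies_in ?F n (H n))) * p n ^ (num_edges ?F - 1) / real (card (H n))"
        using p by (auto intro!: always_eventually mult_nonneg_nonneg divide_nonneg_nonneg simp: less_imp_le)
      have "\<forall>\<^sub>F n in sequentially. 1 \<le> ln (real n)" by real_asymp
      then show "\<forall>\<^sub>F n in sequentially. real (card (copies_in ?F n (H n))) * p n ^ (num_edges ?F - 1) / real (card (H n)) \<le> 1 / ln (real n)"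
        using Hc
      proof eventually_elim
        case (elim n)
        show ?case
        proof (cases "card (H n) = 0")
          case True
          then show ?thesis using elim by simp
        next
          case False
          then show ?thesis using elim by (simp add: num_edges_expansion divide_simps mult_ac)
        qed
      qed
    qed
    show "(0::real) < 1 / 4" by simp
  qed
  then show ?thesis
  proof (rule aas_mono)
    show "\<forall>\<^sub>F n in sequentially. \<forall>G\<in>set_pmf (random_r_graph r n (p n)).
        (1 - 2 * (1 / 4)) * (p n * real (card (H n))) \<le> real (ex_number G ?F) \<longrightarrow> f n / 2 \<le> real (ex_number G ?F)"
      using Hl by (rule eventually_mono) auto
  qed
qed

text \<open>Above the critical probability p0 the complete \<open>r\<close>-graph has too many
  copies, so the host is thinned to a density \<rho> with p \<rho> = p0 / ln n, just below critical.
  About n powr e0 / ln n edges are left.\<close>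

lemma aas_deletion_bound:
  assumes r2: "2 \<le> r" and e0: "1 \<le> e0" and C: "2 \<le> C"
    and p: "\<And>n. 0 < p n \<and> p n \<le> 1" and thr: "(\<lambda>n. real n powr (e0 - real r)) \<lless> p"
  shows "aas (\<lambda>n. random_r_graph r n (p n))
    (\<lambda>n G. real n powr e0 * ln (real n) powr (- C) \<le> real (ex_number G (expansion r0 r F)))"
proof -
  let ?F = "expansion r0 r F"
  let ?K = "\<lambda>n. complete_edges n r"
  define p0 where "p0 n = real n powr (e0 - real r)" for n
  have lim: "filterlim (\<lambda>n. p n / p0 n) at_top sequentially"
    unfolding p0_def by (rule much_less_at_top[OF thr]) (use p in \<open>auto intro: eventually_mono[OF eventually_gt_at_top[of 0]]\<close>)
  have ev1: "\<forall>\<^sub>F n in sequentially. 1 \<le> p n / p0 n" using lim by (simp add: filterlim_at_top)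
  define A where "A = real r ^ r"
  have A: "0 < A" using r2 by (simp add: A_def)
  have ex: "\<forall>\<^sub>F n in sequentially. \<exists>H\<subseteq>?K n. real n powr e0 / (2 * A * ln n) \<le> p n * real (card H) \<and>
     p n ^ (s - 1) * ln n * real (card (copies_in ?F n H)) \<le> real (card H)"
  proof -
    have "\<forall>\<^sub>F n in sequentially. 2 * A \<le> ln (real n)" "\<forall>\<^sub>F n in sequentially. 1 \<le> ln (real n)" by real_asymp+
    then show ?thesis
      using ev1 eventually_ge_at_top[of r]
    proof eventually_elim
      case (elim n)
      define L where "L = ln (real n)"
      have L: "2 * A \<le> L" "1 \<le> L" using elim by (auto simp: L_def)
      have n: "r \<le> n" "0 < n" using elim(4) r2 by auto
      have p0: "0 < p0 n" using n by (simp add: p0_def)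
      have pp: "0 < p n" "p n \<le> 1" "p0 n \<le> p n" using p[of n] elim(3) p0 by (auto simp: le_divide_eq)
      define \<rho> where "\<rho> = p0 n / (p n * L)"
      have \<rho>: "0 < \<rho>" "\<rho> \<le> 1"
      proof -
        show "0 < \<rho>" using p0 pp L by (simp add: \<rho>_def)
        have "p0 n * 1 \<le> p n * L" using pp L p0 by (intro mult_mono) auto
        then show "\<rho> \<le> 1" using pp L by (simp add: \<rho>_def divide_le_eq)
      qed
      define \<omega> where "\<omega> = p n ^ (s - 1) * L"
      have \<omega>: "0 \<le> \<omega>" using pp L by (simp add: \<omega>_def)
      obtain H where H: "H \<subseteq> ?K n" and Hge: "\<rho> * real (n choose r) - \<omega> * (real n ^ num_verts ?F * \<rho> ^ s)
        \<le> real (card H) - \<omega> * real (card (copies_in ?F n H))"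
        using exists_sparse_hypergraph[OF less_imp_le[OF \<rho>(1)] \<rho>(2) \<omega>, of n] by blast
      have "\<omega> * (real n ^ num_verts ?F * \<rho> ^ s) \<le> \<rho> * (real n ^ r / L)"
      proof -
        have "\<rho> ^ s = \<rho> * \<rho> ^ (s - 1)" using s3 by (simp add: power_eq_if)
        moreover have "\<rho> ^ (s - 1) = p0 n ^ (s - 1) / (p n ^ (s - 1) * L ^ (s - 1))"
          by (simp add: \<rho>_def power_divide power_mult_distrib)
        ultimately have "\<omega> * (real n ^ num_verts ?F * \<rho> ^ s) = \<rho> * ((real n ^ num_verts ?F * p0 n ^ (s - 1)) * L / L ^ (s - 1))"
          using pp by (simp add: \<omega>_def)
        also have "real n ^ num_verts ?F * p0 n ^ (s - 1) = real n ^ r"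
          unfolding p0_def by (rule critical_probability[OF n(2)])
        \<comment> \<open>The thinning saves L ^ (s - 1) and \<omega> costs one factor L; since s
          \<ge> 3, at least one factor L remains.\<close>
        also have "real n ^ r * L / L ^ (s - 1) \<le> real n ^ r / L"
        proof -
          have "L ^ 2 \<le> L ^ (s - 1)" using L s3 by (intro power_increasing) auto
          then have "real n ^ r * L / L ^ (s - 1) \<le> real n ^ r * L / L ^ 2"
            using L by (intro divide_left_mono) auto
          also have "\<dots> = real n ^ r / L" using L by (simp add: power2_eq_square)
          finally show ?thesis .
        qed
        finally show ?thesis using \<rho> by (simp add: mult_left_mono)
      qed
      moreover have "real n ^ r / L \<le> real n ^ r / (2 * A)"
        using L A by (intro divide_left_mono) auto
      moreover have nr: "real n ^ r / A \<le> real (n choose r)"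
        unfolding A_def using n r2 by (intro choose_ge_power) auto
      ultimately have low: "\<rho> * (real n ^ r / (2 * A)) \<le> real (card H) - \<omega> * real (card (copies_in ?F n H))"
      proof -
        assume 1: "\<omega> * (real n ^ num_verts ?F * \<rho> ^ s) \<le> \<rho> * (real n ^ r / L)"
          and 2: "real n ^ r / L \<le> real n ^ r / (2 * A)" and 3: "real n ^ r / A \<le> real (n choose r)"
        have "\<rho> * (real n ^ r / L) \<le> \<rho> * (real n ^ r / (2 * A))" using 2 \<rho> by (intro mult_left_mono) auto
        moreover have "\<rho> * (real n ^ r / A) \<le> \<rho> * real (n choose r)" using 3 \<rho> by (intro mult_left_mono) auto
        moreover have "\<rho> * (real n ^ r / A) = 2 * (\<rho> * (real n ^ r / (2 * A)))" by simp
        ultimately show ?thesis using 1 Hge by linarith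
      qed
      have "0 \<le> \<rho> * (real n ^ r / (2 * A))" using \<rho> A by simp
      then have c1: "\<omega> * real (card (copies_in ?F n H)) \<le> real (card H)" using low by linarith
      have "\<rho> * (real n ^ r / (2 * A)) \<le> real (card H)" using low \<omega> by (smt (verit) mult_nonneg_nonneg of_nat_0_le_iff)
      then have "p n * (\<rho> * (real n ^ r / (2 * A))) \<le> p n * real (card H)" using pp by (intro mult_left_mono) auto
      moreover have "p n * (\<rho> * (real n ^ r / (2 * A))) = real n powr e0 / (2 * A * L)"
        using pp n by (simp add: \<rho>_def p0_def powr_diff powr_realpow)
      ultimately show ?case using H c1 by (intro exI[of _ H]) (auto simp: \<omega>_def L_def)
    qed
  qed
  have e00: "0 < e0" using e0 by simp
  have "filterlim (\<lambda>n. real n powr e0 / (2 * A * ln (real n))) at_top sequentially" using A e00 by real_asymp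
  from aas_ex_number_ge_of_few_copies[OF p this ex]
  have "aas (\<lambda>n. random_r_graph r n (p n)) (\<lambda>n G. real n powr e0 / (2 * A * ln (real n)) / 2 \<le> real (ex_number G ?F))" .
  then show ?thesis
  proof (rule aas_mono)
    have "\<forall>\<^sub>F n in sequentially. 4 * A \<le> ln (real n)" "\<forall>\<^sub>F n in sequentially. 1 \<le> ln (real n)" by real_asymp+
    then show "\<forall>\<^sub>F n in sequentially. \<forall>G\<in>set_pmf (random_r_graph r n (p n)).
        real n powr e0 / (2 * A * ln (real n)) / 2 \<le> real (ex_number G ?F) \<longrightarrow>
        real n powr e0 * ln (real n) powr (- C) \<le> real (ex_number G ?F)"
    proof eventually_elim
      case (elim n)
      \<comment> \<open>One logarithm comes from the thinning, a second one absorbs the constant;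
        hence the requirement C \<ge> 2.\<close>
      have "ln (real n) powr (- C) \<le> ln (real n) powr (- 2)" using elim C by (intro powr_mono) auto
      also have "\<dots> = 1 / (ln (real n) * ln (real n))"
        using elim by (simp add: powr_minus_divide power2_eq_square)
      also have "\<dots> \<le> 1 / (4 * A * ln (real n))"
        using elim A by (intro divide_left_mono mult_right_mono) (auto intro!: mult_pos_pos)
      finally have "real n powr e0 * ln (real n) powr (- C) \<le> real n powr e0 * (1 / (4 * A * ln (real n)))"
        by (intro mult_left_mono) auto
      also have "\<dots> = real n powr e0 / (2 * A * ln (real n)) / 2" by simp
      finally show ?case by auto
    qed
  qed
qed

text \<open>Below the critical probability the expected number of copies in the complete
  \<open>r\<close>-graph is already of smaller order than the number of edges, so deletion is
  asymptotically free. The upper bound is the number of all edges.\<close>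

lemma lower_range_holds:
  assumes r2: "2 \<le> r" and p: "\<And>n. 0 < p n \<and> p n \<le> 1"
  shows "lower_range r0 F r p"
  unfolding lower_range_def Let_def
proof (intro impI allI, elim conjE)
  fix \<epsilon> :: real
  assume thr1: "(\<lambda>n. real n powr - real r) \<lless> p"
    and thr: "p \<lless> (\<lambda>n. real n powr (- real r + real r0 - 1 / max_density r0 F))" and \<epsilon>: "0 < \<epsilon>"
  have eq: "- real r + real r0 - 1 / max_density r0 F = e0 - real r" using e0_eq by simp
  have thr2: "p \<lless> (\<lambda>n. real n powr (e0 - real r))" using thr unfolding eq .
  let ?F = "expansion r0 r F" and ?K = "\<lambda>n. complete_edges n r"
  define A where "A = real r ^ r"
  have A: "0 < A" using r2 by (simp add: A_def)
  have lim: "filterlim (\<lambda>n. p n / real n powr (- real r)) at_top sequentially"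
    by (rule much_less_at_top[OF thr1]) (use p in \<open>auto intro: eventually_mono[OF eventually_gt_at_top[of 0]]\<close>)
  have "filterlim (\<lambda>n. inverse A * (p n / real n powr (- real r))) at_top sequentially"
    by (rule filterlim_tendsto_pos_mult_at_top[OF tendsto_const _ lim]) (use A in auto)
  then have large: "filterlim (\<lambda>n. p n * real (n choose r)) at_top sequentially"
  proof (rule filterlim_at_top_mono)
    show "\<forall>\<^sub>F n in sequentially. inverse A * (p n / real n powr (- real r)) \<le> p n * real (n choose r)"
      using eventually_ge_at_top[of r]
    proof eventually_elim
      case (elim n)
      have "p n * (real n ^ r / A) \<le> p n * real (n choose r)"
        unfolding A_def using elim r2 p[of n] by (intro mult_left_mono choose_ge_power) auto
      moreover have "inverse A * (p n / real n powr (- real r)) = p n * (real n ^ r / A)"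
        using elim r2 by (simp add: powr_minus powr_realpow field_simps)
      ultimately show ?case by simp
    qed
  qed
  have lower: "aas (\<lambda>n. random_r_graph r n (p n))
    (\<lambda>n G. (1 - 2 * (\<epsilon> / 2)) * (p n * real (card (?K n))) \<le> real (ex_number G ?F))"
  proof (rule aas_ex_number_ge[OF expansion_finite expansion_edges_sub expansion_edges_nonempty p])
    show "filterlim (\<lambda>n. p n * real (card (?K n))) at_top sequentially" using large by (simp add: card_ksubsets)
    show "(\<lambda>n. real (card (copies_in ?F n (?K n))) * p n ^ (num_edges ?F - 1) / real (card (?K n))) \<longlonglongrightarrow> 0"
    proof (rule tendsto_sandwich[OF _ _ tendsto_const])
      have "(\<lambda>n. A * (p n / real n powr (e0 - real r)) ^ (s - 1)) \<longlonglongrightarrow> A * 0 ^ (s - 1)"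
        using thr2 by (intro tendsto_intros) (simp add: much_less_def)
      moreover have "A * 0 ^ (s - 1) = 0" using s3 by (simp add: zero_power)
      ultimately show "(\<lambda>n. A * (p n / real n powr (e0 - real r)) ^ (s - 1)) \<longlonglongrightarrow> 0" by (simp only:)
      show "\<forall>\<^sub>F n in sequentially. 0 \<le> real (card (copies_in ?F n (?K n))) * p n ^ (num_edges ?F - 1) / real (card (?K n))"
        using p by (auto intro!: always_eventually mult_nonneg_nonneg divide_nonneg_nonneg simp: less_imp_le)
      show "\<forall>\<^sub>F n in sequentially. real (card (copies_in ?F n (?K n))) * p n ^ (num_edges ?F - 1) / real (card (?K n))
          \<le> A * (p n / real n powr (e0 - real r)) ^ (s - 1)"
        using eventually_ge_at_top[of r]
      proof eventually_elim
        case (elim n)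
        then have n: "0 < n" using r2 by simp
        have "real (card (copies_in ?F n (?K n))) * p n ^ (s - 1) / real (n choose r) \<le>
            real n ^ num_verts ?F * p n ^ (s - 1) / (real n ^ r / A)"
          using copies_in_card_le[OF expansion_finite, of n "?K n"] p[of n] n A elim r2 choose_ge_power[of r n]
          by (intro frac_le mult_right_mono) (auto simp: A_def)
        also have "\<dots> = A * (p n / real n powr (e0 - real r)) ^ (s - 1)"
          unfolding critical_probability[OF n, symmetric] using n by (simp add: power_divide)
        finally show ?case by (simp add: num_edges_expansion card_ksubsets)
      qed
    qed
  qed (use \<epsilon> in auto)
  have upper: "aas (\<lambda>n. random_r_graph r n (p n))
    (\<lambda>n G. \<bar>real (card (edges G \<inter> ?K n)) - p n * real (n choose r)\<bar> < \<epsilon> * (p n * real (n choose r)))"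
  proof (rule aasI)
    have "(\<lambda>n. inverse (\<epsilon>\<^sup>2) * inverse (p n * real (n choose r))) \<longlonglongrightarrow> inverse (\<epsilon>\<^sup>2) * 0"
      by (intro tendsto_intros tendsto_inverse_0_at_top large)
    then show "(\<lambda>n. inverse (\<epsilon>\<^sup>2) * inverse (p n * real (n choose r))) \<longlonglongrightarrow> 0" by simp
    have "\<forall>\<^sub>F n in sequentially. 0 < p n * real (n choose r)" using large by (auto simp: filterlim_at_top_dense)
    then show "\<forall>\<^sub>F n in sequentially. 1 - inverse (\<epsilon>\<^sup>2) * inverse (p n * real (n choose r)) \<le>
      measure_pmf.prob (random_r_graph r n (p n))
        {G. \<bar>real (card (edges G \<inter> ?K n)) - p n * real (n choose r)\<bar> < \<epsilon> * (p n * real (n choose r))}"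
    proof eventually_elim
      case (elim n)
      let ?\<mu> = "p n * real (n choose r)" and ?M = "random_r_graph r n (p n)"
      let ?B = "{G. \<epsilon> * ?\<mu> \<le> \<bar>real (card (edges G \<inter> ?K n)) - ?\<mu>\<bar>}"
      have "measure_pmf.prob ?M ?B \<le> ?\<mu> / (\<epsilon> * ?\<mu>)\<^sup>2"
        using prob_card_edges_deviation[of "p n" "?K n" n r "\<epsilon> * ?\<mu>"] p[of n] \<epsilon> elim by (simp add: card_ksubsets)
      also have "\<dots> = inverse (\<epsilon>\<^sup>2) * inverse ?\<mu>" using elim \<epsilon> by (simp add: power2_eq_square divide_simps)
      finally have B: "measure_pmf.prob ?M ?B \<le> inverse (\<epsilon>\<^sup>2) * inverse ?\<mu>" .
      have "1 - measure_pmf.prob ?M ?B - measure_pmf.prob ?M {} \<le>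
         measure_pmf.prob ?M {G. \<bar>real (card (edges G \<inter> ?K n)) - ?\<mu>\<bar> < \<epsilon> * ?\<mu>}"
        by (rule prob_ge_1_minus) auto
      then show ?case using B by simp
    qed
  qed
  show "aas (\<lambda>n. random_r_graph r n (p n))
      (\<lambda>n G. \<bar>real (ex_number G ?F) - p n * real (n choose r)\<bar> \<le> \<epsilon> * (p n * real (n choose r)))"
  proof (rule aas_mono[OF aas_conj[OF lower upper]], rule always_eventually, intro allI ballI impI)
    fix n G assume G: "G \<in> set_pmf (random_r_graph r n (p n))"
      and h: "(1 - 2 * (\<epsilon> / 2)) * (p n * real (card (?K n))) \<le> real (ex_number G ?F) \<and>
        \<bar>real (card (edges G \<inter> ?K n)) - p n * real (n choose r)\<bar> < \<epsilon> * (p n * real (n choose r))"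
    note G' = set_pmf_random_r_graph[OF G]
    have "finite (edges G)" using G'(2) by (rule finite_subset) simp
    then have "ex_number G ?F \<le> num_edges G" by (rule ex_number_le[OF _ expansion_edges_nonempty])
    moreover have "edges G \<inter> ?K n = edges G" using G'(2) by blast
    ultimately have "real (ex_number G ?F) \<le> real (card (edges G \<inter> ?K n))" by simp
    then show "\<bar>real (ex_number G ?F) - p n * real (n choose r)\<bar> \<le> \<epsilon> * (p n * real (n choose r))"
      using h unfolding card_ksubsets by (simp add: abs_le_iff abs_less_iff algebra_simps)
  qed
qed

text \<open>With m = n powr e0 and L = ln n there are at most exp (m L^(2 s + 4)) containers, and
  the union bound gains exp (- m L^(2 s + 5)). The surplus factor L in the exponent leaves a failure
  probability of at most 1 / n. The other condition on \<open>C\<close> is the hypothesis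
  \<open>small\<close> of \<open>prob_ex_number_gt\<close>.\<close>

lemma aas_upper_bound:
  assumes sid: "sidorenko r0 F" and rl: "nblocks * r0 < r" and r0: "2 \<le> r0" and e0: "1 \<le> e0"
    and C: "exp 2 * container_size r \<le> C" "real (2 * s + 5) \<le> C"
    and p: "\<And>n. 0 < p n \<and> p n \<le> 1"
  shows "aas (\<lambda>n. random_r_graph r n (p n))
    (\<lambda>n G. real (ex_number G (expansion r0 r F)) \<le>
       max (C * p n * real n ^ (r - 1)) (real n powr e0 * ln (real n) powr C))"
proof (rule aasI)
  let ?F = "expansion r0 r F" and ?K = "\<lambda>n. complete_edges n r"
  let ?m = "\<lambda>n. max (C * p n * real n ^ (r - 1)) (real n powr e0 * ln (real n) powr C)"
  show "(\<lambda>n. 1 / real n) \<longlonglongrightarrow> 0" by real_asymp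
  have e00: "0 \<le> e0" using e0 by simp
  have "\<forall>\<^sub>F n in sequentially. 2 \<le> ln (real n)" by real_asymp
  then show "\<forall>\<^sub>F n in sequentially. 1 - 1 / real n \<le>
     measure_pmf.prob (random_r_graph r n (p n)) {G. real (ex_number G ?F) \<le> ?m n}"
    using expansion_containers[OF sid rl r0 e00] eventually_ge_at_top[of 1]
  proof eventually_elim
    case (elim n)
    define L where "L = ln (real n)"
    have L: "2 \<le> L" using elim by (simp add: L_def)
    have n: "1 \<le> real n" using elim by simp
    obtain \<C> where \<C>: "finite \<C>" "real (card \<C>) \<le> exp (real n powr e0 * L ^ (2 * s + 4))"
      "\<forall>C\<in>\<C>. C \<subseteq> ?K n \<and> real (card C) \<le> container_size r * real n ^ (r - 1)"
      "\<forall>I\<subseteq>?K n. \<not> contains_copy \<lparr>verts = {..<n}, edges = I\<rparr> ?F \<longrightarrow> (\<exists>C\<in>\<C>. I \<subseteq> C)"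
      using elim(2) unfolding L_def by blast
    have nn: "real n \<le> real n powr e0" using n e0 powr_mono[of 1 e0 "real n"] by simp
    have m1: "real n powr e0 * L powr C \<le> ?m n" by (simp add: L_def)
    have "L ^ (2 * s + 5) = L powr real (2 * s + 5)" using L by (simp add: powr_realpow del: of_nat_add)
    also have "\<dots> \<le> L powr C" using L C by (intro powr_mono) auto
    finally have LC: "L ^ (2 * s + 5) \<le> L powr C" .
    have mpos: "0 < ?m n" using L n by (intro less_le_trans[OF _ m1]) auto
    have sz0: "0 \<le> container_size r" by (simp add: container_size_def)
    have "measure_pmf.prob (random_r_graph r n (p n)) {G. ?m n < real (ex_number G ?F)} \<le> real (card \<C>) * exp (- ?m n)"
    proof (rule prob_ex_number_gt[OF expansion_edges_nonempty expansion_verts_covered _ _ mpos _ \<C>(1)])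
      show "exp 2 * (container_size r * real n ^ (r - 1) * p n) \<le> ?m n"
      proof -
        have "exp 2 * (container_size r * real n ^ (r - 1) * p n) = (exp 2 * container_size r) * (p n * real n ^ (r - 1))" by simp
        also have "\<dots> \<le> C * (p n * real n ^ (r - 1))" using C p[of n] by (intro mult_right_mono) auto
        finally show ?thesis by simp
      qed
    qed (use p[of n] \<C> sz0 in auto)
    also have "\<dots> \<le> exp (real n powr e0 * L ^ (2 * s + 4)) * exp (- (real n powr e0 * L ^ (2 * s + 5)))"
    proof (intro mult_mono)
      have "real n powr e0 * L ^ (2 * s + 5) \<le> real n powr e0 * L powr C" using LC by (intro mult_left_mono) auto
      then show "exp (- ?m n) \<le> exp (- (real n powr e0 * L ^ (2 * s + 5)))" using m1 by simp
    qed (use \<C> in auto)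
    also have "\<dots> = exp (- (real n powr e0 * (L ^ (2 * s + 5) - L ^ (2 * s + 4))))"
      by (simp add: exp_add[symmetric] algebra_simps)
    also have "\<dots> \<le> exp (- L)"
    proof -
      have "L ^ (2 * s + 5) = L * L ^ (2 * s + 4)" by (simp add: numeral_eq_Suc)
      then have "L ^ (2 * s + 5) - L ^ (2 * s + 4) = (L - 1) * L ^ (2 * s + 4)" by (simp add: algebra_simps)
      also have "\<dots> \<ge> 1 * L ^ (2 * s + 4)" using L by (intro mult_right_mono) auto
      also have "1 * L ^ (2 * s + 4) \<ge> L ^ 1" using L power_increasing[of 1 "2 * s + 4" L] by simp
      finally have "L \<le> L ^ (2 * s + 5) - L ^ (2 * s + 4)" by simp
      then have "1 * L \<le> real n powr e0 * (L ^ (2 * s + 5) - L ^ (2 * s + 4))"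
        using nn n L by (intro mult_mono) auto
      then show ?thesis by simp
    qed
    also have "\<dots> = 1 / real n" using n by (simp add: L_def exp_minus divide_inverse)
    finally have P: "measure_pmf.prob (random_r_graph r n (p n)) {G. ?m n < real (ex_number G ?F)} \<le> 1 / real n" .
    have "1 - measure_pmf.prob (random_r_graph r n (p n)) {G. ?m n < real (ex_number G ?F)} -
        measure_pmf.prob (random_r_graph r n (p n)) {} \<le>
        measure_pmf.prob (random_r_graph r n (p n)) {G. real (ex_number G ?F) \<le> ?m n}"
      by (rule prob_ge_1_minus) auto
    then show ?case using P by simp
  qed
qed

end

theorem sidorenko_imp_turan_assertion:
  assumes sid: "sidorenko r0 F" and deg: "2 \<le> max_degree F" "max_degree F < s"
    and r: "s ^ 2 * v * r0 < r"
  shows "turan_assertion r0 F r"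
proof -
  have rl: "nblocks * r0 < r" using r by (simp add: nblocks_def)
  have r0: "2 \<le> r0" and e0: "1 \<le> e0" using e0_gt_1[OF deg(1)] by auto
  have "1 * r0 \<le> nblocks * r0" using nblocks_pos by (intro mult_le_mono1) simp
  then have rr: "r0 \<le> r" "2 \<le> r" using rl r0 by linarith+
  define c where "c = 1 / (2 * (2 * real r) ^ (r - 1))"
  define C where "C = max (exp 2 * container_size r) (real (2 * s + 5))"
  have C: "exp 2 * container_size r \<le> C" "real (2 * s + 5) \<le> C" by (auto simp: C_def)
  have C2: "2 \<le> C" using C(2) by simp
  have "upper_range r0 F r c C p \<and> lower_range r0 F r p" if p: "\<forall>n. 0 < p n \<and> p n \<le> 1" for p
  proof
    show "lower_range r0 F r p" using lower_range_holds[OF rr] p by blast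
    have eq: "- real r + real r0 - 1 / max_density r0 F = e0 - real r" using e0_eq by simp
    show "upper_range r0 F r c C p"
      unfolding upper_range_def Let_def eq e0_eq
    proof
      assume thr: "(\<lambda>n. real n powr (e0 - real r)) \<lless> p"
      have p': "\<And>n. 0 < p n \<and> p n \<le> 1" using p by blast
      have star: "aas (\<lambda>n. random_r_graph r n (p n))
          (\<lambda>n G. c * p n * real n ^ (r - 1) \<le> real (ex_number G (expansion r0 r F)))"
        unfolding c_def by (rule aas_star_bound[OF rr(1) deg(2) rr(2) e0 p' thr])
      show "aas (\<lambda>n. random_r_graph r n (p n))
        (\<lambda>n G. max (c * p n * real n ^ (r - 1)) (real n powr e0 * ln (real n) powr - C)
             \<le> real (ex_number G (expansion r0 r F)) \<and>
           real (ex_number G (expansion r0 r F))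
             \<le> max (C * p n * real n ^ (r - 1)) (real n powr e0 * ln (real n) powr C))"
        by (rule aas_mono[OF aas_conj[OF aas_conj[OF star aas_deletion_bound[OF rr e0 C2 p' thr]]
              aas_upper_bound[OF rr(1) sid rl r0 e0 C p']]])
          (auto intro: always_eventually)
    qed
  qed
  moreover have "0 < c" using rr by (simp add: c_def)
  ultimately show ?thesis unfolding turan_assertion_def using C2 by (intro exI[of _ c] conjI exI[of _ C]) auto
qed

end

section \<open>Non-Sidorenko expansions\<close>

text \<open>A map is determined by its composite with \<open>\<phi>\<close> and its values off the
  image of \<open>\<phi>\<close>. The condition concerns the composite alone, which can be any
  homomorphism because \<open>\<phi>\<close> is injective.\<close>

lemma card_maps_composing_to_homs:
  fixes \<phi> :: "'b \<Rightarrow> nat"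
  assumes F: "finite (verts F)" "\<And>e. e \<in> edges F \<Longrightarrow> e \<subseteq> verts F" and W: "finite (verts H)"
    and \<phi>: "inj_on \<phi> (verts F)" "\<phi> ` verts F \<subseteq> {..<n}"
  shows "card {\<theta> \<in> {..<n} \<rightarrow>\<^sub>E verts H. \<forall>e\<in>edges F. \<theta> ` \<phi> ` e \<in> edges H} =
    card (homs F H) * card (verts H) ^ (n - num_verts F)"
proof -
  let ?V = "verts F" and ?W = "verts H"
  let ?R = "{..<n} - \<phi> ` ?V"
  let ?X = "{\<theta> \<in> {..<n} \<rightarrow>\<^sub>E ?W. \<forall>e\<in>edges F. \<theta> ` \<phi> ` e \<in> edges H}"
  let ?Y = "homs F H \<times> (?R \<rightarrow>\<^sub>E ?W)"
  let ?f = "\<lambda>\<theta>. (restrict (\<theta> \<circ> \<phi>) ?V, restrict \<theta> ?R)"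
  let ?g = "\<lambda>(\<psi>, \<rho>). restrict (\<lambda>x. if x \<in> \<phi> ` ?V then \<psi> (inv_into ?V \<phi> x) else \<rho> x) {..<n}"
  have inv: "inv_into ?V \<phi> (\<phi> x) = x" if "x \<in> ?V" for x using \<phi>(1) that by simp
  have "bij_betw ?f ?X ?Y"
  proof (rule bij_betwI[where g = ?g])
    show "?f \<in> ?X \<rightarrow> ?Y"
    proof
      fix \<theta> assume \<theta>: "\<theta> \<in> ?X"
      have "restrict (\<theta> \<circ> \<phi>) ?V ` e = \<theta> ` \<phi> ` e" if "e \<in> edges F" for e
        unfolding image_image by (rule image_cong) (use F(2)[OF that] in auto)
      then have ed: "\<forall>e\<in>edges F. restrict (\<theta> \<circ> \<phi>) ?V ` e \<in> edges H" using \<theta> by simp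
      have "\<theta> (\<phi> x) \<in> ?W" if "x \<in> ?V" for x
        by (rule PiE_mem[of \<theta> "{..<n}" "\<lambda>_. ?W"]) (use \<theta> \<phi>(2) that in auto)
      then have "restrict (\<theta> \<circ> \<phi>) ?V \<in> ?V \<rightarrow>\<^sub>E ?W" by auto
      then have "restrict (\<theta> \<circ> \<phi>) ?V \<in> homs F H" unfolding homs_def using ed by blast
      moreover have "restrict \<theta> ?R \<in> ?R \<rightarrow>\<^sub>E ?W" using \<theta> by auto
      ultimately show "?f \<theta> \<in> ?Y" by simp
    qed
    show "?g \<in> ?Y \<rightarrow> ?X"
    proof
      fix y assume y: "y \<in> ?Y"
      obtain \<psi> \<rho> where yy: "y = (\<psi>, \<rho>)" by (metis surj_pair)
      have \<psi>: "\<psi> \<in> ?V \<rightarrow>\<^sub>E ?W" "\<forall>e\<in>edges F. \<psi> ` e \<in> edges H" and \<rho>: "\<rho> \<in> ?R \<rightarrow>\<^sub>E ?W"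
        using y yy by (auto simp: homs_def)
      have "?g y \<in> {..<n} \<rightarrow>\<^sub>E ?W"
      proof (rule PiE_I)
        fix x assume x: "x \<in> {..<n}"
        show "?g y x \<in> ?W"
        proof (cases "x \<in> \<phi> ` ?V")
          case True
          then have "inv_into ?V \<phi> x \<in> ?V" by (rule inv_into_into)
          then show ?thesis using True x yy \<psi>(1) by auto
        next
          case False
          then show ?thesis using x yy \<rho> by auto
        qed
      next
        fix x assume "x \<notin> {..<n}"
        then show "?g y x = undefined" using yy by simp
      qed
      moreover have "?g y ` \<phi> ` e \<in> edges H" if e: "e \<in> edges F" for e
      proof -
        have "?g y ` \<phi> ` e = \<psi> ` e"
          unfolding image_image
        proof (rule image_cong[OF refl])
          fix x assume "x \<in> e"
          then have "x \<in> ?V" using F(2)[OF e] by blast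
          then show "?g y (\<phi> x) = \<psi> x" using yy inv \<phi>(2) by auto
        qed
        then show ?thesis using \<psi>(2) e by simp
      qed
      ultimately show "?g y \<in> ?X" by simp
    qed
    fix \<theta> assume \<theta>: "\<theta> \<in> ?X"
    then have ext: "\<theta> \<in> {..<n} \<rightarrow>\<^sub>E ?W" by simp
    show "?g (?f \<theta>) = \<theta>"
    proof
      fix x
      show "?g (?f \<theta>) x = \<theta> x"
      proof (cases "x \<in> {..<n}")
        case True
        then show ?thesis by (auto simp: inv f_inv_into_f inv_into_into)
      next
        case False
        then show ?thesis using ext by (simp add: PiE_arb[OF ext])
      qed
    qed
  next
    fix y assume y: "y \<in> ?Y"
    obtain \<psi> \<rho> where yy: "y = (\<psi>, \<rho>)" by (metis surj_pair)
    have \<psi>: "\<psi> \<in> ?V \<rightarrow>\<^sub>E ?W" and \<rho>: "\<rho> \<in> ?R \<rightarrow>\<^sub>E ?W" using y yy by (auto simp: homs_def)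
    have "restrict (?g y \<circ> \<phi>) ?V x = \<psi> x" for x
      using inv \<phi>(2) PiE_arb[OF \<psi>] yy by (cases "x \<in> ?V") auto
    moreover have "restrict (?g y) ?R x = \<rho> x" for x
      using PiE_arb[OF \<rho>] yy by (cases "x \<in> ?R") auto
    ultimately show "?f (?g y) = y" using yy by auto
  qed
  then have "card ?X = card ?Y" by (rule bij_betw_same_card)
  also have "\<dots> = card (homs F H) * card ?W ^ card ?R" using W by (simp add: card_cartesian_product card_funcsetE)
  also have "card ?R = n - num_verts F" using \<phi> by (simp add: card_Diff_subset card_image F)
  finally show ?thesis .
qed

text \<open>For a uniformly random map, the probability that a fixed embedded copy of
  \<open>F\<close> is sent into \<open>H\<close> is exactly the homomorphism density, whatever the
  embedding.\<close>

lemma hom_density_count: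
  fixes \<phi> :: "'b \<Rightarrow> nat"
  assumes F: "finite (verts F)" "\<And>e. e \<in> edges F \<Longrightarrow> e \<subseteq> verts F" and W: "finite (verts H)" "verts H \<noteq> {}"
    and \<phi>: "inj_on \<phi> (verts F)" "\<phi> ` verts F \<subseteq> {..<n}"
  shows "real (card {\<theta> \<in> {..<n} \<rightarrow>\<^sub>E verts H. \<forall>e\<in>edges F. \<theta> ` \<phi> ` e \<in> edges H}) =
    hom_density F H * real (card (verts H)) ^ n"
proof -
  have h: "0 < real (card (verts H))" using W by (simp add: card_gt_0_iff)
  have "num_verts F = card (\<phi> ` verts F)" using \<phi>(1) by (simp add: card_image)
  also have "\<dots> \<le> n" using card_mono[OF _ \<phi>(2)] by simp
  finally have "real (card (verts H)) ^ n = real (card (verts H)) ^ num_verts F * real (card (verts H)) ^ (n - num_verts F)"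
    by (simp flip: power_add)
  then show ?thesis
    using h arg_cong[OF card_maps_composing_to_homs[OF F W(1) \<phi>], of real] by (simp add: hom_density_def)
qed

text \<open>The edges \<open>e\<close> that every one of \<open>l\<close> random maps \<open>t i\<close> into \<open>H0\<close> sends to an edge of \<open>H0\<close>: this plays
  the role of a random homomorphic preimage of the \<open>l\<close>-th tensor power of \<open>H0\<close>.\<close>

lemma exists_preimage_hypergraph:
  fixes H0 :: "nat hypergraph" and F :: "'b hypergraph"
  assumes H0: "finite (verts H0)" "verts H0 \<noteq> {}"
    and F: "finite (verts F)" "\<And>e. e \<in> edges F \<Longrightarrow> e \<subseteq> verts F"
    and \<omega>: "0 \<le> \<omega>"
  shows "\<exists>H\<subseteq>complete_edges n r.
    real (n choose r) * hom_density (single_edge r) H0 ^ l - \<omega> * (real n ^ num_verts F * hom_density F H0 ^ l)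
      \<le> real (card H) - \<omega> * real (card (copies_in F n H))"
proof -
  let ?K = "complete_edges n r"
  let ?\<alpha> = "hom_density (single_edge r) H0" and ?T = "hom_density F H0"
  let ?\<X> = "{..<n} \<rightarrow>\<^sub>E verts H0"
  let ?\<T> = "{..<l} \<rightarrow>\<^sub>E ?\<X>"
  define h where "h = real (card (verts H0))"
  have h: "0 < h" using H0 by (simp add: h_def card_gt_0_iff)
  have fin\<X>: "finite ?\<X>" using H0 by (auto intro!: finite_PiE)
  have fin\<T>: "finite ?\<T>" using fin\<X> by (auto intro!: finite_PiE)
  have c\<T>: "real (card ?\<T>) = (h ^ n) ^ l" using H0 by (simp add: card_funcsetE h_def)
  define pre where "pre t = {e \<in> ?K. \<forall>i<l. t i ` e \<in> edges H0}" for t :: "nat \<Rightarrow> nat \<Rightarrow> nat"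
  \<comment> \<open>The coordinates of a tuple are independent, so \<open>l\<close> maps raise a
    proportion to its l-th power.\<close>
  have tuples: "real (card {t \<in> ?\<T>. \<forall>i<l. Q (t i)}) = real (card {\<theta> \<in> ?\<X>. Q \<theta>}) ^ l" for Q :: "(nat \<Rightarrow> nat) \<Rightarrow> bool"
  proof -
    have "{t \<in> ?\<T>. \<forall>i<l. Q (t i)} = ({..<l} \<rightarrow>\<^sub>E {\<theta> \<in> ?\<X>. Q \<theta>})"
      by (auto simp: PiE_iff extensional_def)
    then show ?thesis by (simp add: card_funcsetE)
  qed
  have finK: "finite ?K" by simp
  have edges: "(\<Sum>t\<in>?\<T>. real (card (pre t))) = real (n choose r) * (?\<alpha> * h ^ n) ^ l"
  proof -
    have "(\<Sum>t\<in>?\<T>. real (card (pre t))) = (\<Sum>t\<in>?\<T>. \<Sum>e\<in>?K. if \<forall>i<l. t i ` e \<in> edges H0 then 1 else 0)"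
      unfolding pre_def using finK by (intro sum.cong refl) (simp add: sum.If_cases Int_def)
    also have "\<dots> = (\<Sum>e\<in>?K. \<Sum>t\<in>?\<T>. if \<forall>i<l. t i ` e \<in> edges H0 then 1 else 0)" by (rule sum.swap)
    also have "\<dots> = (\<Sum>e\<in>?K. real (card {t \<in> ?\<T>. \<forall>i<l. t i ` e \<in> edges H0}))"
      using fin\<T> by (intro sum.cong refl) (simp add: sum.If_cases Int_def)
    also have "\<dots> = (\<Sum>e\<in>?K. (?\<alpha> * h ^ n) ^ l)"
    proof (rule sum.cong[OF refl])
      fix e assume e: "e \<in> ?K"
      then have "finite e" using finite_subset[of e "{..<n}"] by simp
      then obtain \<phi> where \<phi>: "bij_betw \<phi> {0..<r} e" using ex_bij_betw_nat_finite[of e] e by auto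
      then have \<phi>': "inj_on \<phi> {..<r}" "\<phi> ` {..<r} = e" by (auto simp: bij_betw_def atLeast0LessThan)
      have "real (card {\<theta> \<in> ?\<X>. \<forall>e\<in>edges (single_edge r). \<theta> ` \<phi> ` e \<in> edges H0}) = ?\<alpha> * h ^ n"
        unfolding h_def by (rule hom_density_count[OF _ _ H0]) (use \<phi>' e in \<open>auto simp: single_edge_def\<close>)
      then have "real (card {\<theta> \<in> ?\<X>. \<theta> ` e \<in> edges H0}) = ?\<alpha> * h ^ n"
        by (simp add: single_edge_def \<phi>'(2))
      then show "real (card {t \<in> ?\<T>. \<forall>i<l. t i ` e \<in> edges H0}) = (?\<alpha> * h ^ n) ^ l"
        using tuples[of "\<lambda>\<theta>. \<theta> ` e \<in> edges H0"] by simp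
    qed
    finally show ?thesis by (simp add: card_ksubsets)
  qed
  let ?I = "{\<phi> \<in> verts F \<rightarrow>\<^sub>E {..<n}. inj_on \<phi> (verts F)}"
  have finI: "finite ?I" using F(1) finite_PiE[of "verts F" "\<lambda>_. {..<n}"] by simp
  have T0: "0 \<le> ?T" by (simp add: hom_density_def)
  have copies: "(\<Sum>t\<in>?\<T>. real (card (copies_in F n (pre t)))) \<le> real n ^ num_verts F * (?T * h ^ n) ^ l"
  proof -
    have "(\<Sum>t\<in>?\<T>. real (card (copies_in F n (pre t)))) \<le>
        (\<Sum>t\<in>?\<T>. \<Sum>\<phi>\<in>?I. if \<forall>i<l. \<forall>e\<in>edges F. t i ` \<phi> ` e \<in> edges H0 then 1 else 0)"
    proof (rule sum_mono)
      fix t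
      have "copies_in F n (pre t) \<subseteq> {\<phi> \<in> ?I. \<forall>i<l. \<forall>e\<in>edges F. t i ` \<phi> ` e \<in> edges H0}"
        by (auto simp: copies_in_def homs_def pre_def)
      moreover have "finite {\<phi> \<in> ?I. \<forall>i<l. \<forall>e\<in>edges F. t i ` \<phi> ` e \<in> edges H0}"
        using finI by (rule rev_finite_subset) auto
      ultimately have "card (copies_in F n (pre t)) \<le> card {\<phi> \<in> ?I. \<forall>i<l. \<forall>e\<in>edges F. t i ` \<phi> ` e \<in> edges H0}"
        by (rule card_mono[rotated])
      then show "real (card (copies_in F n (pre t))) \<le> (\<Sum>\<phi>\<in>?I. if \<forall>i<l. \<forall>e\<in>edges F. t i ` \<phi> ` e \<in> edges H0 then 1 else 0)"
        using finI by (simp add: sum.If_cases Int_def)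
    qed
    also have "\<dots> = (\<Sum>\<phi>\<in>?I. \<Sum>t\<in>?\<T>. if \<forall>i<l. \<forall>e\<in>edges F. t i ` \<phi> ` e \<in> edges H0 then 1 else 0)" by (rule sum.swap)
    also have "\<dots> = (\<Sum>\<phi>\<in>?I. real (card {t \<in> ?\<T>. \<forall>i<l. \<forall>e\<in>edges F. t i ` \<phi> ` e \<in> edges H0}))"
      using fin\<T> by (intro sum.cong refl) (simp add: sum.If_cases Int_def)
    also have "\<dots> = (\<Sum>\<phi>\<in>?I. (?T * h ^ n) ^ l)"
    proof (rule sum.cong[OF refl])
      fix \<phi> assume \<phi>: "\<phi> \<in> ?I"
      have "real (card {\<theta> \<in> ?\<X>. \<forall>e\<in>edges F. \<theta> ` \<phi> ` e \<in> edges H0}) = ?T * h ^ n"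
        unfolding h_def by (rule hom_density_count[OF F H0]) (use \<phi> in auto)
      then show "real (card {t \<in> ?\<T>. \<forall>i<l. \<forall>e\<in>edges F. t i ` \<phi> ` e \<in> edges H0}) = (?T * h ^ n) ^ l"
        using tuples[of "\<lambda>\<theta>. \<forall>e\<in>edges F. \<theta> ` \<phi> ` e \<in> edges H0"] by simp
    qed
    also have "\<dots> = real (card ?I) * (?T * h ^ n) ^ l" by simp
    also have "\<dots> \<le> real n ^ num_verts F * (?T * h ^ n) ^ l"
    proof (rule mult_right_mono)
      have "card ?I \<le> card (verts F \<rightarrow>\<^sub>E {..<n})" using F(1) by (intro card_mono finite_PiE) auto
      also have "\<dots> = n ^ num_verts F" using F(1) by (simp add: card_funcsetE)
      finally show "real (card ?I) \<le> real n ^ num_verts F" by (metis of_nat_mono of_nat_power)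
    qed (use T0 h in simp)
    finally show ?thesis .
  qed
  let ?b = "real (n choose r) * ?\<alpha> ^ l - \<omega> * (real n ^ num_verts F * ?T ^ l)"
  have "\<exists>t\<in>?\<T>. ?b \<le> real (card (pre t)) - \<omega> * real (card (copies_in F n (pre t)))"
  proof (rule ccontr)
    assume neg: "\<not> ?thesis"
    have "?\<T> \<noteq> {}" using c\<T> h by fastforce
    then have "(\<Sum>t\<in>?\<T>. real (card (pre t)) - \<omega> * real (card (copies_in F n (pre t)))) < (\<Sum>t\<in>?\<T>. ?b)"
      using neg fin\<T> by (intro sum_strict_mono) auto
    also have "\<dots> = (h ^ n) ^ l * ?b" using c\<T> by simp
    also have "\<dots> = real (n choose r) * (?\<alpha> * h ^ n) ^ l - \<omega> * (real n ^ num_verts F * (?T * h ^ n) ^ l)"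
      by (simp add: power_mult_distrib algebra_simps)
    also have "\<dots> \<le> (\<Sum>t\<in>?\<T>. real (card (pre t))) - \<omega> * (\<Sum>t\<in>?\<T>. real (card (copies_in F n (pre t))))"
      using edges mult_left_mono[OF copies \<omega>] by linarith
    also have "\<dots> = (\<Sum>t\<in>?\<T>. real (card (pre t)) - \<omega> * real (card (copies_in F n (pre t))))"
      by (simp add: sum_subtractf sum_distrib_left)
    finally show False by simp
  qed
  then obtain t where "?b \<le> real (card (pre t)) - \<omega> * real (card (copies_in F n (pre t)))" by blast
  moreover have "pre t \<subseteq> ?K" by (auto simp: pre_def)
  ultimately show ?thesis by blast
qed

section \<open>Choice of exponents for a witness against the Sidorenko property\<close>

lemma hom_density_single_edge_le_1:
  assumes "finite (verts H)"
  shows "hom_density (single_edge r) H \<le> 1"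
proof -
  have "card (homs (single_edge r) H) \<le> card ({..<r} \<rightarrow>\<^sub>E verts H)"
    using assms by (intro card_mono finite_PiE) (auto simp: homs_def single_edge_def)
  also have "\<dots> = card (verts H) ^ r" by (simp add: card_funcsetE)
  finally have "real (card (homs (single_edge r) H)) \<le> real (card (verts H)) ^ r" by (metis of_nat_mono of_nat_power)
  moreover have "x / y \<le> 1" if "x \<le> y" "0 \<le> y" for x y :: real using that by (cases "y = 0") auto
  ultimately show ?thesis unfolding hom_density_def by (simp add: single_edge_def)
qed

text \<open>Logarithmically many factors turn a constant \<open>x\<close> into a power of n;
  rounding the number of factors down costs at most 1 / x.\<close>

lemma power_floor_ln_bounds:
  fixes x a :: real
  assumes x: "0 < x" "x \<le> 1" and a: "0 \<le> a" and n: "1 \<le> n"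
  defines "l \<equiv> nat \<lfloor>a * ln (real n)\<rfloor>"
  shows "real n powr (a * ln x) \<le> x ^ l" "x ^ l \<le> real n powr (a * ln x) / x"
proof -
  have al: "0 \<le> a * ln (real n)" using a n by simp
  have l: "real l \<le> a * ln (real n)" "a * ln (real n) - 1 \<le> real l"
    using al unfolding l_def by linarith+
  have lx: "ln x \<le> 0" using x by simp
  have xl: "x ^ l = exp (real l * ln x)" using x by (simp add: exp_of_nat_mult)
  have np: "real n powr (a * ln x) = exp (a * ln (real n) * ln x)" using n by (simp add: powr_def mult_ac)
  show "real n powr (a * ln x) \<le> x ^ l"
    unfolding xl np using mult_right_mono_neg[OF l(1) lx] by simp
  have "exp (real l * ln x) \<le> exp ((a * ln (real n) - 1) * ln x)"
    using mult_right_mono_neg[OF l(2) lx] by simp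
  also have "\<dots> = exp (a * ln (real n) * ln x) / x" using x by (simp add: left_diff_distrib exp_diff)
  finally show "x ^ l \<le> real n powr (a * ln x) / x" unfolding xl np .
qed

context strictly_balanced_graph
begin

text \<open>The witness has edge density \<alpha> and copy density T \<le> la \<alpha>^s with la <
  1. Put A = - ln \<alpha> and B = - ln la. After about a ln n maps the host has edge density about
  n powr (- a A) and copy density at most about n powr (- a (s A + B)). At n powr \<delta> times the
  critical probability, n powr (e0 + \<delta> - a A) edges survive, and the ratio of copies to edges
  is n powr ((s - 1) (\<delta> - a A) - a B). So \<eta> = \<delta> - a A may be any positive number
  below a B / (s - 1); half of that is taken.\<close>

lemma not_sidorenko_lower_bound:
  assumes r: "r0 \<le> r" "2 \<le> r" and e0: "1 \<le> e0" and ns: "\<not> sidorenko r (expansion r0 r F)"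
  obtains \<delta> \<eta> c where "0 < \<delta>" "\<delta> \<le> 1 / 2" "\<delta> \<le> real r - e0" "0 < \<eta>" "0 < c"
    "aas (\<lambda>n. random_r_graph r n (if n = 0 then 1 else real n powr (e0 - real r + \<delta>)))
      (\<lambda>n G. c * real n powr (e0 + \<eta>) \<le> real (ex_number G (expansion r0 r F)))"
proof -
  let ?F = "expansion r0 r F" and ?K = "\<lambda>n. complete_edges n r"
  from ns obtain H0 :: "nat hypergraph" where H0: "r_graph r H0"
    and less: "hom_density ?F H0 < hom_density (single_edge r) H0 ^ s"
    by (auto simp: sidorenko_def num_edges_expansion[OF r(1)] not_le)
  define \<alpha> where "\<alpha> = hom_density (single_edge r) H0"
  define T where "T = hom_density ?F H0"
  have T0: "0 \<le> T" by (simp add: T_def hom_density_def)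
  have \<alpha>s: "0 < \<alpha> ^ s" using less T0 unfolding \<alpha>_def T_def by linarith
  have \<alpha>0: "0 \<le> \<alpha>" by (simp add: \<alpha>_def hom_density_def)
  then have \<alpha>: "0 < \<alpha>" using \<alpha>s s3 by (cases "\<alpha> = 0") (auto simp: zero_power)
  have finH0: "finite (verts H0)" using H0 by (simp add: r_graph_def)
  have neH0: "verts H0 \<noteq> {}"
  proof
    assume "verts H0 = {}"
    then have "\<alpha> = 0" using r(2) by (simp add: \<alpha>_def hom_density_def single_edge_def)
    then show False using \<alpha> by simp
  qed
  have \<alpha>1: "\<alpha> \<le> 1" unfolding \<alpha>_def by (rule hom_density_single_edge_le_1[OF finH0])
  \<comment> \<open>The maximum with 1 / 2 keeps \<open>la\<close> positive when T = 0, so that its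
    logarithm makes sense.\<close>
  define la where "la = max (T / \<alpha> ^ s) (1 / 2)"
  have la: "0 < la" "la < 1" "T \<le> la * \<alpha> ^ s"
  proof -
    show "0 < la" by (simp add: la_def)
    show "la < 1" using less \<alpha>s by (simp add: la_def \<alpha>_def T_def)
    have "T = T / \<alpha> ^ s * \<alpha> ^ s" using \<alpha>s by (metis less_irrefl nonzero_divide_eq_eq)
    also have "\<dots> \<le> la * \<alpha> ^ s" using \<alpha>s by (intro mult_right_mono) (auto simp: la_def)
    finally show "T \<le> la * \<alpha> ^ s" .
  qed
  define A where "A = - ln \<alpha>"
  define B where "B = - ln la"
  have A: "0 \<le> A" using \<alpha> \<alpha>1 by (simp add: A_def)
  have B: "0 < B" using la by (simp add: B_def)
  \<comment> \<open>The value for which \<delta> = a u splits as a A + \<eta>.\<close>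
  define u where "u = A + B / (2 * (real s - 1))"
  have u: "0 < u" using A B s3 by (simp add: u_def add_nonneg_pos)
  \<comment> \<open>The bound r - e0 ensures p \<le> 1; the bound 1 / 2 keeps p n^(r - 1) = n powr
    (e0 - 1 + \<delta>) below n powr e0.\<close>
  define \<delta> where "\<delta> = min (1 / 2) (real r - e0)"
  have \<delta>: "0 < \<delta>" "\<delta> \<le> 1 / 2" "\<delta> \<le> real r - e0"
    unfolding \<delta>_def by (use e0_less_r0 r in simp, rule min.cobounded1, rule min.cobounded2)
  define a where "a = \<delta> / u"
  have a: "0 < a" using \<delta> u by (simp add: a_def)
  define \<eta> where "\<eta> = a * B / (2 * (real s - 1))"
  have \<eta>: "0 < \<eta>" using a B s3 by (simp add: \<eta>_def)
  have \<delta>\<eta>: "\<delta> = a * A + \<eta>"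
  proof -
    have "\<delta> = a * u" using u by (simp add: a_def)
    also have "\<dots> = a * A + \<eta>" unfolding u_def \<eta>_def by (simp add: distrib_left)
    finally show ?thesis .
  qed
  have \<eta>s: "(real s - 1) * \<eta> = a * B / 2"
  proof -
    have *: "x * (y / (2 * x)) = y / 2" if "x \<noteq> 0" for x y :: real using that by simp
    show ?thesis unfolding \<eta>_def by (rule *) (use s3 in simp)
  qed
  define Ar where "Ar = real r ^ r"
  have Ar: "0 < Ar" using r by (simp add: Ar_def)
  define E where "E = inverse \<alpha> ^ (s - 1) * inverse la"
  have E: "0 < E" using \<alpha> la by (simp add: E_def)
  \<comment> \<open>\<open>0 powr x = 0\<close>, but \<open>p 0\<close> must be positive\<close>
  define p where "p n = (if n = 0 then 1 else real n powr (e0 - real r + \<delta>))" for n :: nat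
  have p: "0 < p n \<and> p n \<le> 1" for n
  proof (cases "n = 0")
    case False
    then have "real n powr (e0 - real r + \<delta>) \<le> real n powr 0" using \<delta> by (intro powr_mono) auto
    then show ?thesis using False by (simp add: p_def)
  qed (simp add: p_def)
  have ex: "\<forall>\<^sub>F n in sequentially. \<exists>H\<subseteq>?K n. real n powr (e0 + \<eta>) / (2 * Ar) \<le> p n * real (card H) \<and>
      p n ^ (s - 1) * ln n * real (card (copies_in ?F n H)) \<le> real (card H)"
  proof -
    have aB: "0 < a * B" using a B by simp
    have "\<forall>\<^sub>F n in sequentially. E * ln (real n) * real n powr (- (a * B / 2)) \<le> 1 / (2 * Ar)"
      using E Ar aB by real_asymp
    then show ?thesis
      using eventually_ge_at_top[of r] eventually_ge_at_top[of 3]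
    proof eventually_elim
      case (elim n)
      define L where "L = ln (real n)"
      have n: "r \<le> n" "0 < n" "1 \<le> n" "1 \<le> real n" using elim by auto
      have L: "0 \<le> L" using n by (simp add: L_def)
      define l where "l = nat \<lfloor>a * ln (real n)\<rfloor>"
      have a0: "0 \<le> a" using a by simp
      have bal: "real n powr (- (a * A)) \<le> \<alpha> ^ l" "\<alpha> ^ l \<le> real n powr (- (a * A)) * inverse \<alpha>"
        using power_floor_ln_bounds[OF \<alpha> \<alpha>1 a0 n(3)] by (simp_all add: l_def A_def divide_inverse)
      have bla: "la ^ l \<le> real n powr (- (a * B)) * inverse la"
        using power_floor_ln_bounds(2)[OF la(1) less_imp_le[OF la(2)] a0 n(3)] by (simp add: l_def B_def divide_inverse)
      have pn: "p n = real n powr (e0 - real r) * real n powr \<delta>" using n by (simp add: p_def powr_add)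
      define \<omega> where "\<omega> = p n ^ (s - 1) * L"
      have \<omega>: "0 \<le> \<omega>" using p[of n] L by (simp add: \<omega>_def)
      obtain H where H: "H \<subseteq> ?K n" and Hge: "real (n choose r) * \<alpha> ^ l - \<omega> * (real n ^ num_verts ?F * T ^ l)
          \<le> real (card H) - \<omega> * real (card (copies_in ?F n H))"
        using exists_preimage_hypergraph[OF finH0 neH0 expansion_finite[OF r(1)] expansion_edges_sub[OF r(1)] \<omega>, of n r l]
        unfolding \<alpha>_def T_def by blast
      have "T ^ l \<le> (la * \<alpha> ^ s) ^ l" using la T0 by (intro power_mono) auto
      also have "\<dots> = \<alpha> ^ l * ((\<alpha> ^ l) ^ (s - 1) * la ^ l)"
      proof -
        have "(\<alpha> ^ s) ^ l = (\<alpha> ^ l) ^ s" by (simp add: mult.commute flip: power_mult)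
        also have "\<dots> = \<alpha> ^ l * (\<alpha> ^ l) ^ (s - 1)" using s3 by (simp add: power_eq_if)
        finally show ?thesis by (simp add: power_mult_distrib)
      qed
      also have "\<dots> \<le> \<alpha> ^ l * ((real n powr (- (a * A)) * inverse \<alpha>) ^ (s - 1) * (real n powr (- (a * B)) * inverse la))"
        using bal bla \<alpha> la by (intro mult_left_mono mult_mono power_mono) auto
      also have "\<dots> = \<alpha> ^ l * (E * ((real n powr (- (a * A))) ^ (s - 1) * real n powr (- (a * B))))"
        by (simp add: E_def power_mult_distrib)
      finally have Tl: "T ^ l \<le> \<alpha> ^ l * (E * ((real n powr (- (a * A))) ^ (s - 1) * real n powr (- (a * B))))" .
      have "\<omega> * (real n ^ num_verts ?F * T ^ l) \<le>
         \<omega> * (real n ^ num_verts ?F * (\<alpha> ^ l * (E * ((real n powr (- (a * A))) ^ (s - 1) * real n powr (- (a * B))))))"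
        using Tl \<omega> by (intro mult_left_mono) auto
      also have "\<dots> = \<alpha> ^ l * (E * L * ((real n ^ num_verts ?F * (real n powr (e0 - real r)) ^ (s - 1)) *
         ((real n powr \<delta>) ^ (s - 1) * (real n powr (- (a * A))) ^ (s - 1) * real n powr (- (a * B)))))"
        by (simp add: \<omega>_def pn power_mult_distrib mult_ac)
      also have "real n ^ num_verts ?F * (real n powr (e0 - real r)) ^ (s - 1) = real n ^ r"
        by (rule critical_probability[OF r(1) n(2)])
      \<comment> \<open>The exponents add up to (s - 1) \<eta> - a B = - a B / 2, which outweighs
        the factor ln n in \<omega>.\<close>
      also have "(real n powr \<delta>) ^ (s - 1) * (real n powr (- (a * A))) ^ (s - 1) * real n powr (- (a * B)) = real n powr (- (a * B / 2))"
      proof -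
        have "(real n powr x) ^ (s - 1) = real n powr ((real s - 1) * x)" for x
          using n s3 by (simp add: powr_realpow[symmetric] powr_powr of_nat_diff mult.commute)
        then have "(real n powr \<delta>) ^ (s - 1) * (real n powr (- (a * A))) ^ (s - 1) * real n powr (- (a * B)) =
            real n powr ((real s - 1) * \<delta> + (real s - 1) * (- (a * A)) + (- (a * B)))"
          by (simp only: powr_add)
        also have "(real s - 1) * \<delta> + (real s - 1) * (- (a * A)) + (- (a * B)) = (real s - 1) * \<eta> - a * B"
          unfolding \<delta>\<eta> by (simp add: algebra_simps)
        also have "\<dots> = - (a * B / 2)" unfolding \<eta>s by simp
        finally show ?thesis .
      qed
      also have "\<alpha> ^ l * (E * L * (real n ^ r * real n powr (- (a * B / 2)))) =
          \<alpha> ^ l * real n ^ r * (E * L * real n powr (- (a * B / 2)))" by simp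
      also have "\<dots> \<le> \<alpha> ^ l * real n ^ r * (1 / (2 * Ar))"
        using elim(1) \<alpha> by (intro mult_left_mono) (auto simp: L_def)
      finally have small: "\<omega> * (real n ^ num_verts ?F * T ^ l) \<le> \<alpha> ^ l * real n ^ r / (2 * Ar)" by simp
      have "real n ^ r / Ar \<le> real (n choose r)" unfolding Ar_def using n r by (intro choose_ge_power) auto
      then have "real n ^ r / Ar * \<alpha> ^ l \<le> real (n choose r) * \<alpha> ^ l" using \<alpha> by (intro mult_right_mono) auto
      moreover have "real n ^ r / Ar * \<alpha> ^ l = 2 * (\<alpha> ^ l * real n ^ r / (2 * Ar))" by simp
      ultimately have low: "\<alpha> ^ l * real n ^ r / (2 * Ar) \<le> real (card H) - \<omega> * real (card (copies_in ?F n H))"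
        using Hge small by linarith
      have "0 \<le> \<alpha> ^ l * real n ^ r / (2 * Ar)" using \<alpha> Ar by simp
      then have c1: "\<omega> * real (card (copies_in ?F n H)) \<le> real (card H)" using low by linarith
      have "0 \<le> \<omega> * real (card (copies_in ?F n H))" using \<omega> by simp
      then have "\<alpha> ^ l * real n ^ r / (2 * Ar) \<le> real (card H)" using low by linarith
      then have "p n * (\<alpha> ^ l * real n ^ r / (2 * Ar)) \<le> p n * real (card H)" using p[of n] by (intro mult_left_mono) auto
      moreover have "real n powr (e0 + \<eta>) / (2 * Ar) \<le> p n * (\<alpha> ^ l * real n ^ r / (2 * Ar))"
      proof -
        have "real n powr (e0 + \<eta>) = p n * (real n powr (- (a * A)) * real n ^ r)"
          using n unfolding p_def by (simp add: powr_realpow[symmetric] powr_add[symmetric] \<delta>\<eta>)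
        also have "\<dots> \<le> p n * (\<alpha> ^ l * real n ^ r)" using p[of n] bal by (intro mult_left_mono mult_right_mono) auto
        finally have "real n powr (e0 + \<eta>) / (2 * Ar) \<le> p n * (\<alpha> ^ l * real n ^ r) / (2 * Ar)"
          using Ar by (intro divide_right_mono) auto
        then show ?thesis by simp
      qed
      ultimately show ?case using H c1 by (intro exI[of _ H]) (auto simp: \<omega>_def L_def)
    qed
  qed
  have "0 < e0 + \<eta>" using e0 \<eta> by simp
  then have lim: "filterlim (\<lambda>n. real n powr (e0 + \<eta>) / (2 * Ar)) at_top sequentially" using Ar by real_asymp
  have "aas (\<lambda>n. random_r_graph r n (p n)) (\<lambda>n G. real n powr (e0 + \<eta>) / (2 * Ar) / 2 \<le> real (ex_number G ?F))"
    by (rule aas_ex_number_ge_of_few_copies[OF r(1) p lim ex])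
  then have "aas (\<lambda>n. random_r_graph r n (p n)) (\<lambda>n G. 1 / (4 * Ar) * real n powr (e0 + \<eta>) \<le> real (ex_number G ?F))"
    by simp
  moreover have "0 < 1 / (4 * Ar)" using Ar by simp
  ultimately show ?thesis using that[OF \<delta> \<eta>] unfolding p_def by blast
qed

text \<open>At the chosen p both terms of the claimed maximum are of smaller order than n powr (e0 +
  \<eta>): the first because \<delta> \<le> 1 / 2, the second because it exceeds n powr e0 only by
  logarithms. Two incompatible events would both hold a.a.s.\<close>

theorem not_sidorenko_imp_not_turan_assertion:
  assumes deg: "2 \<le> max_degree F" and r: "r0 \<le> r" and ns: "\<not> sidorenko r (expansion r0 r F)"
  shows "\<not> turan_assertion r0 F r"
proof
  let ?F = "expansion r0 r F"
  assume "turan_assertion r0 F r"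
  then obtain c C where cC: "0 < c" "0 < C" and
    all: "\<And>p. \<forall>n. 0 < p n \<and> p n \<le> 1 \<Longrightarrow> upper_range r0 F r c C p"
    by (auto simp: turan_assertion_def)
  have r0: "2 \<le> r0" and e0: "1 \<le> e0" using e0_gt_1[OF deg] by auto
  have r2: "2 \<le> r" using r0 r by simp
  obtain \<delta> \<eta> b where \<delta>: "0 < \<delta>" "\<delta> \<le> 1 / 2" "\<delta> \<le> real r - e0" and \<eta>: "0 < \<eta>" and b: "0 < b" and
    lower: "aas (\<lambda>n. random_r_graph r n (if n = 0 then 1 else real n powr (e0 - real r + \<delta>)))
      (\<lambda>n G. b * real n powr (e0 + \<eta>) \<le> real (ex_number G ?F))"
    by (rule not_sidorenko_lower_bound[OF r r2 e0 ns]) blast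
  define p where "p n = (if n = 0 then 1 else real n powr (e0 - real r + \<delta>))" for n :: nat
  have p: "\<forall>n. 0 < p n \<and> p n \<le> 1"
  proof
    fix n
    show "0 < p n \<and> p n \<le> 1"
    proof (cases "n = 0")
      case False
      then have "real n powr (e0 - real r + \<delta>) \<le> real n powr 0" using \<delta> by (intro powr_mono) auto
      then show ?thesis using False by (simp add: p_def)
    qed (simp add: p_def)
  qed
  have eq: "- real r + real r0 - 1 / max_density r0 F = e0 - real r" using e0_eq by simp
  have "(\<lambda>n. real n powr (e0 - real r)) \<lless> p"
    unfolding much_less_def
  proof (rule Lim_transform_eventually)
    show "(\<lambda>n. real n powr (- \<delta>)) \<longlonglongrightarrow> 0" using \<delta> by real_asymp
    show "\<forall>\<^sub>F n in sequentially. real n powr (- \<delta>) = real n powr (e0 - real r) / p n"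
      using eventually_gt_at_top[of 0] by eventually_elim (simp add: p_def powr_diff[symmetric])
  qed
  then have "aas (\<lambda>n. random_r_graph r n (p n))
      (\<lambda>n G. real (ex_number G ?F) \<le> max (C * p n * real n ^ (r - 1)) (real n powr e0 * ln (real n) powr C))"
    using all[OF p] unfolding upper_range_def Let_def eq e0_eq
    by (auto elim!: aas_mono intro!: always_eventually)
  from aas_conj[OF lower[folded p_def] this] have "aas (\<lambda>n. random_r_graph r n (p n)) (\<lambda>n G. False)"
  proof (rule aas_mono)
    have "\<forall>\<^sub>F n in sequentially. C * real n powr (e0 - 1 / 2) < b * real n powr (e0 + \<eta>)"
      using cC b \<eta> by real_asymp
    moreover have "\<forall>\<^sub>F n in sequentially. real n powr e0 * ln (real n) powr C < b * real n powr (e0 + \<eta>)"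
      using cC b \<eta> by real_asymp
    ultimately show "\<forall>\<^sub>F n in sequentially. \<forall>G\<in>set_pmf (random_r_graph r n (p n)).
        b * real n powr (e0 + \<eta>) \<le> real (ex_number G ?F) \<and>
        real (ex_number G ?F) \<le> max (C * p n * real n ^ (r - 1)) (real n powr e0 * ln (real n) powr C) \<longrightarrow> False"
      using eventually_ge_at_top[of 1]
    proof eventually_elim
      case (elim n)
      have "p n * real n ^ (r - 1) = real n powr (e0 - real r + \<delta> + real (r - 1))"
        using elim(3) by (simp add: p_def powr_add powr_realpow)
      also have "e0 - real r + \<delta> + real (r - 1) = e0 - 1 + \<delta>" using r2 by (simp add: of_nat_diff)
      also have "real n powr (e0 - 1 + \<delta>) \<le> real n powr (e0 - 1 / 2)" using elim(3) \<delta> by (intro powr_mono) auto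
      finally have "C * p n * real n ^ (r - 1) \<le> C * real n powr (e0 - 1 / 2)" using cC by (simp add: mult.assoc)
      then have "max (C * p n * real n ^ (r - 1)) (real n powr e0 * ln (real n) powr C) < b * real n powr (e0 + \<eta>)"
        using elim(1,2) by simp
      then show ?case by auto
    qed
  qed
  then show False by (simp add: aas_def LIMSEQ_const_iff)
qed

end

theorem theorem2p1:
  fixes F :: "'a hypergraph" and r0 :: nat
  assumes "r_graph r0 F"
    and "strictly_balanced r0 F"
    and "2 \<le> max_degree F"
    and "max_degree F < num_edges F"
  shows "(sidorenko r0 F \<longrightarrow>
            (\<forall>r. r > (num_edges F)^2 * num_verts F * r0 \<longrightarrow> turan_assertion r0 F r))
       \<and> (\<not> (\<exists>k\<ge>r0. sidorenko k (expansion r0 k F)) \<longrightarrow>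
            (\<forall>r\<ge>r0. \<not> turan_assertion r0 F r))"
proof -
  interpret strictly_balanced_graph F r0
    using assms by unfold_locales
  show ?thesis
    using sidorenko_imp_turan_assertion not_sidorenko_imp_not_turan_assertion assms by blast
qed

end
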